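(* Let $(\mathbb{M},g)$ be a $C^\infty$ connected Riemannian manifold of dimension $d$, with orthonormal frame bundle $\pi:\mathcal{O}(\mathbb{M})\to\mathbb{M}$, fundamental horizontal vector fields $H_1,\dots,H_d$ and curvature form $\Omega$, and let $\mathfrak{so}_d(\mathbb{R})$ be equipped with an inner product. Assume that: (1) the Ricci tensor $\mathrm{Ric}$ of $\mathbb{M}$ is a Codazzi tensor, i.e. $(\nabla_X\mathrm{Ric})(Y,Z)=(\nabla_Y\mathrm{Ric})(X,Z)$ for all vector fields $X,Y,Z$ on $\mathbb{M}$; (2) there exists $\rho_1\ge0$ such that $\mathrm{Ric}\ge\rho_1$; (3) there exists $\rho_2>0$ such that for every $U\in\mathfrak{so}_d(\mathbb{R})$, $\sum_{j,k=1}^d\langle\Omega(H_j,H_k),U\rangle^2\ge4\rho_2\|U\|^2$ on $\mathcal{O}(\mathbb{M})$; (4) there exists $\kappa\ge0$ such that for every horizontal vector field $X$ on $\mathcal{O}(\mathbb{M})$, $\sum_{i=1}^d\|\Omega(H_i,X)\|^2\le\kappa\|X\|^2$. Then the horizontal Bochner operator $L=\sum_{i=1}^dH_i^2$ of $\mathcal{O}(\mathbb{M})$ satisfies the generalized curvature-dimension inequality $\mathrm{CD}(\rho_1,\rho_2,\kappa,d)$ with respect to $\Gamma^Z$: for every $f\in C^\infty(\mathcal{O}(\mathbb{M}))$ and $\nu>0$, $$\Gamma_2(f)+\nu\,\Gamma_2^Z(f)\ \ge\ \frac1d(Lf)^2+\Big(\rho_1-\frac\kappa\nu\Big)\Ga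mma(f)+\rho_2\,\Gamma^Z(f).$$
   Context: Points $u\in\mathcal{O}(\mathbb{M})$ are viewed as isometries $u:\mathbb{R}^d\to T_{\pi(u)}\mathbb{M}$. The horizontal distribution $\mathcal{H}$ is the kernel of the Levi-Civita connection form; $H_i(u)$ is the horizontal lift at $u$ of $u(e_i)$, with $(e_i)$ the canonical basis of $\mathbb{R}^d$, and $\mathcal{H}$ is given the inner product for which $H_1,\dots,H_d$ are orthonormal. For $M\in\mathfrak{so}_d(\mathbb{R})$ (skew-symmetric $d\times d$ matrices) the vertical field $V_M$ is $(V_MF)(u)=\lim_{t\to0}\frac{F(ue^{tM})-F(u)}{t}$; vertical vector fields are endowed with the inner product for which $M\mapsto V_M(u)$ is an isometry from $\mathfrak{so}_d(\mathbb{R})$ onto the vertical space at each $u$. The curvature form is $\Omega(X,Y)(u)=u^{-1}R(\pi_*X,\pi_*Y)u\in\mathfrak{so}_d(\mathbb{R})$ for $X,Y\in T_u\mathcal{O}(\mathbb{M})$, with $R$ the Riemannian curvature tensor of $\mathbb{M}$. $\Gamma(f,g)=\frac12(L(fg)-fLg-gLf)=\sum_i(H_if)(H_ig)$; $\Gamma^Z(f,g)=\sum_m(V_{M_m}f)(V_{M_m}g)$ for an orthonormal basis $(M_m)$ of $\mathfrak{so}_d(\mathbb{R})$; $\Gamma(f)=\Gamma(f,f)$, $\Gamma^Z(f)=\Gamma^Z(f,f)$, $\Gamma_2(f)=\frac12[L\Gamma(f)-2\Gamma(f,Lf)]$, $\Gamma_2^Z(f)=\frac12[L\Gamma^Z(f)-2\Gamma^Z(f,Lf)]$.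 *)

theory Defs
  imports "HOL-Analysis.Analysis" "HOL-Library.Function_Algebras"
begin

section \<open>Vector spaces of functions and inner products on subspaces\<close>

text \<open>Tangent vectors will be functions from charts to coordinates, with pointwise operations.\<close>

instantiation "fun" :: (type, real_vector) real_vector
begin

definition "scaleR_fun r f = (\<lambda>x. r *\<^sub>R f x)"

instance
  by standard (auto simp: scaleR_fun_def plus_fun_def scaleR_add_left scaleR_add_right)

end

definition inner_product_on :: "'v::real_vector set \<Rightarrow> ('v \<Rightarrow> 'v \<Rightarrow> real) \<Rightarrow> bool" where
  "inner_product_on S ip \<longleftrightarrow>
     (\<forall>x\<in>S. \<forall>y\<in>S. ip x y = ip y x) \<and>
     (\<forall>x\<in>S. \<forall>y\<in>S. \<forall>z\<in>S. ip (x + y) z = ip x z + ip y z) \<and>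
     (\<forall>r. \<forall>x\<in>S. \<forall>y\<in>S. ip (r *\<^sub>R x) y = r * ip x y) \<and>
     (\<forall>x\<in>S. x \<noteq> 0 \<longrightarrow> ip x x > 0)"

definition orthonormal_basis_of ::
  "'v::real_vector set \<Rightarrow> ('v \<Rightarrow> 'v \<Rightarrow> real) \<Rightarrow> 'v set \<Rightarrow> bool" where
  "orthonormal_basis_of S ip B \<longleftrightarrow>
     finite B \<and> B \<subseteq> S \<and> span B = S \<and>
     (\<forall>x\<in>B. \<forall>y\<in>B. ip x y = (if x = y then 1 else 0))"


section \<open>Smooth functions between Euclidean spaces\<close>

primrec Ck_on ::
  "nat \<Rightarrow> 'a::real_normed_vector set \<Rightarrow> ('a \<Rightarrow> 'b::real_normed_vector) \<Rightarrow> bool" where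
  "Ck_on 0 S f \<longleftrightarrow> continuous_on S f"
| "Ck_on (Suc k) S f \<longleftrightarrow>
     (\<forall>x\<in>S. f differentiable (at x)) \<and>
     (\<forall>v. Ck_on k S (\<lambda>x. frechet_derivative f (at x) v))"

text \<open>Only used for open \<open>S\<close>.\<close>

definition smooth_on ::
  "'a::real_normed_vector set \<Rightarrow> ('a \<Rightarrow> 'b::real_normed_vector) \<Rightarrow> bool" where
  "smooth_on S f \<longleftrightarrow> (\<forall>k. Ck_on k S f)"


section \<open>Smooth functions, tangent vectors and vector fields in families of charts\<close>

text \<open>
  The same definitions serve a manifold and its orthonormal frame bundle.  A family of charts is
  an index set \<open>A\<close> with a map \<open>K\<close> from indices to charts (domain and coordinate map).
  The images of the coordinate maps are open sets for the manifold, and embedded submanifolds of a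
  Euclidean space for the frame bundle.  Accordingly a function is smooth if, in every chart, it
  extends locally to a smooth function on an open set of the Euclidean space; if the image is
  open, this says that its coordinate expression is smooth.
\<close>

type_synonym ('p, 'e) chart = "'p set \<times> ('p \<Rightarrow> 'e)"

definition smooth_in_chart ::
  "('p, 'e::real_normed_vector) chart \<Rightarrow> ('p \<Rightarrow> 'b::real_normed_vector) \<Rightarrow> bool" where
  "smooth_in_chart c f \<longleftrightarrow>
     (\<forall>p\<in>fst c. \<exists>W h. open W \<and> snd c p \<in> W \<and> smooth_on W h \<and>
        (\<forall>q\<in>fst c. snd c q \<in> W \<longrightarrow> f q = h (snd c q)))"

definition smooth_fun ::
  "'i set \<Rightarrow> ('i \<Rightarrow> ('p, 'e::real_normed_vector) chart) \<Rightarrow> ('p \<Rightarrow> real) \<Rightarrow> bool" where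
  "smooth_fun A K f \<longleftrightarrow> (\<forall>c\<in>A. smooth_in_chart (K c) f)"

text \<open>
  Tangent vectors are velocities of curves.  A tangent vector at \<open>p\<close> is recorded by its
  coordinates in every chart around \<open>p\<close>, and is \<open>0\<close> by convention at all other indices.
\<close>

definition has_velocity ::
  "'i set \<Rightarrow> ('i \<Rightarrow> ('p, 'e::real_normed_vector) chart) \<Rightarrow> (real \<Rightarrow> 'p) \<Rightarrow> 'p \<Rightarrow> ('i \<Rightarrow> 'e) \<Rightarrow> bool"
  where
  "has_velocity A K \<gamma> p v \<longleftrightarrow>
     \<gamma> 0 = p \<and>
     (\<forall>c. if c \<in> A \<and> p \<in> fst (K c)
          then (\<forall>\<^sub>F t in nhds 0. \<gamma> t \<in> fst (K c)) \<and>
               ((\<lambda>t. snd (K c) (\<gamma> t)) has_vector_derivative v c) (at 0)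
          else v c = 0)"

definition tangent_space ::
  "'i set \<Rightarrow> ('i \<Rightarrow> ('p, 'e::real_normed_vector) chart) \<Rightarrow> 'p \<Rightarrow> ('i \<Rightarrow> 'e) set" where
  "tangent_space A K p = {v. \<exists>\<gamma>. has_velocity A K \<gamma> p v}"

definition vector_field ::
  "'i set \<Rightarrow> ('i \<Rightarrow> ('p, 'e::real_normed_vector) chart) \<Rightarrow> ('p \<Rightarrow> 'i \<Rightarrow> 'e) \<Rightarrow> bool" where
  "vector_field A K X \<longleftrightarrow>
     (\<forall>p\<in>(\<Union>c\<in>A. fst (K c)). X p \<in> tangent_space A K p) \<and>
     (\<forall>c\<in>A. smooth_in_chart (K c) (\<lambda>p. X p c))"

text \<open>For smooth \<open>f\<close> the derivative does not depend on the curve with velocity \<open>v\<close>.\<close>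

definition deriv_along ::
  "'i set \<Rightarrow> ('i \<Rightarrow> ('p, 'e::real_normed_vector) chart) \<Rightarrow> ('p \<Rightarrow> real) \<Rightarrow> 'p \<Rightarrow> ('i \<Rightarrow> 'e) \<Rightarrow> real"
  where
  "deriv_along A K f p v =
     (THE D. \<forall>\<gamma>. has_velocity A K \<gamma> p v \<longrightarrow> ((\<lambda>t. f (\<gamma> t)) has_real_derivative D) (at 0))"


section \<open>Riemannian manifolds\<close>

type_synonym ('a, 'n) mchart = "('a, (real, 'n) vec) chart"
type_synonym ('a, 'n) tvec = "('a, 'n) mchart \<Rightarrow> (real, 'n) vec"
type_synonym ('a, 'n) metric = "'a \<Rightarrow> ('a, 'n) tvec \<Rightarrow> ('a, 'n) tvec \<Rightarrow> real"

definition chart_inv :: "('a, 'n) mchart \<Rightarrow> (real, 'n::finite) vec \<Rightarrow> 'a" where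
  "chart_inv c = inv_into (fst c) (snd c)"

definition smooth_manifold :: "'a topology \<Rightarrow> ('a, 'n::finite) mchart set \<Rightarrow> bool" where
  "smooth_manifold X A \<longleftrightarrow>
     Hausdorff_space X \<and> second_countable X \<and>
     (\<Union>c\<in>A. fst c) = topspace X \<and>
     (\<forall>c\<in>A. openin X (fst c) \<and> open (snd c ` fst c) \<and>
        homeomorphic_map (subtopology X (fst c)) (top_of_set (snd c ` fst c)) (snd c)) \<and>
     (\<forall>c\<in>A. \<forall>c'\<in>A. smooth_on (snd c ` (fst c \<inter> fst c')) (\<lambda>x. snd c' (chart_inv c x)))"

abbreviation TM :: "('a, 'n::finite) mchart set \<Rightarrow> 'a \<Rightarrow> ('a, 'n) tvec set" where
  "TM A \<equiv> tangent_space A (\<lambda>c. c)"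

definition coord_tvec ::
  "('a, 'n::finite) mchart set \<Rightarrow> ('a, 'n) mchart \<Rightarrow> 'a \<Rightarrow> real^'n \<Rightarrow> ('a, 'n) tvec" where
  "coord_tvec A c p a = (THE v. v \<in> TM A p \<and> v c = a)"

definition metric_matrix ::
  "('a, 'n::finite) mchart set \<Rightarrow> ('a, 'n) metric \<Rightarrow> ('a, 'n) mchart \<Rightarrow> real^'n \<Rightarrow> real^'n^'n" where
  "metric_matrix A g c x =
     (\<chi> i j. g (chart_inv c x) (coord_tvec A c (chart_inv c x) (axis i 1))
                              (coord_tvec A c (chart_inv c x) (axis j 1)))"

definition riemannian_manifold ::
  "'a topology \<Rightarrow> ('a, 'n::finite) mchart set \<Rightarrow> ('a, 'n) metric \<Rightarrow> bool" where
  "riemannian_manifold X A g \<longleftrightarrow>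
     smooth_manifold X A \<and>
     (\<forall>p\<in>topspace X. inner_product_on (TM A p) (g p)) \<and>
     (\<forall>c\<in>A. smooth_on (snd c ` fst c) (metric_matrix A g c))"


section \<open>Levi-Civita connection and curvature\<close>

text \<open>
  The constants prefixed with \<open>local_\<close> are coordinate expressions on an open subset of
  Euclidean space, for a metric given by its matrix \<open>G\<close>; vector fields are given by their
  components.
\<close>

definition partial :: "'n \<Rightarrow> (real^'n \<Rightarrow> real) \<Rightarrow> real^'n \<Rightarrow> real" where
  "partial i h x = frechet_derivative h (at x) (axis i 1)"

text \<open>\<open>local_christoffel G x k i j\<close> is the Christoffel symbol with upper index \<open>k\<close> and lower
  indices \<open>i j\<close>.\<close>

definition local_christoffel ::
  "(real^'n \<Rightarrow> real^'n^'n) \<Rightarrow> real^'n \<Rightarrow> 'n \<Rightarrow> 'n \<Rightarrow> 'n \<Rightarrow> real" where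
  "local_christoffel G x k i j =
     1/2 * (\<Sum>l\<in>UNIV. matrix_inv (G x) $ k $ l *
       (partial i (\<lambda>y. G y $ j $ l) x + partial j (\<lambda>y. G y $ i $ l) x
        - partial l (\<lambda>y. G y $ i $ j) x))"

definition local_chr :: "(real^'n \<Rightarrow> real^'n^'n) \<Rightarrow> real^'n \<Rightarrow> real^'n \<Rightarrow> real^'n \<Rightarrow> real^'n" where
  "local_chr G x v w =
     (\<chi> k. \<Sum>i\<in>UNIV. \<Sum>j\<in>UNIV. local_christoffel G x k i j * v $ i * w $ j)"

definition local_nabla ::
  "(real^'n \<Rightarrow> real^'n^'n) \<Rightarrow> (real^'n \<Rightarrow> real^'n) \<Rightarrow> (real^'n \<Rightarrow> real^'n) \<Rightarrow> real^'n \<Rightarrow> real^'n" where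
  "local_nabla G X Y x = frechet_derivative Y (at x) (X x) + local_chr G x (X x) (Y x)"

text \<open>
  The tensor \<open>R(X,Y)Z = \<nabla>\<^sub>X \<nabla>\<^sub>Y Z - \<nabla>\<^sub>Y \<nabla>\<^sub>X Z - \<nabla>\<^bsub>[X,Y]\<^esub> Z\<close>, evaluated on vectors at \<open>x\<close>
  through their extensions with constant components, for which \<open>[X,Y] = 0\<close>.
\<close>

definition local_riemann ::
  "(real^'n \<Rightarrow> real^'n^'n) \<Rightarrow> real^'n \<Rightarrow> real^'n \<Rightarrow> real^'n \<Rightarrow> real^'n \<Rightarrow> real^'n" where
  "local_riemann G x v w z =
     local_nabla G (\<lambda>_. v) (local_nabla G (\<lambda>_. w) (\<lambda>_. z)) x
   - local_nabla G (\<lambda>_. w) (local_nabla G (\<lambda>_. v) (\<lambda>_. z)) x"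

definition nabla ::
  "('a, 'n::finite) mchart set \<Rightarrow> ('a, 'n) metric \<Rightarrow>
   ('a \<Rightarrow> ('a, 'n) tvec) \<Rightarrow> ('a \<Rightarrow> ('a, 'n) tvec) \<Rightarrow> 'a \<Rightarrow> ('a, 'n) tvec" where
  "nabla A g X Y p =
     (\<lambda>c. if c \<in> A \<and> p \<in> fst c
          then local_nabla (metric_matrix A g c)
                 (\<lambda>x. X (chart_inv c x) c) (\<lambda>x. Y (chart_inv c x) c) (snd c p)
          else 0)"

definition riemann ::
  "('a, 'n::finite) mchart set \<Rightarrow> ('a, 'n) metric \<Rightarrow>
   'a \<Rightarrow> ('a, 'n) tvec \<Rightarrow> ('a, 'n) tvec \<Rightarrow> ('a, 'n) tvec \<Rightarrow> ('a, 'n) tvec" where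
  "riemann A g p v w z =
     (\<lambda>c. if c \<in> A \<and> p \<in> fst c
          then local_riemann (metric_matrix A g c) (snd c p) (v c) (w c) (z c)
          else 0)"

definition chart_at :: "('a, 'n::finite) mchart set \<Rightarrow> 'a \<Rightarrow> ('a, 'n) mchart" where
  "chart_at A p = (SOME c. c \<in> A \<and> p \<in> fst c)"

text \<open>\<open>Ric(v,w)\<close> is the trace of \<open>X \<mapsto> R(X,v)w\<close>, computed in the coordinate basis of some chart.\<close>

definition ricci ::
  "('a, 'n::finite) mchart set \<Rightarrow> ('a, 'n) metric \<Rightarrow> 'a \<Rightarrow> ('a, 'n) tvec \<Rightarrow> ('a, 'n) tvec \<Rightarrow> real" where
  "ricci A g p v w =
     (let c = chart_at A p
      in \<Sum>i\<in>UNIV. riemann A g p (coord_tvec A c p (axis i 1)) v w c $ i)"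

definition nabla_tensor ::
  "('a, 'n::finite) mchart set \<Rightarrow> ('a, 'n) metric \<Rightarrow> ('a \<Rightarrow> ('a, 'n) tvec \<Rightarrow> ('a, 'n) tvec \<Rightarrow> real) \<Rightarrow>
   ('a \<Rightarrow> ('a, 'n) tvec) \<Rightarrow> ('a \<Rightarrow> ('a, 'n) tvec) \<Rightarrow> ('a \<Rightarrow> ('a, 'n) tvec) \<Rightarrow> 'a \<Rightarrow> real" where
  "nabla_tensor A g T X Y Z p =
     deriv_along A (\<lambda>c. c) (\<lambda>q. T q (Y q) (Z q)) p (X p)
     - T p (nabla A g X Y p) (Z p) - T p (Y p) (nabla A g X Z p)"

definition codazzi_tensor ::
  "('a, 'n::finite) mchart set \<Rightarrow> ('a, 'n) metric \<Rightarrow>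
   ('a \<Rightarrow> ('a, 'n) tvec \<Rightarrow> ('a, 'n) tvec \<Rightarrow> real) \<Rightarrow> bool" where
  "codazzi_tensor A g T \<longleftrightarrow>
     (\<forall>X Y Z. vector_field A (\<lambda>c. c) X \<and> vector_field A (\<lambda>c. c) Y \<and> vector_field A (\<lambda>c. c) Z \<longrightarrow>
        (\<forall>p\<in>(\<Union>c\<in>A. fst c). nabla_tensor A g T X Y Z p = nabla_tensor A g T Y X Z p))"


section \<open>The orthonormal frame bundle\<close>

text \<open>A frame at \<open>p\<close> is a linear isometry \<open>u\<close> from Euclidean space to the tangent space at \<open>p\<close>.\<close>

type_synonym ('a, 'n) frame = "'a \<times> ((real, 'n) vec \<Rightarrow> ('a, 'n) tvec)"
type_synonym ('a, 'n) ftvec =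
  "('a, 'n) mchart \<Rightarrow> (real, 'n) vec \<times> ((real, 'n) vec, 'n) vec"

definition frame_bundle ::
  "('a, 'n::finite) mchart set \<Rightarrow> ('a, 'n) metric \<Rightarrow> ('a, 'n) frame set" where
  "frame_bundle A g =
     {(p, u). p \<in> (\<Union>c\<in>A. fst c) \<and> linear u \<and> (\<forall>x. u x \<in> TM A p) \<and>
              (\<forall>x y. g p (u x) (u y) = x \<bullet> y)}"

text \<open>
  A chart \<open>c\<close> of the manifold gives the coordinates \<open>(x, E)\<close> of a frame: \<open>x\<close> the coordinates of the
  base point, \<open>E\<close> the matrix of \<open>u\<close>.  The image is the embedded submanifold of all
  \<open>(x, E)\<close> with \<open>E\<^sup>T G(x) E = 1\<close>, where \<open>G\<close> is the matrix of the metric.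
\<close>

definition frame_chart ::
  "('a, 'n::finite) mchart set \<Rightarrow> ('a, 'n) metric \<Rightarrow> ('a, 'n) mchart \<Rightarrow>
   (('a, 'n) frame, (real^'n) \<times> (real^'n^'n)) chart" where
  "frame_chart A g c =
     ({U \<in> frame_bundle A g. fst U \<in> fst c},
      \<lambda>U. (snd c (fst U), matrix (\<lambda>x. snd U x c)))"

abbreviation TO ::
  "('a, 'n::finite) mchart set \<Rightarrow> ('a, 'n) metric \<Rightarrow> ('a, 'n) frame \<Rightarrow> ('a, 'n) ftvec set" where
  "TO A g \<equiv> tangent_space A (frame_chart A g)"

definition dproj :: "('a, 'n::finite) ftvec \<Rightarrow> ('a, 'n) tvec" where
  "dproj \<xi> = (\<lambda>c. fst (\<xi> c))"

text \<open>
  The Levi-Civita connection form: for a curve \<open>(x(t), E(t))\<close> of frames it is the matrix of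
  \<open>u\<^sup>-\<^sup>1 (Du/dt)\<close>, where the covariant derivative of the columns of \<open>E\<close> is \<open>E' + \<Gamma>(x', E)\<close>.
\<close>

definition connection_form ::
  "('a, 'n::finite) mchart set \<Rightarrow> ('a, 'n) metric \<Rightarrow> ('a, 'n) frame \<Rightarrow> ('a, 'n) ftvec \<Rightarrow> real^'n^'n" where
  "connection_form A g U \<xi> =
     (let c = chart_at A (fst U); E = matrix (\<lambda>x. snd U x c)
      in matrix_inv E **
           (snd (\<xi> c) +
            matrix (\<lambda>y. local_chr (metric_matrix A g c) (snd c (fst U)) (fst (\<xi> c)) (E *v y))))"

definition horizontal_space ::
  "('a, 'n::finite) mchart set \<Rightarrow> ('a, 'n) metric \<Rightarrow> ('a, 'n) frame \<Rightarrow> ('a, 'n) ftvec set" where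
  "horizontal_space A g U = {\<xi> \<in> TO A g U. connection_form A g U \<xi> = 0}"

definition horizontal_lift ::
  "('a, 'n::finite) mchart set \<Rightarrow> ('a, 'n) metric \<Rightarrow> ('a, 'n) frame \<Rightarrow> ('a, 'n) tvec \<Rightarrow> ('a, 'n) ftvec" where
  "horizontal_lift A g U v = (THE \<xi>. \<xi> \<in> horizontal_space A g U \<and> dproj \<xi> = v)"

definition fundamental_field ::
  "('a, 'n::finite) mchart set \<Rightarrow> ('a, 'n) metric \<Rightarrow> 'n \<Rightarrow> ('a, 'n) frame \<Rightarrow> ('a, 'n) ftvec" where
  "fundamental_field A g i U =
     horizontal_lift A g U (snd U (axis i 1))"

definition horizontal_vector_field ::
  "('a, 'n::finite) mchart set \<Rightarrow> ('a, 'n) metric \<Rightarrow> (('a, 'n) frame \<Rightarrow> ('a, 'n) ftvec) \<Rightarrow> bool" where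
  "horizontal_vector_field A g X \<longleftrightarrow>
     vector_field A (frame_chart A g) X \<and>
     (\<forall>U\<in>frame_bundle A g. X U \<in> horizontal_space A g U)"

text \<open>The inner product on horizontal vectors for which the fundamental fields are orthonormal.\<close>

definition horizontal_coeffs ::
  "('a, 'n::finite) mchart set \<Rightarrow> ('a, 'n) metric \<Rightarrow> ('a, 'n) frame \<Rightarrow> ('a, 'n) ftvec \<Rightarrow> real^'n" where
  "horizontal_coeffs A g U \<xi> = (THE a. \<xi> = (\<Sum>i\<in>UNIV. a $ i *\<^sub>R fundamental_field A g i U))"

definition horizontal_inner ::
  "('a, 'n::finite) mchart set \<Rightarrow> ('a, 'n) metric \<Rightarrow> ('a, 'n) frame \<Rightarrow>
   ('a, 'n) ftvec \<Rightarrow> ('a, 'n) ftvec \<Rightarrow> real" where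
  "horizontal_inner A g U \<xi> \<eta> = horizontal_coeffs A g U \<xi> \<bullet> horizontal_coeffs A g U \<eta>"

definition curvature_form ::
  "('a, 'n::finite) mchart set \<Rightarrow> ('a, 'n) metric \<Rightarrow> ('a, 'n) frame \<Rightarrow>
   ('a, 'n) ftvec \<Rightarrow> ('a, 'n) ftvec \<Rightarrow> real^'n^'n" where
  "curvature_form A g U \<xi> \<eta> =
     matrix (\<lambda>x. inv (snd U) (riemann A g (fst U) (dproj \<xi>) (dproj \<eta>) (snd U x)))"


section \<open>Differential operators on the frame bundle\<close>

definition skew_matrices :: "(real^'n^'n) set" where
  "skew_matrices = {M. transpose M = - M}"

definition mat_exp :: "real^'n^'n \<Rightarrow> real^'n^'n" where
  "mat_exp M = (\<Sum>k. (1 / fact k) *\<^sub>R ((\<lambda>N. M ** N) ^^ k) (mat 1))"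

definition Vder ::
  "real^'n^'n \<Rightarrow> (('a, 'n::finite) frame \<Rightarrow> real) \<Rightarrow> ('a, 'n) frame \<Rightarrow> real" where
  "Vder M F U =
     Lim (at 0) (\<lambda>t::real. (F (fst U, \<lambda>x. snd U (mat_exp (t *\<^sub>R M) *v x)) - F U) / t)"

definition Hder ::
  "('a, 'n::finite) mchart set \<Rightarrow> ('a, 'n) metric \<Rightarrow> 'n \<Rightarrow>
   (('a, 'n) frame \<Rightarrow> real) \<Rightarrow> ('a, 'n) frame \<Rightarrow> real" where
  "Hder A g i F U = deriv_along A (frame_chart A g) F U (fundamental_field A g i U)"

definition horizontal_bochner ::
  "('a, 'n::finite) mchart set \<Rightarrow> ('a, 'n) metric \<Rightarrow>
   (('a, 'n) frame \<Rightarrow> real) \<Rightarrow> ('a, 'n) frame \<Rightarrow> real" where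
  "horizontal_bochner A g F U = (\<Sum>i\<in>UNIV. Hder A g i (Hder A g i F) U)"

definition carre_du_champ ::
  "(('p \<Rightarrow> real) \<Rightarrow> 'p \<Rightarrow> real) \<Rightarrow> ('p \<Rightarrow> real) \<Rightarrow> ('p \<Rightarrow> real) \<Rightarrow> 'p \<Rightarrow> real" where
  "carre_du_champ L f h x =
     1/2 * (L (\<lambda>y. f y * h y) x - f x * L h x - h x * L f x)"

text \<open>\<open>B\<close> is an orthonormal basis of the skew-symmetric matrices.\<close>

definition GammaZ ::
  "(real^'n^'n) set \<Rightarrow> (('a, 'n::finite) frame \<Rightarrow> real) \<Rightarrow> (('a, 'n) frame \<Rightarrow> real) \<Rightarrow>
   ('a, 'n) frame \<Rightarrow> real" where
  "GammaZ B f h U = (\<Sum>M\<in>B. Vder M f U * Vder M h U)"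

definition iterated_form ::
  "(('p \<Rightarrow> real) \<Rightarrow> 'p \<Rightarrow> real) \<Rightarrow> (('p \<Rightarrow> real) \<Rightarrow> ('p \<Rightarrow> real) \<Rightarrow> 'p \<Rightarrow> real) \<Rightarrow>
   ('p \<Rightarrow> real) \<Rightarrow> 'p \<Rightarrow> real" where
  "iterated_form L Q f x = 1/2 * (L (Q f f) x - 2 * Q f (L f) x)"

definition Gamma ::
  "('a, 'n::finite) mchart set \<Rightarrow> ('a, 'n) metric \<Rightarrow>
   (('a, 'n) frame \<Rightarrow> real) \<Rightarrow> (('a, 'n) frame \<Rightarrow> real) \<Rightarrow> ('a, 'n) frame \<Rightarrow> real" where
  "Gamma A g = carre_du_champ (horizontal_bochner A g)"

definition Gamma2 ::
  "('a, 'n::finite) mchart set \<Rightarrow> ('a, 'n) metric \<Rightarrow>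
   (('a, 'n) frame \<Rightarrow> real) \<Rightarrow> ('a, 'n) frame \<Rightarrow> real" where
  "Gamma2 A g = iterated_form (horizontal_bochner A g) (Gamma A g)"

definition GammaZ2 ::
  "('a, 'n::finite) mchart set \<Rightarrow> ('a, 'n) metric \<Rightarrow> (real^'n^'n) set \<Rightarrow>
   (('a, 'n) frame \<Rightarrow> real) \<Rightarrow> ('a, 'n) frame \<Rightarrow> real" where
  "GammaZ2 A g B = iterated_form (horizontal_bochner A g) (GammaZ B)"

end

theory Submission
  imports Defs
begin

text \<open>
  In the frame bundle \<open>[H\<^sub>i, H\<^sub>j] = - V\<^bsub>\<Omega>(H\<^sub>i, H\<^sub>j)\<^esub>\<close> and \<open>[V\<^sub>M, H\<^sub>i] = H\<^bsub>M e\<^sub>i\<^esub>\<close>.  Since \<open>M\<close> is skew, \<open>L\<close>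
  commutes with \<open>V\<^sub>M\<close>, so \<open>\<Gamma>\<^sub>2\<^sup>Z(f) = \<Sum> (H\<^sub>i V\<^sub>m f)\<^sup>2\<close> over an orthonormal basis of vertical fields.  In
  \<open>\<Gamma>\<^sub>2(f) = \<Sum> (H\<^sub>i H\<^sub>j f)\<^sup>2 + \<Sum> H\<^sub>j f [L, H\<^sub>j] f\<close> the commutator consists of a Ricci term, a cross term
  pairing \<open>\<Omega>(H\<^sub>i, H\<^sub>j)\<close> with the mixed derivatives \<open>H\<^sub>i V\<^sub>m f\<close>, and the divergence \<open>\<Sum> H\<^sub>i \<Omega>(H\<^sub>i, H\<^sub>j)\<close>; by the contracted second Bianchi identity the
  divergence vanishes exactly when the Ricci tensor is Codazzi.  The symmetric part of the Hessian
  gives \<open>(L f)\<^sup>2 / d\<close>, its antisymmetric part is \<open>- V\<^bsub>\<Omega>(H\<^sub>i, H\<^sub>j)\<^esub> f / 2\<close> and gives the \<open>\<rho>\<^sub>2\<close> term, and the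
  cross term is absorbed into \<open>\<nu> \<Gamma>\<^sub>2\<^sup>Z(f)\<close> at the price of \<open>\<kappa> \<Gamma>(f) / \<nu>\<close>.

  In a chart, all these fields extend from orthonormal frames to all pairs \<open>(x, E)\<close> with \<open>E\<close> an arbitrary
  matrix, where the commutation relations still hold; this reduces them to calculus on open sets.
  Tensoriality of the curvature and its skewness are read off from the brackets as well.
\<close>

section \<open>Calculus of smooth functions\<close>

text \<open>The operators are defined by curves of orthonormal frames and by \<open>THE\<close>,
  whereas calculus needs open sets, and a smooth function on frames is only locally the restriction
  of some \<open>h\<close>, which is not unique. The bridge: the extended horizontal fields keep E^T
  G E constant by metric compatibility, and the vertical ones are tangent to the orthonormal frames
  because M is skew. Hence the derivative of \<open>h\<close> along them depends, at frames, on the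
  function alone, and it is again a local extension, so derivatives can be iterated. That frames
  admit curves with these velocities has to be proved: a straight line in coordinates leaves the
  orthonormal frames. On frames, tensors become scalar functions whose horizontal derivatives are
  the components of the covariant derivative, so the Bianchi identities and the Codazzi condition
  lose their connection terms. The constants fit together: the antisymmetric part of the Hessian
  carries a weight 1/4, which meets the 4 in the lower curvature bound; commuting \<open>H j\<close>
  past two copies of \<open>H i\<close> gives the cross term a factor 2, the one in Young's
  inequality.\<close>

abbreviation fd :: "('a::real_normed_vector \<Rightarrow> 'b::real_normed_vector) \<Rightarrow> 'a \<Rightarrow> 'a \<Rightarrow> 'b" where
  "fd f x \<equiv> frechet_derivative f (at x)"

lemma fd_eq: "(f has_derivative f') (at x) \<Longrightarrow> fd f x = f'"
  using frechet_derivative_at by metis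

lemma fd_eqI: "(f has_derivative f') (at x) \<Longrightarrow> fd f x v = f' v"
  by (simp add: fd_eq)

text \<open>The same linear maps are derivatives of both functions, so the \<open>SOME\<close>
  behind \<open>frechet_derivative\<close> picks the same one, even where neither is
  differentiable.\<close>

lemma fd_cong:
  assumes "open S" "x \<in> S" "\<And>y. y \<in> S \<Longrightarrow> f y = g y"
  shows "fd f x = fd g x"
proof -
  have "(f has_derivative D) (at x) \<longleftrightarrow> (g has_derivative D) (at x)" for D
    using has_derivative_transform_within_open[OF _ assms(1,2), of f D UNIV g]
      has_derivative_transform_within_open[OF _ assms(1,2), of g D UNIV f] assms(3) by auto
  then show ?thesis by (simp add: frechet_derivative_def)
qed

text \<open>The congruence at level \<open>k\<close> is a hypothesis because
  \<open>Ck_on_cong\<close> is itself proved by induction through this rule;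
  \<open>Ck_on_SucI'\<close> discharges it afterwards.\<close>

lemma Ck_on_SucI:
  assumes "\<And>x. x \<in> S \<Longrightarrow> (f has_derivative f' x) (at x)" "open S"
    and "\<And>v. Ck_on k S (\<lambda>x. f' x v)"
    and cong: "\<And>(h::'a::real_normed_vector \<Rightarrow> 'b::real_normed_vector) h'. (\<And>x. x \<in> S \<Longrightarrow> h x = h' x) \<Longrightarrow> Ck_on k S h \<Longrightarrow> Ck_on k S h'"
  shows "Ck_on (Suc k) S (f :: 'a \<Rightarrow> 'b)"
proof -
  have "f differentiable (at x)" if "x \<in> S" for x
    using assms(1)[OF that] by (auto simp: differentiable_def)
  moreover have "Ck_on k S (\<lambda>x. fd f x v)" for v
    using assms(3)[of v] by (rule cong[rotated]) (simp add: fd_eqI[OF assms(1)])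
  ultimately show ?thesis by simp
qed

lemma Ck_on_cong:
  assumes "open S" "\<And>x. x \<in> S \<Longrightarrow> f x = g x" "Ck_on k S f"
  shows "Ck_on k S g"
  using assms(2,3)
proof (induction k arbitrary: f g)
  case 0
  then show ?case using continuous_on_cong by force
next
  case (Suc k)
  show ?case
  proof (rule Ck_on_SucI[OF _ assms(1)])
    show "(g has_derivative fd f x) (at x)" if "x \<in> S" for x
    proof -
      have "(f has_derivative fd f x) (at x)"
        using Suc.prems(2) that frechet_derivative_works by auto
      then show ?thesis
        by (rule has_derivative_transform_within_open[OF _ assms(1) that Suc.prems(1)])
    qed
    show "Ck_on k S (\<lambda>x. fd f x v)" for v using Suc.prems(2) by simp
  qed (rule Suc.IH)
qed

lemma Ck_on_SucI':
  assumes "open S" "\<And>x. x \<in> S \<Longrightarrow> (f has_derivative f' x) (at x)"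
    and "\<And>v. Ck_on k S (\<lambda>x. f' x v)"
  shows "Ck_on (Suc k) S f"
  by (rule Ck_on_SucI[OF assms(2) assms(1) assms(3) Ck_on_cong[OF assms(1)]])

lemma Ck_on_SucD:
  assumes "Ck_on (Suc k) S f" "x \<in> S"
  shows "(f has_derivative fd f x) (at x)"
  using assms frechet_derivative_works by auto

lemma Ck_on_Suc_imp: "Ck_on (Suc k) S f \<Longrightarrow> Ck_on k S f"
proof (induction k arbitrary: f)
  case 0
  then show ?case
    by (auto intro!: differentiable_imp_continuous_on simp: differentiable_on_def
        differentiable_at_withinI)
next
  case (Suc k)
  then show ?case by (metis Ck_on.simps(2))
qed

lemma Ck_on_subset: "Ck_on k S f \<Longrightarrow> T \<subseteq> S \<Longrightarrow> Ck_on k T f"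
  by (induction k arbitrary: f) (auto intro: continuous_on_subset)

lemma Ck_on_const: "open S \<Longrightarrow> Ck_on k S (\<lambda>x. c)"
proof (induction k arbitrary: c)
  case (Suc k)
  show ?case
    by (rule Ck_on_SucI'[where f'="\<lambda>_ _. 0"]) (use Suc in auto)
qed simp

lemma Ck_on_linear:
  assumes "bounded_linear f" "open S" shows "Ck_on k S f"
proof (cases k)
  case 0
  then show ?thesis using assms by (simp add: linear_continuous_on)
next
  case (Suc j)
  show ?thesis unfolding Suc
    by (rule Ck_on_SucI'[where f'="\<lambda>_. f"])
      (use assms Ck_on_const in \<open>auto intro: bounded_linear_imp_has_derivative\<close>)
qed

lemma Ck_on_add:
  assumes "open S" shows "Ck_on k S f \<Longrightarrow> Ck_on k S g \<Longrightarrow> Ck_on k S (\<lambda>x. f x + g x)"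
proof (induction k arbitrary: f g)
  case 0 then show ?case by (auto intro: continuous_intros)
next
  case (Suc k)
  show ?case
    by (rule Ck_on_SucI'[OF assms, where f'="\<lambda>x v. fd f x v + fd g x v"])
      (use Suc in \<open>auto intro!: has_derivative_add Ck_on_SucD[where S=S] simp del: Ck_on.simps
         intro: Suc.IH simp: Ck_on.simps(2)\<close>)
qed

lemma Ck_on_bilinear:
  assumes "bounded_bilinear pr" "open S"
  shows "Ck_on k S f \<Longrightarrow> Ck_on k S g \<Longrightarrow> Ck_on k S (\<lambda>x. pr (f x) (g x))"
proof (induction k arbitrary: f g)
  case 0 then show ?case
    using bounded_bilinear.continuous_on[OF assms(1)] by auto
next
  case (Suc k)
  have "Ck_on k S (\<lambda>x. pr (f x) (fd g x v) + pr (fd f x v) (g x))" for v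
    using Suc.prems
    by (intro Ck_on_add[OF assms(2)] Suc.IH) (auto intro: Ck_on_Suc_imp simp del: Ck_on.simps simp: Ck_on.simps(2))
  then show ?case
    by (rule Ck_on_SucI'[OF assms(2), rotated])
      (auto intro!: bounded_bilinear.FDERIV[OF assms(1)] Ck_on_SucD[where S=S] Suc.prems)
qed

lemma Ck_on_minus:
  assumes "open S" "Ck_on k S f" shows "Ck_on k S (\<lambda>x. - f x)"
  using Ck_on_bilinear[OF bounded_bilinear_scaleR assms(1) Ck_on_const[OF assms(1), of k "-1"] assms(2)]
  by simp

lemma Ck_on_sum:
  assumes "open S" shows "(\<And>i. i \<in> I \<Longrightarrow> Ck_on k S (f i)) \<Longrightarrow> Ck_on k S (\<lambda>x. \<Sum>i\<in>I. f i x)"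
  by (induction I rule: infinite_finite_induct) (auto intro: Ck_on_const Ck_on_add assms)

lemma linear_euclidean_sum:
  assumes "linear l" shows "l v = (\<Sum>b\<in>Basis. (v \<bullet> b) *\<^sub>R l (b::'a::euclidean_space))"
proof -
  have "l v = l (\<Sum>b\<in>Basis. (v \<bullet> b) *\<^sub>R b)" by (simp add: euclidean_representation)
  then show ?thesis using assms by (simp add: linear_sum linear_scale)
qed

text \<open>\<open>Ck_on\<close> only controls derivatives in fixed directions, whereas the chain
  rule differentiates \<open>g\<close> in the moving direction \<open>fd f x v\<close>. Expanding
  that direction in a basis of the Euclidean middle space leaves fixed directions with C^k
  coefficients, to which the induction hypothesis applies.\<close>

lemma Ck_on_compose:
  fixes f :: "'a::real_normed_vector \<Rightarrow> 'b::euclidean_space" and g :: "'b \<Rightarrow> 'c::real_normed_vector"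
  assumes "open S" "open T" "f ` S \<subseteq> T"
  shows "Ck_on k S f \<Longrightarrow> Ck_on k T g \<Longrightarrow> Ck_on k S (\<lambda>x. g (f x))"
  using assms(3)
proof (induction k arbitrary: f g)
  case 0
  then show ?case using continuous_on_compose2 by (metis Ck_on.simps(1))
next
  case (Suc k)
  have inner: "Ck_on k S (\<lambda>x. fd f x v \<bullet> b)" for v b
    using Suc.prems(1) by (intro Ck_on_bilinear[OF bounded_bilinear_inner assms(1)])
      (auto intro: Ck_on_const assms)
  have "Ck_on k S (\<lambda>x. \<Sum>b\<in>Basis. (fd f x v \<bullet> b) *\<^sub>R fd g (f x) b)" for v
    using Suc.prems
    by (intro Ck_on_sum[OF assms(1)] Ck_on_bilinear[OF bounded_bilinear_scaleR assms(1)] inner Suc.IH)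
      (auto intro: Ck_on_Suc_imp simp del: Ck_on.simps simp: Ck_on.simps(2))
  moreover have "((\<lambda>x. g (f x)) has_derivative (\<lambda>v. \<Sum>b\<in>Basis. (fd f x v \<bullet> b) *\<^sub>R fd g (f x) b)) (at x)"
    if "x \<in> S" for x
  proof -
    have 1: "(f has_derivative fd f x) (at x)" using Ck_on_SucD[OF Suc.prems(1) that] .
    have 2: "(g has_derivative fd g (f x)) (at (f x))" using Ck_on_SucD[OF Suc.prems(2), of "f x"] Suc.prems(3) that by auto
    have "(\<lambda>v. \<Sum>b\<in>Basis. (fd f x v \<bullet> b) *\<^sub>R fd g (f x) b) = fd g (f x) \<circ> fd f x"
      using linear_euclidean_sum[OF has_derivative_linear[OF 2]] unfolding o_def by metis
    then show ?thesis using diff_chain_at[OF 1 2] unfolding o_def[of g f] by metis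
  qed
  ultimately show ?case by (rule Ck_on_SucI'[OF assms(1), rotated])
qed

lemma Ck_on_inverse:
  fixes f :: "'a::real_normed_vector \<Rightarrow> real"
  assumes "open S" "\<And>x. x \<in> S \<Longrightarrow> f x \<noteq> 0"
  shows "Ck_on k S f \<Longrightarrow> Ck_on k S (\<lambda>x. inverse (f x))"
proof (induction k)
  case 0 then show ?case using assms by (auto intro: continuous_intros)
next
  case (Suc k)
  have 1: "Ck_on k S (\<lambda>x. inverse (f x))" using Suc by (metis Ck_on_Suc_imp)
  have "Ck_on k S (\<lambda>x. - (inverse (f x) * fd f x v * inverse (f x)))" for v
    using Suc.prems
    by (intro Ck_on_minus Ck_on_bilinear[OF bounded_bilinear_mult assms(1)] 1 assms(1)) auto
  then show ?case
    by (rule Ck_on_SucI'[OF assms(1), rotated])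
      (rule Deriv.has_derivative_inverse[OF assms(2) Ck_on_SucD[OF Suc.prems]])
qed

lemma smooth_onI: "(\<And>k. Ck_on k S f) \<Longrightarrow> smooth_on S f"
  by (simp add: smooth_on_def)

lemma smooth_on_Ck: "smooth_on S f \<Longrightarrow> Ck_on k S f"
  by (simp add: smooth_on_def)

lemma smooth_on_has_derivative: "smooth_on S f \<Longrightarrow> x \<in> S \<Longrightarrow> (f has_derivative fd f x) (at x)"
  using Ck_on_SucD smooth_on_Ck by blast

lemma smooth_on_continuous: "smooth_on S f \<Longrightarrow> continuous_on S f"
  using smooth_on_Ck[of S f 0] by simp

lemma smooth_on_fd: "smooth_on S f \<Longrightarrow> smooth_on S (\<lambda>x. fd f x v)"
  unfolding smooth_on_def using Ck_on.simps(2) by blast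

lemma smooth_on_cong: "smooth_on S f \<Longrightarrow> open S \<Longrightarrow> (\<And>x. x \<in> S \<Longrightarrow> f x = g x) \<Longrightarrow> smooth_on S g"
  unfolding smooth_on_def using Ck_on_cong by metis

lemma smooth_on_subset: "smooth_on S f \<Longrightarrow> T \<subseteq> S \<Longrightarrow> smooth_on T f"
  unfolding smooth_on_def using Ck_on_subset by blast

lemma smooth_on_const: "open S \<Longrightarrow> smooth_on S (\<lambda>x. c)"
  by (simp add: smooth_on_def Ck_on_const)

lemma smooth_on_linear: "bounded_linear f \<Longrightarrow> open S \<Longrightarrow> smooth_on S f"
  by (simp add: smooth_on_def Ck_on_linear)

lemma smooth_on_add: "open S \<Longrightarrow> smooth_on S f \<Longrightarrow> smooth_on S g \<Longrightarrow> smooth_on S (\<lambda>x. f x + g x)"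
  by (simp add: smooth_on_def Ck_on_add)

lemma smooth_on_sum:
  "open S \<Longrightarrow> (\<And>i. i \<in> I \<Longrightarrow> smooth_on S (f i)) \<Longrightarrow> smooth_on S (\<lambda>x. \<Sum>i\<in>I. f i x)"
  by (simp add: smooth_on_def Ck_on_sum)

lemma smooth_on_bilinear:
  "bounded_bilinear pr \<Longrightarrow> open S \<Longrightarrow> smooth_on S f \<Longrightarrow> smooth_on S g \<Longrightarrow>
    smooth_on S (\<lambda>x. pr (f x) (g x))"
  by (simp add: smooth_on_def Ck_on_bilinear)

lemma smooth_on_compose:
  fixes f :: "'a::real_normed_vector \<Rightarrow> 'b::euclidean_space" and g :: "'b \<Rightarrow> 'c::real_normed_vector"
  shows "open S \<Longrightarrow> open T \<Longrightarrow> f ` S \<subseteq> T \<Longrightarrow> smooth_on S f \<Longrightarrow> smooth_on T g \<Longrightarrow> smooth_on S (\<lambda>x. g (f x))"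
  unfolding smooth_on_def using Ck_on_compose by blast

lemma smooth_on_linear_compose:
  fixes f :: "'a::real_normed_vector \<Rightarrow> 'b::euclidean_space"
  shows "bounded_linear l \<Longrightarrow> open S \<Longrightarrow> smooth_on S f \<Longrightarrow> smooth_on S (\<lambda>x. l (f x))"
  using smooth_on_compose[of S UNIV f l] smooth_on_linear[of l UNIV] by auto

lemma smooth_on_inverse:
  fixes f :: "'a::real_normed_vector \<Rightarrow> real"
  shows "open S \<Longrightarrow> (\<And>x. x \<in> S \<Longrightarrow> f x \<noteq> 0) \<Longrightarrow> smooth_on S f \<Longrightarrow> smooth_on S (\<lambda>x. inverse (f x))"
  by (simp add: smooth_on_def Ck_on_inverse)

lemmas smooth_on_mult = smooth_on_bilinear[OF bounded_bilinear_mult]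
lemmas smooth_on_scaleR = smooth_on_bilinear[OF bounded_bilinear_scaleR]
lemmas smooth_on_inner = smooth_on_bilinear[OF bounded_bilinear_inner]

lemma smooth_on_minus:
  fixes f :: "'a::real_normed_vector \<Rightarrow> 'b::euclidean_space"
  shows "open S \<Longrightarrow> smooth_on S f \<Longrightarrow> smooth_on S (\<lambda>x. - f x)"
  by (simp add: smooth_on_def Ck_on_minus)

lemma smooth_on_diff:
  fixes f :: "'a::real_normed_vector \<Rightarrow> 'b::euclidean_space"
  shows "open S \<Longrightarrow> smooth_on S f \<Longrightarrow> smooth_on S g \<Longrightarrow> smooth_on S (\<lambda>x. f x - g x)"
  using smooth_on_add[of S f "\<lambda>x. - g x"] smooth_on_minus[of S g] by simp

lemma smooth_on_prod:
  fixes f :: "'i \<Rightarrow> 'a::real_normed_vector \<Rightarrow> real"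
  shows "open S \<Longrightarrow> (\<And>i. i \<in> I \<Longrightarrow> smooth_on S (f i)) \<Longrightarrow> smooth_on S (\<lambda>x. \<Prod>i\<in>I. f i x)"
  by (induction I rule: infinite_finite_induct) (auto intro: smooth_on_const smooth_on_mult)

lemma smooth_on_componentwise:
  fixes f :: "'a::real_normed_vector \<Rightarrow> 'b::euclidean_space"
  assumes "open S" "\<And>b. b \<in> Basis \<Longrightarrow> smooth_on S (\<lambda>x. f x \<bullet> b)"
  shows "smooth_on S f"
proof -
  have "smooth_on S (\<lambda>x. \<Sum>b\<in>Basis. (f x \<bullet> b) *\<^sub>R b)"
    by (intro smooth_on_sum smooth_on_scaleR smooth_on_const assms)
  then show ?thesis by (simp add: euclidean_representation)
qed

text \<open>The basis expansion of the chain rule again, now for a derivative along a vector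
  field.\<close>

lemma smooth_on_fd_field:
  fixes f :: "'a::euclidean_space \<Rightarrow> 'b::real_normed_vector"
  assumes "open S" "smooth_on S f" "smooth_on S \<xi>"
  shows "smooth_on S (\<lambda>x. fd f x (\<xi> x))"
proof -
  have "smooth_on S (\<lambda>x. \<Sum>b\<in>Basis. (\<xi> x \<bullet> b) *\<^sub>R fd f x b)"
    by (intro smooth_on_sum smooth_on_scaleR smooth_on_inner smooth_on_const smooth_on_fd assms)
  then show ?thesis
    by (rule smooth_on_cong[OF _ assms(1)])
      (simp add: linear_euclidean_sum[OF has_derivative_linear[OF smooth_on_has_derivative[OF assms(2)]], symmetric])
qed

text \<open>In the second-order term the direction is frozen at \<open>\<xi> x\<close>; its
  variation gives the first-order term. Keeping them apart lets the second-order terms of a bracket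
  cancel.\<close>

lemma has_derivative_fd_field:
  fixes f :: "'a::euclidean_space \<Rightarrow> 'b::real_normed_vector"
  assumes "open S" "smooth_on S f" "x \<in> S" "(\<xi> has_derivative \<xi>') (at x)"
  shows "((\<lambda>y. fd f y (\<xi> y)) has_derivative (\<lambda>v. fd (\<lambda>y. fd f y (\<xi> x)) x v + fd f x (\<xi>' v))) (at x)"
proof -
  have lin: "linear (fd f y)" if "y \<in> S" for y
    using assms(2) has_derivative_linear smooth_on_has_derivative that by blast
  have d2: "((\<lambda>y. fd f y b) has_derivative fd (\<lambda>y. fd f y b) x) (at x)" for b
    using assms(2,3) smooth_on_fd smooth_on_has_derivative by blast
  have s: "((\<lambda>y. \<Sum>b\<in>Basis. (\<xi> y \<bullet> b) *\<^sub>R fd f y b) has_derivative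
      (\<lambda>v. \<Sum>b\<in>Basis. (\<xi> x \<bullet> b) *\<^sub>R fd (\<lambda>y. fd f y b) x v + (\<xi>' v \<bullet> b) *\<^sub>R fd f x b)) (at x)"
    by (auto intro!: derivative_eq_intros d2 assms(4))
  have c: "((\<lambda>y. \<Sum>b\<in>Basis. (\<xi> x \<bullet> b) *\<^sub>R fd f y b) has_derivative
      (\<lambda>v. \<Sum>b\<in>Basis. (\<xi> x \<bullet> b) *\<^sub>R fd (\<lambda>y. fd f y b) x v)) (at x)"
    by (auto intro!: derivative_eq_intros d2)
  have "fd (\<lambda>y. fd f y (\<xi> x)) x v = (\<Sum>b\<in>Basis. (\<xi> x \<bullet> b) *\<^sub>R fd (\<lambda>y. fd f y b) x v)" for v
    by (rule fd_eqI, rule has_derivative_transform_within_open[OF c assms(1,3)])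
      (simp add: linear_euclidean_sum[OF lin, symmetric])
  moreover have "fd f x (\<xi>' v) = (\<Sum>b\<in>Basis. (\<xi>' v \<bullet> b) *\<^sub>R fd f x b)" for v
    by (rule linear_euclidean_sum[OF lin[OF assms(3)]])
  ultimately have "(\<lambda>v. fd (\<lambda>y. fd f y (\<xi> x)) x v + fd f x (\<xi>' v)) =
     (\<lambda>v. \<Sum>b\<in>Basis. (\<xi> x \<bullet> b) *\<^sub>R fd (\<lambda>y. fd f y b) x v + (\<xi>' v \<bullet> b) *\<^sub>R fd f x b)"
    by (simp add: sum.distrib)
  then show ?thesis
    using s by (simp only:) (rule has_derivative_transform_within_open[OF s assms(1,3)],
      simp add: linear_euclidean_sum[OF lin, symmetric])
qed

text \<open>Two applications of the mean value theorem to \<open>h (z + s v + s w) - h (z + s v) - h (z + s w) + h z\<close>.\<close>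

lemma second_difference:
  fixes h :: "'a::euclidean_space \<Rightarrow> real"
  assumes "smooth_on (ball z r) h" "0 < s" "s * (norm v + norm w) < r"
  shows "\<exists>y. norm (y - z) \<le> s * (norm v + norm w) \<and>
    h (z + s *\<^sub>R v + s *\<^sub>R w) - h (z + s *\<^sub>R v) - h (z + s *\<^sub>R w) + h z = s^2 * fd (\<lambda>y. fd h y v) y w"
proof -
  have mem: "norm (a *\<^sub>R v + b *\<^sub>R w) \<le> s * (norm v + norm w)" if "0 \<le> a" "a \<le> s" "0 \<le> b" "b \<le> s" for a b
  proof -
    have "norm (a *\<^sub>R v + b *\<^sub>R w) \<le> a * norm v + b * norm w"
      using norm_triangle_ineq[of "a *\<^sub>R v" "b *\<^sub>R w"] that by simp
    also have "\<dots> \<le> s * norm v + s * norm w" using that by (intro add_mono mult_right_mono) auto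
    finally show ?thesis by (simp add: algebra_simps)
  qed
  have inb: "z + a *\<^sub>R v + b *\<^sub>R w \<in> ball z r" if "0 \<le> a" "a \<le> s" "0 \<le> b" "b \<le> s" for a b
  proof -
    have "z - (z + a *\<^sub>R v + b *\<^sub>R w) = - (a *\<^sub>R v + b *\<^sub>R w)" by simp
    then show ?thesis using mem[OF that] assms(3)
      by (simp only: mem_ball dist_norm norm_minus_cancel)
  qed
  have dh: "((\<lambda>a. h (z + a *\<^sub>R v + b *\<^sub>R w)) has_real_derivative fd h (z + a *\<^sub>R v + b *\<^sub>R w) v) (at a)"
    if "0 \<le> a" "a \<le> s" "0 \<le> b" "b \<le> s" for a b
  proof -
    have *: "((\<lambda>a. z + a *\<^sub>R v + b *\<^sub>R w) has_derivative (\<lambda>t. t *\<^sub>R v)) (at a)"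
      by (auto intro!: derivative_eq_intros)
    have d: "(h has_derivative fd h (z + a *\<^sub>R v + b *\<^sub>R w)) (at (z + a *\<^sub>R v + b *\<^sub>R w))"
      using smooth_on_has_derivative[OF assms(1) inb[OF that]] .
    have "((\<lambda>a. h (z + a *\<^sub>R v + b *\<^sub>R w)) has_derivative (\<lambda>t. fd h (z + a *\<^sub>R v + b *\<^sub>R w) (t *\<^sub>R v))) (at a)"
      using diff_chain_at[OF * d] by (simp add: o_def)
    then show ?thesis
      unfolding has_field_derivative_def using linear_scale[OF has_derivative_linear[OF d]]
      by (simp add: mult_commute_abs)
  qed
  have dv: "((\<lambda>b. fd h (z + a *\<^sub>R v + b *\<^sub>R w) v) has_real_derivative
      fd (\<lambda>y. fd h y v) (z + a *\<^sub>R v + b *\<^sub>R w) w) (at b)"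
    if "0 \<le> a" "a \<le> s" "0 \<le> b" "b \<le> s" for a b
  proof -
    have *: "((\<lambda>b. z + a *\<^sub>R v + b *\<^sub>R w) has_derivative (\<lambda>t. t *\<^sub>R w)) (at b)"
      by (auto intro!: derivative_eq_intros)
    have d: "((\<lambda>y. fd h y v) has_derivative fd (\<lambda>y. fd h y v) (z + a *\<^sub>R v + b *\<^sub>R w)) (at (z + a *\<^sub>R v + b *\<^sub>R w))"
      using smooth_on_has_derivative[OF smooth_on_fd[OF assms(1)] inb[OF that]] .
    have "((\<lambda>b. fd h (z + a *\<^sub>R v + b *\<^sub>R w) v) has_derivative
        (\<lambda>t. fd (\<lambda>y. fd h y v) (z + a *\<^sub>R v + b *\<^sub>R w) (t *\<^sub>R w))) (at b)"
      using diff_chain_at[OF * d] by (simp add: o_def)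
    then show ?thesis
      unfolding has_field_derivative_def using linear_scale[OF has_derivative_linear[OF d]]
      by (simp add: mult_commute_abs)
  qed
  obtain a where a: "0 < a" "a < s"
    "(h (z + s *\<^sub>R v + s *\<^sub>R w) - h (z + s *\<^sub>R v + 0 *\<^sub>R w)) - (h (z + 0 *\<^sub>R v + s *\<^sub>R w) - h (z + 0 *\<^sub>R v + 0 *\<^sub>R w))
      = (s - 0) * (fd h (z + a *\<^sub>R v + s *\<^sub>R w) v - fd h (z + a *\<^sub>R v + 0 *\<^sub>R w) v)"
    using MVT2[of 0 s "\<lambda>a. h (z + a *\<^sub>R v + s *\<^sub>R w) - h (z + a *\<^sub>R v + 0 *\<^sub>R w)"
        "\<lambda>a. fd h (z + a *\<^sub>R v + s *\<^sub>R w) v - fd h (z + a *\<^sub>R v + 0 *\<^sub>R w) v"]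
      DERIV_diff[OF dh[of _ s] dh[of _ 0]] assms(2) by fastforce
  obtain b where b: "0 < b" "b < s"
    "fd h (z + a *\<^sub>R v + s *\<^sub>R w) v - fd h (z + a *\<^sub>R v + 0 *\<^sub>R w) v = (s - 0) * fd (\<lambda>y. fd h y v) (z + a *\<^sub>R v + b *\<^sub>R w) w"
    using MVT2[of 0 s "\<lambda>b. fd h (z + a *\<^sub>R v + b *\<^sub>R w) v" "\<lambda>b. fd (\<lambda>y. fd h y v) (z + a *\<^sub>R v + b *\<^sub>R w) w"]
      dv[of a] assms(2) a(1,2) by fastforce
  show ?thesis
    using a b mem[of a b]
    by (intro exI[of _ "z + a *\<^sub>R v + b *\<^sub>R w"]) (simp add: power2_eq_square algebra_simps)
qed

text \<open>The second difference is symmetric in \<open>v\<close> and \<open>w\<close>, so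
  \<open>second_difference\<close> equates the two mixed derivatives at points close to
  \<open>z\<close>; a gap at \<open>z\<close> itself would contradict their continuity.\<close>

lemma fd_fd_commute_real:
  fixes h :: "'a::euclidean_space \<Rightarrow> real"
  assumes "open S" "smooth_on S h" "z \<in> S"
  shows "fd (\<lambda>y. fd h y v) z w = fd (\<lambda>y. fd h y w) z v"
proof (rule ccontr)
  let ?a = "\<lambda>z. fd (\<lambda>y. fd h y v) z w" and ?b = "\<lambda>z. fd (\<lambda>y. fd h y w) z v"
  assume "?a z \<noteq> ?b z"
  define e where "e = \<bar>?a z - ?b z\<bar> / 2"
  have e: "e > 0" using \<open>?a z \<noteq> ?b z\<close> by (simp add: e_def)
  obtain r where r: "r > 0" "ball z r \<subseteq> S" using assms open_contains_ball by blast
  have "continuous_on S ?a" "continuous_on S ?b"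
    using smooth_on_continuous smooth_on_fd assms(2) by blast+
  then have "isCont ?a z" "isCont ?b z"
    using assms(1,3) continuous_on_eq_continuous_at by blast+
  then obtain d1 d2 where d: "d1 > 0" "d2 > 0"
    "\<And>y. norm (y - z) < d1 \<Longrightarrow> \<bar>?a y - ?a z\<bar> < e" "\<And>y. norm (y - z) < d2 \<Longrightarrow> \<bar>?b y - ?b z\<bar> < e"
    using e unfolding continuous_at_eps_delta dist_norm real_norm_def by metis
  define m where "m = min r (min d1 d2)"
  \<comment> \<open>Keeps the parallelogram inside all the radii collected in \<open>m\<close>; the
    summand 1 keeps the denominator positive when \<open>v\<close> and \<open>w\<close>
    vanish.\<close>
  define s where "s = m / (2 * (norm v + norm w + 1))"
  have m: "m > 0" using r d by (simp add: m_def)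
  then have s: "s > 0" by (auto simp: s_def intro!: divide_pos_pos add_nonneg_pos)
  have "s * (norm v + norm w) < s * (2 * (norm v + norm w + 1))"
    by (rule mult_strict_left_mono[OF _ s]) (smt (verit) norm_ge_zero)
  also have "\<dots> = m" unfolding s_def
    by simp (smt (verit) norm_ge_zero)
  finally have sm: "s * (norm v + norm w) < m" .
  have sb: "smooth_on (ball z r) h" using assms(2) r smooth_on_subset by blast
  obtain y1 where y1: "norm (y1 - z) \<le> s * (norm v + norm w)"
    "h (z + s *\<^sub>R v + s *\<^sub>R w) - h (z + s *\<^sub>R v) - h (z + s *\<^sub>R w) + h z = s^2 * ?a y1"
    using second_difference[OF sb s, of v w] sm by (auto simp: m_def)
  obtain y2 where y2: "norm (y2 - z) \<le> s * (norm w + norm v)"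
    "h (z + s *\<^sub>R w + s *\<^sub>R v) - h (z + s *\<^sub>R w) - h (z + s *\<^sub>R v) + h z = s^2 * ?b y2"
    using second_difference[OF sb s, of w v] sm by (auto simp: m_def add.commute)
  have "s^2 * ?a y1 = s^2 * ?b y2"
    using y1(2) y2(2) by (simp only: add.assoc add.commute[of "s *\<^sub>R w" "s *\<^sub>R v"])
  then have "?a y1 = ?b y2" using s by simp
  moreover have "\<bar>?a y1 - ?a z\<bar> < e" "\<bar>?b y2 - ?b z\<bar> < e"
    using d y1(1) y2(1) sm by (auto simp: m_def add.commute)
  ultimately show False unfolding e_def by (auto simp: abs_if split: if_splits)
qed

lemma fd_fd_commute:
  fixes h :: "'a::euclidean_space \<Rightarrow> 'b::euclidean_space"
  assumes "open S" "smooth_on S h" "z \<in> S"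
  shows "fd (\<lambda>y. fd h y v) z w = fd (\<lambda>y. fd h y w) z v"
proof (rule euclidean_eqI)
  fix b :: 'b assume "b \<in> Basis"
  have s: "smooth_on S (\<lambda>y. h y \<bullet> b)"
    using assms by (intro smooth_on_inner smooth_on_const)
  have 1: "fd (\<lambda>y. h y \<bullet> b) y v = fd h y v \<bullet> b" if "y \<in> S" for y v
    by (rule fd_eqI) (auto intro!: derivative_eq_intros smooth_on_has_derivative[OF assms(2) that])
  have 2: "fd (\<lambda>y. fd h y v) z w \<bullet> b = fd (\<lambda>y. fd (\<lambda>y. h y \<bullet> b) y v) z w" for v w
  proof -
    have "fd (\<lambda>y. fd (\<lambda>y. h y \<bullet> b) y v) z w = fd (\<lambda>y. fd h y v \<bullet> b) z w"
      by (rule fun_cong, rule fd_cong[OF assms(1,3)], rule 1)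
    also have "\<dots> = fd (\<lambda>y. fd h y v) z w \<bullet> b"
      by (rule fd_eqI)
        (auto intro!: derivative_eq_intros smooth_on_has_derivative[OF smooth_on_fd[OF assms(2)] assms(3)])
    finally show ?thesis by simp
  qed
  show "fd (\<lambda>y. fd h y v) z w \<bullet> b = fd (\<lambda>y. fd h y w) z v \<bullet> b"
    unfolding 2 by (rule fd_fd_commute_real[OF assms(1) s assms(3)])
qed

text \<open>The second-order terms cancel by \<open>fd_fd_commute\<close>; what remains is the Lie
  bracket of \<open>\<xi>\<close> and \<open>\<eta>\<close> in coordinates.\<close>

lemma fd_bracket:
  fixes h :: "'a::euclidean_space \<Rightarrow> 'b::euclidean_space"
  assumes "open S" "smooth_on S h" "z \<in> S"
    and "(\<xi> has_derivative \<xi>') (at z)" "(\<eta> has_derivative \<eta>') (at z)"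
  shows "fd (\<lambda>y. fd h y (\<eta> y)) z (\<xi> z) - fd (\<lambda>y. fd h y (\<xi> y)) z (\<eta> z) = fd h z (\<eta>' (\<xi> z) - \<xi>' (\<eta> z))"
proof -
  have "linear (fd h z)" using assms(2,3) has_derivative_linear smooth_on_has_derivative by blast
  then show ?thesis
    using fd_fd_commute[OF assms(1-3), of "\<eta> z" "\<xi> z"]
    by (simp add: fd_eqI[OF has_derivative_fd_field[OF assms(1-3) assms(4)]]
        fd_eqI[OF has_derivative_fd_field[OF assms(1-3) assms(5)]] linear_diff)
qed

section \<open>Smooth matrix functions\<close>

lemma bounded_bilinear_matmul:
  "bounded_bilinear ((**) :: real^'n::finite^'m::finite \<Rightarrow> real^'k::finite^'n \<Rightarrow> real^'k^'m)"
proof -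
  have "bilinear ((**) :: real^'n^'m \<Rightarrow> real^'k^'n \<Rightarrow> real^'k^'m)"
    unfolding bilinear_def
    by (auto intro!: linearI simp: matrix_matrix_mult_def vec_eq_iff distrib_left distrib_right
        sum.distrib sum_distrib_left mult.assoc mult.left_commute)
  then show ?thesis using bilinear_conv_bounded_bilinear by blast
qed

lemma bounded_bilinear_matvec:
  "bounded_bilinear ((*v) :: real^'n::finite^'m::finite \<Rightarrow> real^'n \<Rightarrow> real^'m)"
proof -
  have "bilinear ((*v) :: real^'n^'m \<Rightarrow> real^'n \<Rightarrow> real^'m)"
    unfolding bilinear_def
    by (auto intro!: linearI simp: matrix_vector_mult_def vec_eq_iff distrib_left distrib_right
        sum.distrib sum_distrib_left mult.assoc mult.left_commute)
  then show ?thesis using bilinear_conv_bounded_bilinear by blast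
qed

lemma bounded_linear_transpose: "bounded_linear (transpose :: real^'n::finite^'m::finite \<Rightarrow> real^'m^'n)"
  by (rule linear_conv_bounded_linear[THEN iffD1], rule linearI)
    (auto simp: transpose_def vec_eq_iff)

lemmas matmul_simps = bounded_bilinear.add_left[OF bounded_bilinear_matmul]
  bounded_bilinear.add_right[OF bounded_bilinear_matmul]
  bounded_bilinear.diff_left[OF bounded_bilinear_matmul]
  bounded_bilinear.diff_right[OF bounded_bilinear_matmul]
  bounded_bilinear.minus_left[OF bounded_bilinear_matmul]
  bounded_bilinear.minus_right[OF bounded_bilinear_matmul]
  bounded_bilinear.zero_left[OF bounded_bilinear_matmul]
  bounded_bilinear.zero_right[OF bounded_bilinear_matmul]
  bounded_bilinear.scaleR_left[OF bounded_bilinear_matmul]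
  bounded_bilinear.scaleR_right[OF bounded_bilinear_matmul]

lemmas matvec_simps = bounded_bilinear.add_left[OF bounded_bilinear_matvec]
  bounded_bilinear.add_right[OF bounded_bilinear_matvec]
  bounded_bilinear.diff_left[OF bounded_bilinear_matvec]
  bounded_bilinear.diff_right[OF bounded_bilinear_matvec]
  bounded_bilinear.minus_left[OF bounded_bilinear_matvec]
  bounded_bilinear.minus_right[OF bounded_bilinear_matvec]
  bounded_bilinear.zero_left[OF bounded_bilinear_matvec]
  bounded_bilinear.zero_right[OF bounded_bilinear_matvec]
  bounded_bilinear.scaleR_left[OF bounded_bilinear_matvec]
  bounded_bilinear.scaleR_right[OF bounded_bilinear_matvec]

lemmas transpose_simps = linear_add[OF bounded_linear.linear[OF bounded_linear_transpose]]
  linear_diff[OF bounded_linear.linear[OF bounded_linear_transpose]]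
  linear_neg[OF bounded_linear.linear[OF bounded_linear_transpose]]
  linear_scale[OF bounded_linear.linear[OF bounded_linear_transpose]]
  linear_0[OF bounded_linear.linear[OF bounded_linear_transpose]]

lemmas has_derivative_matmul = bounded_bilinear.FDERIV[OF bounded_bilinear_matmul]
lemmas has_derivative_matvec = bounded_bilinear.FDERIV[OF bounded_bilinear_matvec]
lemmas has_derivative_transpose = bounded_linear.has_derivative[OF bounded_linear_transpose]

lemmas smooth_on_matmul = smooth_on_bilinear[OF bounded_bilinear_matmul]
lemmas smooth_on_matvec = smooth_on_bilinear[OF bounded_bilinear_matvec]
lemmas smooth_on_transpose = smooth_on_linear_compose[OF bounded_linear_transpose]

lemma smooth_on_vecI:
  fixes f :: "'a::real_normed_vector \<Rightarrow> 'b::euclidean_space^'n::finite"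
  assumes "open S" "\<And>i. smooth_on S (\<lambda>x. f x $ i)"
  shows "smooth_on S f"
proof (rule smooth_on_componentwise[OF assms(1)])
  fix b :: "'b^'n" assume "b \<in> Basis"
  then obtain i u where "b = axis i u" unfolding Basis_vec_def by auto
  then show "smooth_on S (\<lambda>x. f x \<bullet> b)"
    by (simp add: inner_axis) (intro smooth_on_inner smooth_on_const assms)
qed

lemma smooth_on_nth:
  fixes f :: "'a::real_normed_vector \<Rightarrow> 'b::euclidean_space^'n::finite"
  shows "open S \<Longrightarrow> smooth_on S f \<Longrightarrow> smooth_on S (\<lambda>x. f x $ i)"
  by (rule smooth_on_linear_compose[OF bounded_linear_vec_nth])

lemma smooth_on_det:
  fixes f :: "'a::real_normed_vector \<Rightarrow> real^'n::finite^'n"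
  shows "open S \<Longrightarrow> smooth_on S f \<Longrightarrow> smooth_on S (\<lambda>x. det (f x))"
  unfolding det_def
  by (intro smooth_on_sum smooth_on_mult smooth_on_const smooth_on_prod smooth_on_nth)

lemma matrix_inv_left: "invertible A \<Longrightarrow> matrix_inv A ** A = mat 1"
  and matrix_inv_right: "invertible A \<Longrightarrow> A ** matrix_inv A = mat 1"
  using someI_ex[of "\<lambda>A'. A ** A' = mat 1 \<and> A' ** A = mat 1"]
  unfolding invertible_def matrix_inv_def by auto

lemma matrix_inv_unique:
  fixes A :: "real^'n::finite^'n"
  assumes "B ** A = mat 1" shows "matrix_inv A = B"
proof -
  have "invertible A" using assms by (metis invertible_def matrix_left_right_inverse)
  then have "B ** (A ** matrix_inv A) = B" by (simp add: matrix_inv_right)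
  then show ?thesis by (simp add: matrix_mul_assoc assms)
qed

text \<open>Cramer's rule gives the entries as quotients of determinants, which is how smoothness of
  the inverse is obtained.\<close>

lemma matrix_inv_cramer:
  fixes A :: "real^'n::finite^'n"
  assumes "invertible A"
  shows "matrix_inv A $ k $ l = det (\<chi> i j. if j = k then axis l 1 $ i else A$i$j) / det A"
proof -
  have "A *v (matrix_inv A *v axis l 1) = axis l 1"
    using assms by (simp add: matrix_vector_mul_assoc matrix_inv_right)
  then have "matrix_inv A *v axis l 1 = (\<chi> k. det (\<chi> i j. if j = k then axis l 1 $ i else A$i$j) / det A)"
    using cramer[of A "matrix_inv A *v axis l 1" "axis l 1"] assms by (simp add: invertible_det_nz)
  then have "(matrix_inv A *v axis l 1) $ k = det (\<chi> i j. if j = k then axis l 1 $ i else A$i$j) / det A"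
    by (simp only: vec_lambda_beta)
  then show ?thesis by (simp add: matrix_vector_mult_basis column_def)
qed

lemma smooth_on_matrix_inv:
  fixes f :: "'a::real_normed_vector \<Rightarrow> real^'n::finite^'n"
  assumes "open S" "smooth_on S f" "\<And>x. x \<in> S \<Longrightarrow> invertible (f x)"
  shows "smooth_on S (\<lambda>x. matrix_inv (f x))"
proof (intro smooth_on_vecI assms(1))
  fix k l
  have "smooth_on S (\<lambda>x. (\<chi> i j. if j = k then axis l 1 $ i else f x $ i $ j) :: real^'n^'n)"
  proof (intro smooth_on_vecI assms(1))
    fix i j :: 'n
    show "smooth_on S (\<lambda>x. ((\<chi> i j. if j = k then axis l 1 $ i else f x $ i $ j) :: real^'n^'n) $ i $ j)"
      by (cases "j = k") (simp_all add: smooth_on_const smooth_on_nth assms(1,2))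
  qed
  then have "smooth_on S (\<lambda>x. det ((\<chi> i j. if j = k then axis l 1 $ i else f x $ i $ j)::real^'n^'n) * inverse (det (f x)))"
    using assms(3) by (intro smooth_on_mult smooth_on_inverse smooth_on_det assms(1,2))
       (auto simp: invertible_det_nz)
  then show "smooth_on S (\<lambda>x. matrix_inv (f x) $ k $ l)"
    by (rule smooth_on_cong[OF _ assms(1)]) (simp add: matrix_inv_cramer assms(3) divide_inverse)
qed

text \<open>Meant for Christoffel symbols, whose smoothness is known for fixed vector arguments
  only: \<open>hor_field\<close> feeds them the vector E a, which moves with the frame.\<close>

lemma smooth_on_linear_arg:
  fixes T :: "'a::euclidean_space \<Rightarrow> 'b::euclidean_space \<Rightarrow> 'c::real_normed_vector"
  assumes "open S" "\<And>y. y \<in> S \<Longrightarrow> linear (T y)" "\<And>v. smooth_on S (\<lambda>y. T y v)"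
    and "open W" "smooth_on W p" "smooth_on W q" "p ` W \<subseteq> S"
  shows "smooth_on W (\<lambda>z. T (p z) (q z))"
proof (rule smooth_on_cong)
  show "smooth_on W (\<lambda>z. \<Sum>b\<in>Basis. (q z \<bullet> b) *\<^sub>R T (p z) b)"
    by (intro smooth_on_sum smooth_on_scaleR smooth_on_inner smooth_on_const
        smooth_on_compose[OF assms(4,1,7,5,3)] assms)
  show "(\<Sum>b\<in>Basis. (q z \<bullet> b) *\<^sub>R T (p z) b) = T (p z) (q z)" if "z \<in> W" for z
    by (rule linear_euclidean_sum[symmetric]) (use assms(2,7) that in auto)
qed fact

lemma has_derivative_linear_arg:
  fixes T :: "'a::euclidean_space \<Rightarrow> 'b::euclidean_space \<Rightarrow> 'c::real_normed_vector"
  assumes "open S" "\<And>y. y \<in> S \<Longrightarrow> linear (T y)" "\<And>v. smooth_on S (\<lambda>y. T y v)"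
    and "(p has_derivative p') (at z)" "(q has_derivative q') (at z)" "p z \<in> S"
  shows "((\<lambda>z. T (p z) (q z)) has_derivative (\<lambda>v. fd (\<lambda>y. T y (q z)) (p z) (p' v) + T (p z) (q' v))) (at z)"
proof -
  have d: "((\<lambda>y. T y v) has_derivative fd (\<lambda>y. T y v) (p z)) (at (p z))" for v
    using assms(3,6) smooth_on_has_derivative by blast
  have dp: "((\<lambda>y. T (p y) v) has_derivative (\<lambda>t. fd (\<lambda>y. T y v) (p z) (p' t))) (at z)" for v
    using diff_chain_at[OF assms(4) d] by (simp add: o_def)
  have s: "((\<lambda>y. \<Sum>b\<in>Basis. (q y \<bullet> b) *\<^sub>R T (p y) b) has_derivative
      (\<lambda>v. \<Sum>b\<in>Basis. (q z \<bullet> b) *\<^sub>R fd (\<lambda>y. T y b) (p z) (p' v) + (q' v \<bullet> b) *\<^sub>R T (p z) b)) (at z)"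
    by (auto intro!: derivative_eq_intros dp assms(5))
  have c: "((\<lambda>y. \<Sum>b\<in>Basis. (q z \<bullet> b) *\<^sub>R T y b) has_derivative
      (\<lambda>v. \<Sum>b\<in>Basis. (q z \<bullet> b) *\<^sub>R fd (\<lambda>y. T y b) (p z) v)) (at (p z))"
    by (auto intro!: derivative_eq_intros d)
  have "fd (\<lambda>y. T y (q z)) (p z) v = (\<Sum>b\<in>Basis. (q z \<bullet> b) *\<^sub>R fd (\<lambda>y. T y b) (p z) v)" for v
    by (rule fd_eqI, rule has_derivative_transform_within_open[OF c assms(1,6)])
      (simp add: linear_euclidean_sum[OF assms(2), symmetric])
  moreover have "T (p z) (q' v) = (\<Sum>b\<in>Basis. (q' v \<bullet> b) *\<^sub>R T (p z) b)" for v
    by (rule linear_euclidean_sum[OF assms(2)[OF assms(6)]])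
  ultimately have *: "(\<lambda>v. fd (\<lambda>y. T y (q z)) (p z) (p' v) + T (p z) (q' v)) =
     (\<lambda>v. \<Sum>b\<in>Basis. (q z \<bullet> b) *\<^sub>R fd (\<lambda>y. T y b) (p z) (p' v) + (q' v \<bullet> b) *\<^sub>R T (p z) b)"
    by (simp add: sum.distrib)
  have "isCont p z" using assms(4) has_derivative_continuous by blast
  then have "\<forall>\<^sub>F y in at z. p y \<in> S"
    using assms(1,6) by (auto simp: isCont_def intro: topological_tendstoD)
  then have "\<forall>\<^sub>F y in at z. (\<Sum>b\<in>Basis. (q y \<bullet> b) *\<^sub>R T (p y) b) = T (p y) (q y)"
    by (rule eventually_mono) (simp add: linear_euclidean_sum[OF assms(2), symmetric])
  then show ?thesis unfolding *
    by (intro has_derivative_transform_eventually[OF s])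
      (simp_all add: linear_euclidean_sum[OF assms(2)[OF assms(6)], symmetric])
qed

lemma smooth_on_bilinear_arg:
  fixes T :: "'a::euclidean_space \<Rightarrow> 'b::euclidean_space \<Rightarrow> 'd::euclidean_space \<Rightarrow> 'c::real_normed_vector"
  assumes "open S" "\<And>y v. y \<in> S \<Longrightarrow> linear (T y v)" "\<And>y v. y \<in> S \<Longrightarrow> linear (\<lambda>u. T y u v)"
     "\<And>u v. smooth_on S (\<lambda>y. T y u v)"
    and "open W" "smooth_on W p" "smooth_on W q" "smooth_on W r" "p ` W \<subseteq> S"
  shows "smooth_on W (\<lambda>z. T (p z) (q z) (r z))"
proof (rule smooth_on_cong)
  show "smooth_on W (\<lambda>z. \<Sum>b\<in>Basis. (r z \<bullet> b) *\<^sub>R T (p z) (q z) b)"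
    by (intro smooth_on_sum smooth_on_scaleR smooth_on_inner smooth_on_const
        smooth_on_linear_arg[where T="\<lambda>y u. T y u _", OF assms(1,3,4,5,6,7,9)] assms)
  show "(\<Sum>b\<in>Basis. (r z \<bullet> b) *\<^sub>R T (p z) (q z) b) = T (p z) (q z) (r z)" if "z \<in> W" for z
    by (rule linear_euclidean_sum[symmetric]) (use assms(2,9) that in auto)
qed fact

lemma has_derivative_bilinear_arg:
  fixes T :: "'a::euclidean_space \<Rightarrow> 'b::euclidean_space \<Rightarrow> 'd::euclidean_space \<Rightarrow> 'c::real_normed_vector"
  assumes "open S" "\<And>y v. y \<in> S \<Longrightarrow> linear (T y v)" "\<And>y v. y \<in> S \<Longrightarrow> linear (\<lambda>u. T y u v)"
     "\<And>u v. smooth_on S (\<lambda>y. T y u v)"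
    and "(p has_derivative p') (at z)" "(q has_derivative q') (at z)" "(r has_derivative r') (at z)" "p z \<in> S"
  shows "((\<lambda>z. T (p z) (q z) (r z)) has_derivative
    (\<lambda>v. fd (\<lambda>y. T y (q z) (r z)) (p z) (p' v) + T (p z) (q' v) (r z) + T (p z) (q z) (r' v))) (at z)"
proof -
  have d: "((\<lambda>y. T y u v) has_derivative fd (\<lambda>y. T y u v) (p z)) (at (p z))" for u v
    using assms(4,8) smooth_on_has_derivative by blast
  have dp: "((\<lambda>y. T (p y) (q y) v) has_derivative
       (\<lambda>t. fd (\<lambda>y. T y (q z) v) (p z) (p' t) + T (p z) (q' t) v)) (at z)" for v
    by (rule has_derivative_linear_arg[OF assms(1,3,4,5,6,8)])
  have "((\<lambda>y. (r y \<bullet> b) *\<^sub>R T (p y) (q y) b) has_derivative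
      (\<lambda>v. (r z \<bullet> b) *\<^sub>R (fd (\<lambda>y. T y (q z) b) (p z) (p' v) + T (p z) (q' v) b)
         + (r' v \<bullet> b) *\<^sub>R T (p z) (q z) b)) (at z)" for b
    by (rule has_derivative_scaleR[OF has_derivative_inner_left[OF assms(7)] dp])
  then have s: "((\<lambda>y. \<Sum>b\<in>Basis. (r y \<bullet> b) *\<^sub>R T (p y) (q y) b) has_derivative
      (\<lambda>v. \<Sum>b\<in>Basis. (r z \<bullet> b) *\<^sub>R (fd (\<lambda>y. T y (q z) b) (p z) (p' v) + T (p z) (q' v) b)
         + (r' v \<bullet> b) *\<^sub>R T (p z) (q z) b)) (at z)"
    by (rule has_derivative_sum)
  have c: "((\<lambda>y. \<Sum>b\<in>Basis. (r z \<bullet> b) *\<^sub>R T y (q z) b) has_derivative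
      (\<lambda>v. \<Sum>b\<in>Basis. (r z \<bullet> b) *\<^sub>R fd (\<lambda>y. T y (q z) b) (p z) v)) (at (p z))"
    by (auto intro!: derivative_eq_intros d)
  have e1: "fd (\<lambda>y. T y (q z) (r z)) (p z) v = (\<Sum>b\<in>Basis. (r z \<bullet> b) *\<^sub>R fd (\<lambda>y. T y (q z) b) (p z) v)" for v
    by (rule fd_eqI, rule has_derivative_transform_within_open[OF c assms(1,8)])
      (simp add: linear_euclidean_sum[OF assms(2), symmetric])
  have e2: "T (p z) u v = (\<Sum>b\<in>Basis. (v \<bullet> b) *\<^sub>R T (p z) u b)" for u v
    by (rule linear_euclidean_sum[OF assms(2)[OF assms(8)]])
  have *: "(\<lambda>v. fd (\<lambda>y. T y (q z) (r z)) (p z) (p' v) + T (p z) (q' v) (r z) + T (p z) (q z) (r' v)) =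
     (\<lambda>v. \<Sum>b\<in>Basis. (r z \<bullet> b) *\<^sub>R (fd (\<lambda>y. T y (q z) b) (p z) (p' v) + T (p z) (q' v) b)
         + (r' v \<bullet> b) *\<^sub>R T (p z) (q z) b)"
    by (rule ext, subst e1, subst e2[of _ "r z"], subst e2[of "q z" "r' _"])
      (simp only: sum.distrib scaleR_add_right)
  have "isCont p z" using assms(5) has_derivative_continuous by blast
  then have "\<forall>\<^sub>F y in at z. p y \<in> S"
    using assms(1,8) by (auto simp: isCont_def intro: topological_tendstoD)
  then have "\<forall>\<^sub>F y in at z. (\<Sum>b\<in>Basis. (r y \<bullet> b) *\<^sub>R T (p y) (q y) b) = T (p y) (q y) (r y)"
    by (rule eventually_mono) (simp add: linear_euclidean_sum[OF assms(2), symmetric])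
  then show ?thesis unfolding *
    by (intro has_derivative_transform_eventually[OF s])
      (simp_all add: linear_euclidean_sum[OF assms(2)[OF assms(8)], symmetric])
qed

lemma linear_fd_param:
  fixes T :: "'a::real_normed_vector \<Rightarrow> 'b::real_vector \<Rightarrow> 'c::real_normed_vector"
  assumes "open S" "x \<in> S" "\<And>y. y \<in> S \<Longrightarrow> linear (T y)" "\<And>v. smooth_on S (\<lambda>y. T y v)"
  shows "linear (\<lambda>v. fd (\<lambda>y. T y v) x u)"
proof (rule linearI)
  have d: "((\<lambda>y. T y v) has_derivative fd (\<lambda>y. T y v) x) (at x)" for v
    using assms smooth_on_has_derivative by blast
  fix v w :: 'b and r :: real
  show "fd (\<lambda>y. T y (v + w)) x u = fd (\<lambda>y. T y v) x u + fd (\<lambda>y. T y w) x u"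
    by (rule fd_eqI, rule has_derivative_transform_within_open[OF has_derivative_add[OF d d] assms(1,2)])
      (simp add: linear_add[OF assms(3)])
  show "fd (\<lambda>y. T y (r *\<^sub>R v)) x u = r *\<^sub>R fd (\<lambda>y. T y v) x u"
    by (rule fd_eqI, rule has_derivative_transform_within_open[OF has_derivative_scaleR_right[OF d] assms(1,2)])
      (simp add: linear_scale[OF assms(3)])
qed

section \<open>The Levi-Civita connection in coordinates\<close>

text \<open>\<open>chr_mat G x v\<close> is the matrix of \<open>w \<mapsto> \<Gamma>(v, w)\<close>, and \<open>curv_mat G x v w\<close> that of \<open>R(v, w)\<close>.
  The fields \<open>hor_field\<close> and \<open>ver_field\<close> extend the fundamental horizontal and vertical fields to
  all pairs \<open>(x, E)\<close>, where \<open>E\<close> may be any matrix, so that they live on an open set.\<close>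

definition chr_mat :: "(real^'n::finite \<Rightarrow> real^'n^'n) \<Rightarrow> real^'n \<Rightarrow> real^'n \<Rightarrow> real^'n^'n" where
  "chr_mat G x v = (\<chi> k j. \<Sum>i\<in>UNIV. local_christoffel G x k i j * v $ i)"

definition dchr :: "(real^'n::finite \<Rightarrow> real^'n^'n) \<Rightarrow> real^'n \<Rightarrow> real^'n \<Rightarrow> real^'n \<Rightarrow> real^'n^'n" where
  "dchr G x u v = fd (\<lambda>y. chr_mat G y v) x u"

definition curv_mat :: "(real^'n::finite \<Rightarrow> real^'n^'n) \<Rightarrow> real^'n \<Rightarrow> real^'n \<Rightarrow> real^'n \<Rightarrow> real^'n^'n" where
  "curv_mat G x v w = dchr G x v w - dchr G x w v + chr_mat G x v ** chr_mat G x w - chr_mat G x w ** chr_mat G x v"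

text \<open>The covariant derivative of the curvature in direction \<open>u\<close>: the connection
  acts on the endomorphism by a commutator and on each of the arguments \<open>v\<close> and
  \<open>w\<close>.\<close>

definition nabla_curv :: "(real^'n::finite \<Rightarrow> real^'n^'n) \<Rightarrow> real^'n \<Rightarrow> real^'n \<Rightarrow> real^'n \<Rightarrow> real^'n \<Rightarrow> real^'n^'n" where
  "nabla_curv G x u v w = fd (\<lambda>y. curv_mat G y v w) x u
     + chr_mat G x u ** curv_mat G x v w - curv_mat G x v w ** chr_mat G x u
     - curv_mat G x (chr_mat G x u *v v) w - curv_mat G x v (chr_mat G x u *v w)"

definition hor_field :: "(real^'n::finite \<Rightarrow> real^'n^'n) \<Rightarrow> real^'n \<Rightarrow> (real^'n) \<times> (real^'n^'n) \<Rightarrow> (real^'n) \<times> (real^'n^'n)" where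
  "hor_field G a z = (snd z *v a, - (chr_mat G (fst z) (snd z *v a) ** snd z))"

definition ver_field :: "real^'n::finite^'n \<Rightarrow> (real^'n) \<times> (real^'n^'n) \<Rightarrow> (real^'n) \<times> (real^'n^'n)" where
  "ver_field M z = (0, snd z ** M)"

text \<open>On orthonormal frames E^T G is the inverse of E, so this is the curvature form u^-1 R u.
  The form without an inverse stays smooth at singular E.\<close>

definition curv_frame :: "(real^'n::finite \<Rightarrow> real^'n^'n) \<Rightarrow> real^'n \<Rightarrow> real^'n \<Rightarrow> (real^'n) \<times> (real^'n^'n) \<Rightarrow> real^'n^'n" where
  "curv_frame G a b z =
     transpose (snd z) ** G (fst z) ** curv_mat G (fst z) (snd z *v a) (snd z *v b) ** snd z"

lemma linear_axis_sum:
  assumes "linear l" shows "l v = (\<Sum>i\<in>UNIV. v $ i *\<^sub>R l (axis i (1::real)))"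
proof -
  have "l v = l (\<Sum>i\<in>UNIV. v $ i *\<^sub>R axis i 1)"
    using basis_expansion[of v] by (simp add: scalar_mult_eq_scaleR)
  then show ?thesis using assms by (simp add: linear_sum linear_scale)
qed

lemma local_chr_eq: "local_chr G x v w = chr_mat G x v *v w"
proof -
  have "(\<Sum>i\<in>UNIV. \<Sum>j\<in>UNIV. local_christoffel G x k i j * v $ i * w $ j) =
     (\<Sum>j\<in>UNIV. \<Sum>i\<in>UNIV. local_christoffel G x k i j * v $ i * w $ j)" for k
    by (rule sum.swap)
  then show ?thesis
    by (simp add: local_chr_def chr_mat_def vec_eq_iff matrix_vector_mult_def sum_distrib_right)
qed

lemma linear_chr_mat: "linear (chr_mat G x)"
  by (rule linearI)
    (auto simp: chr_mat_def vec_eq_iff distrib_left sum.distrib sum_distrib_left mult_ac)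

lemmas chr_mat_simps = linear_add[OF linear_chr_mat] linear_diff[OF linear_chr_mat]
  linear_neg[OF linear_chr_mat] linear_0[OF linear_chr_mat]

lemma smooth_on_Pair:
  fixes f :: "'a::real_normed_vector \<Rightarrow> 'b::euclidean_space" and g :: "'a \<Rightarrow> 'c::euclidean_space"
  assumes "open S" "smooth_on S f" "smooth_on S g" shows "smooth_on S (\<lambda>x. (f x, g x))"
proof -
  have "smooth_on S (\<lambda>x. (f x, 0) + (0, g x))"
    by (intro smooth_on_add assms smooth_on_linear_compose[where l="\<lambda>y. (y, 0)"]
        smooth_on_linear_compose[where l="\<lambda>y. (0, y)"] bounded_linear_Pair bounded_linear_ident bounded_linear_zero)
  then show ?thesis by simp
qed

lemma smooth_on_fst: "open S \<Longrightarrow> smooth_on S fst"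
  and smooth_on_snd: "open S \<Longrightarrow> smooth_on S snd"
  by (simp_all add: smooth_on_linear bounded_linear_fst bounded_linear_snd)

lemma inner_transpose: "z \<bullet> (transpose A *v y) = (A *v z) \<bullet> (y :: real^'n::finite)"
  using dot_lmul_matrix[of z "transpose A" y] by (simp only: vector_transpose_matrix)

section \<open>Levi-Civita connection and curvature of a metric on an open set\<close>

locale local_metric =
  fixes S :: "(real^'n::finite) set" and G :: "real^'n \<Rightarrow> real^'n^'n"
  assumes open_S: "open S" and smooth_G: "smooth_on S G"
    and sym_G: "x \<in> S \<Longrightarrow> transpose (G x) = G x"
    and inv_G: "x \<in> S \<Longrightarrow> invertible (G x)"
begin

abbreviation "cm \<equiv> chr_mat G"
abbreviation "R \<equiv> curv_mat G"
abbreviation "D \<equiv> dchr G"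

lemma has_derivative_G: "x \<in> S \<Longrightarrow> (G has_derivative fd G x) (at x)"
  by (rule smooth_on_has_derivative[OF smooth_G])

lemma partial_G: "x \<in> S \<Longrightarrow> partial i (\<lambda>y. G y $ j $ l) x = fd G x (axis i 1) $ j $ l"
  unfolding partial_def
  by (rule fd_eqI) (intro bounded_linear.has_derivative[OF bounded_linear_vec_nth] has_derivative_G)

lemma fd_G_sym: assumes "x \<in> S" shows "transpose (fd G x v) = fd G x v"
proof -
  have "((\<lambda>y. transpose (G y)) has_derivative (\<lambda>v. transpose (fd G x v))) (at x)"
    by (intro has_derivative_transpose has_derivative_G assms)
  then have "(G has_derivative (\<lambda>v. transpose (fd G x v))) (at x)"
    by (rule has_derivative_transform_within_open[OF _ open_S assms sym_G])
  then show ?thesis by (metis fd_eqI)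
qed

text \<open>Clears the inverse of the metric: the right-hand side is the Christoffel symbol of the
  first kind, contracted with \<open>v\<close>.\<close>

lemma G_chr_mat:
  assumes "x \<in> S"
  shows "G x ** cm x v = (\<chi> l j. 1/2 * (\<Sum>i\<in>UNIV. (fd G x (axis i 1) $ j $ l
     + fd G x (axis j 1) $ i $ l - fd G x (axis l 1) $ i $ j) * v $ i))" (is "_ = ?Q")
proof -
  have "cm x v = matrix_inv (G x) ** ?Q"
  proof -
    have "(\<Sum>i\<in>UNIV. (1/2 * (\<Sum>l\<in>UNIV. m $ k $ l * F i l)) * v $ i) =
      (\<Sum>l\<in>UNIV. m $ k $ l * (1/2 * (\<Sum>i\<in>UNIV. F i l * v $ i)))" for k and F :: "'n \<Rightarrow> 'n \<Rightarrow> real" and m :: "real^'n^'n"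
    proof -
      have "(\<Sum>i\<in>UNIV. (1/2 * (\<Sum>l\<in>UNIV. m $ k $ l * F i l)) * v $ i) =
         (\<Sum>i\<in>UNIV. \<Sum>l\<in>UNIV. m $ k $ l * (1/2 * (F i l * v $ i)))"
        by (simp add: sum_distrib_left sum_distrib_right sum_divide_distrib mult_ac)
      also have "\<dots> = (\<Sum>l\<in>UNIV. \<Sum>i\<in>UNIV. m $ k $ l * (1/2 * (F i l * v $ i)))" by (rule sum.swap)
      finally show ?thesis by (simp add: sum_distrib_left)
    qed
    then show ?thesis
      unfolding chr_mat_def local_christoffel_def partial_G[OF assms] matrix_matrix_mult_def
      by (simp add: vec_eq_iff)
  qed
  then show ?thesis by (simp add: matrix_mul_assoc matrix_inv_right inv_G[OF assms])
qed

text \<open>When the first-kind symbol is added to its transpose, the derivatives in the directions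
  \<open>l\<close> and \<open>j\<close> cancel and only the one along \<open>v\<close> is
  left.\<close>

lemma metric_compatible:
  assumes "x \<in> S"
  shows "fd G x v = transpose (cm x v) ** G x + G x ** cm x v"
proof -
  have sym: "fd G x u $ i $ j = fd G x u $ j $ i" for u i j
    using fd_G_sym[OF assms, of u] by (metis (no_types) transpose_def vec_lambda_beta)
  have t: "transpose (cm x v) ** G x = transpose (G x ** cm x v)"
    by (simp add: matrix_transpose_mul sym_G[OF assms])
  have "fd G x v = (\<Sum>i\<in>UNIV. v $ i *\<^sub>R fd G x (axis i 1))"
    using linear_axis_sum[OF has_derivative_linear[OF has_derivative_G[OF assms]]] .
  then have "fd G x v $ l $ j = (\<Sum>i\<in>UNIV. v $ i * fd G x (axis i 1) $ l $ j)" for l j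
    by simp
  moreover have "1/2 * (\<Sum>i\<in>UNIV. (fd G x (axis i 1) $ l $ j + fd G x (axis l 1) $ i $ j - fd G x (axis j 1) $ i $ l) * v $ i)
     + 1/2 * (\<Sum>i\<in>UNIV. (fd G x (axis i 1) $ j $ l + fd G x (axis j 1) $ i $ l - fd G x (axis l 1) $ i $ j) * v $ i)
     = (\<Sum>i\<in>UNIV. v $ i * fd G x (axis i 1) $ l $ j)" for l j
  proof -
    have "\<And>i. 1/2 * ((fd G x (axis i 1) $ l $ j + fd G x (axis l 1) $ i $ j - fd G x (axis j 1) $ i $ l) * v $ i)
      + 1/2 * ((fd G x (axis i 1) $ j $ l + fd G x (axis j 1) $ i $ l - fd G x (axis l 1) $ i $ j) * v $ i)
      = v $ i * fd G x (axis i 1) $ l $ j"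
      by (simp only: sym[of _ j l]) (simp add: algebra_simps)
    then show ?thesis by (simp only: sum_distrib_left sum.distrib[symmetric])
  qed
  ultimately show ?thesis unfolding t G_chr_mat[OF assms]
    by (simp add: vec_eq_iff transpose_def)
qed

lemma christoffel_sym:
  assumes "x \<in> S" shows "local_christoffel G x k i j = local_christoffel G x k j i"
proof -
  have sym: "fd G x u $ i $ j = fd G x u $ j $ i" for u i j
    using fd_G_sym[OF assms, of u] by (metis (no_types) transpose_def vec_lambda_beta)
  show ?thesis unfolding local_christoffel_def partial_G[OF assms]
    by (simp add: sym[of _ i j] add.commute)
qed

lemma chr_mat_sym:
  assumes "x \<in> S" shows "cm x v *v w = cm x w *v v"
proof -
  have *: "(cm x v *v w) $ k = (\<Sum>j\<in>UNIV. \<Sum>i\<in>UNIV. local_christoffel G x k i j * v $ i * w $ j)" for v w k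
    by (simp add: chr_mat_def matrix_vector_mult_def sum_distrib_right)
  have "(\<Sum>j\<in>UNIV. \<Sum>i\<in>UNIV. local_christoffel G x k i j * v $ i * w $ j) =
     (\<Sum>j\<in>UNIV. \<Sum>i\<in>UNIV. local_christoffel G x k i j * w $ i * v $ j)" for k
    by (subst sum.swap) (auto intro!: sum.cong simp: christoffel_sym[OF assms])
  then show ?thesis by (simp add: vec_eq_iff *)
qed

text \<open>The difference tensor \<open>T\<close> is symmetric in its first two arguments (no
  torsion) and antisymmetric in its last two (metric compatibility). Alternating the two symmetries
  six times returns to the same arguments with the opposite sign, so \<open>T\<close>
  vanishes.\<close>

lemma levi_civita_unique:
  assumes "x \<in> S" "\<And>v w. L v *v w = L w *v v"
    and "\<And>v. fd G x v = transpose (L v) ** G x + G x ** L v"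
  shows "L v = cm x v"
proof -
  define T where "T v w z = z \<bullet> (G x *v ((L v - cm x v) *v w))" for v w z
  have s: "T v w z = T w v z" for v w z
    by (simp add: T_def matvec_simps assms(2)[of v w] chr_mat_sym[OF assms(1), of v w])
  have a: "T v w z = - T v z w" for v w z
  proof -
    have "transpose (L v - cm x v) ** G x + G x ** (L v - cm x v) = 0"
    proof -
      have "transpose (L v) ** G x + G x ** L v = transpose (cm x v) ** G x + G x ** cm x v"
        using assms(3)[of v] metric_compatible[OF assms(1), of v] by simp
      moreover have "transpose (L v - cm x v) ** G x + G x ** (L v - cm x v) =
         (transpose (L v) ** G x + G x ** L v) - (transpose (cm x v) ** G x + G x ** cm x v)"
        by (simp add: matmul_simps transpose_simps)
      ultimately show ?thesis by simp
    qed
    then have "z \<bullet> ((transpose (L v - cm x v) ** G x + G x ** (L v - cm x v)) *v w) = 0" by simp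
    then have "z \<bullet> (transpose (L v - cm x v) *v (G x *v w)) + T v w z = 0"
      unfolding T_def by (simp only: matvec_simps(1) inner_add_right matrix_vector_mul_assoc)
    moreover have "z \<bullet> (transpose (L v - cm x v) *v (G x *v w)) = T v z w"
      using inner_transpose[of w "G x" "(L v - cm x v) *v z"] sym_G[OF assms(1)]
      by (simp only: inner_transpose T_def) (simp add: inner_commute)
    ultimately show ?thesis by simp
  qed
  have "T v w z = 0" for v w z
    using s[of v w z] a[of w v z] s[of w z v] a[of z w v] s[of z v w] a[of v z w] by linarith
  then have "G x *v ((L v - cm x v) *v w) = 0" for v w
    unfolding T_def by (metis inner_eq_zero_iff)
  then have "matrix_inv (G x) *v (G x *v ((L v - cm x v) *v w)) = 0" for w by simp
  then have "(L v - cm x v) *v w = 0" for w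
    by (simp add: matrix_vector_mul_assoc matrix_mul_assoc matrix_inv_left inv_G[OF assms(1)])
  then show ?thesis by (simp add: matrix_eq matvec_simps)
qed

lemma smooth_chr_mat: "smooth_on S (\<lambda>x. cm x v)"
proof -
  have *: "smooth_on S (\<lambda>x. local_christoffel G x k i j)" for k i j
  proof (rule smooth_on_cong[OF _ open_S])
    show "smooth_on S (\<lambda>x. 1/2 * (\<Sum>l\<in>UNIV. matrix_inv (G x) $ k $ l *
       (fd G x (axis i 1) $ j $ l + fd G x (axis j 1) $ i $ l - fd G x (axis l 1) $ i $ j)))"
      by (intro smooth_on_mult smooth_on_sum smooth_on_const smooth_on_add smooth_on_diff smooth_on_nth
          smooth_on_fd smooth_G smooth_on_matrix_inv open_S inv_G)
  qed (simp add: local_christoffel_def partial_G)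
  show ?thesis unfolding chr_mat_def
    by (intro smooth_on_vecI open_S) (simp, intro smooth_on_sum smooth_on_mult smooth_on_const open_S *)
qed

lemma smooth_dchr: "smooth_on S (\<lambda>x. D x u v)"
  unfolding dchr_def by (intro smooth_on_fd smooth_chr_mat)

lemma has_derivative_chr_mat: "x \<in> S \<Longrightarrow> ((\<lambda>x. cm x v) has_derivative (\<lambda>u. D x u v)) (at x)"
  unfolding dchr_def by (rule smooth_on_has_derivative[OF smooth_chr_mat])

lemma linear_dchr_left: "x \<in> S \<Longrightarrow> linear (\<lambda>u. D x u v)"
  using has_derivative_linear[OF has_derivative_chr_mat] .

lemma linear_dchr_right: "x \<in> S \<Longrightarrow> linear (D x u)"
  using linear_fd_param[OF open_S _ linear_chr_mat smooth_chr_mat] by (simp add: dchr_def[abs_def])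

lemma dchr_sym:
  assumes "x \<in> S" shows "D x u v *v w = D x u w *v v"
proof -
  have "((\<lambda>x. cm x v *v w) has_derivative (\<lambda>u. cm x v *v 0 + D x u v *v w)) (at x)" for v w
    by (intro has_derivative_matvec has_derivative_chr_mat assms has_derivative_const)
  then have d: "((\<lambda>x. cm x v *v w) has_derivative (\<lambda>u. D x u v *v w)) (at x)" for v w
    by (simp add: matvec_simps)
  have "((\<lambda>x. cm x v *v w) has_derivative (\<lambda>u. D x u w *v v)) (at x)"
    by (rule has_derivative_transform_within_open[OF d[of w v] open_S assms chr_mat_sym])
  with d show ?thesis by (metis fd_eq)
qed

lemma linear_curv_right: "x \<in> S \<Longrightarrow> linear (R x v)"
  and linear_curv_left: "x \<in> S \<Longrightarrow> linear (\<lambda>v. R x v w)"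
  unfolding curv_mat_def
  by (rule linearI; simp add: linear_add[OF linear_dchr_left] linear_add[OF linear_dchr_right]
      linear_scale[OF linear_dchr_left] linear_scale[OF linear_dchr_right] linear_add[OF linear_chr_mat]
      linear_scale[OF linear_chr_mat] matmul_simps algebra_simps)+

lemma smooth_curv: "smooth_on S (\<lambda>x. R x v w)"
  unfolding curv_mat_def
  by (intro smooth_on_diff smooth_on_add smooth_on_matmul smooth_dchr smooth_chr_mat open_S)

lemma curv_antisym: "R x v w = - R x w v"
  by (simp add: curv_mat_def)

lemma local_riemann_eq:
  assumes "x \<in> S" shows "local_riemann G x v w z = R x v w *v z"
proof -
  have n: "local_nabla G (\<lambda>_. w) (\<lambda>_. z) = (\<lambda>y. cm y w *v z)" for w
    by (simp add: local_nabla_def local_chr_eq fun_eq_iff)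
  have "((\<lambda>x. cm x w *v z) has_derivative (\<lambda>u. cm x w *v 0 + D x u w *v z)) (at x)" for w
    by (intro has_derivative_matvec has_derivative_chr_mat assms has_derivative_const)
  then have d: "((\<lambda>x. cm x w *v z) has_derivative (\<lambda>u. D x u w *v z)) (at x)" for w
    by (simp add: matvec_simps)
  show ?thesis unfolding local_riemann_def n
    by (simp add: local_nabla_def local_chr_eq fd_eqI[OF d] curv_mat_def matvec_simps matrix_vector_mul_assoc)
qed

text \<open>In the cyclic sum every term meets one of opposite sign with its last two vectors
  exchanged; both \<open>dchr\<close> and \<open>chr_mat\<close> are symmetric under this
  exchange.\<close>

lemma first_bianchi:
  assumes "x \<in> S" shows "R x u v *v w + R x v w *v u + R x w u *v v = 0"
  by (simp add: curv_mat_def matvec_simps matrix_vector_mul_assoc[symmetric]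
      dchr_sym[OF assms, of u v w] dchr_sym[OF assms, of v u w] dchr_sym[OF assms, of w u v]
      chr_mat_sym[OF assms, of v u] chr_mat_sym[OF assms, of w u] chr_mat_sym[OF assms, of w v])

section \<open>Extended horizontal and vertical fields on pairs (x, E)\<close>

abbreviation "W \<equiv> S \<times> (UNIV :: (real^'n^'n) set)"

lemma open_W: "open W"
  by (intro open_Times open_S open_UNIV)

lemma smooth_on_W_fst:
  fixes h :: "real^'n \<Rightarrow> 'c::real_normed_vector"
  assumes "smooth_on S h" shows "smooth_on W (\<lambda>z. h (fst z))"
  by (rule smooth_on_compose[OF open_W open_S _ smooth_on_fst[OF open_W] assms]) auto

lemma smooth_frame: "smooth_on W (\<lambda>z. snd z *v a)"
  by (intro smooth_on_matvec smooth_on_snd smooth_on_const open_W)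

lemma smooth_hor_field: "smooth_on W (hor_field G a)"
  unfolding hor_field_def[abs_def]
  by (intro smooth_on_Pair open_W smooth_frame smooth_on_minus smooth_on_matmul smooth_on_snd
      smooth_on_linear_arg[OF open_S linear_chr_mat smooth_chr_mat open_W smooth_on_fst]) auto

lemma smooth_ver_field: "smooth_on W (ver_field M)"
  unfolding ver_field_def[abs_def]
  by (intro smooth_on_Pair open_W smooth_on_matmul smooth_on_snd smooth_on_const)

lemma has_derivative_frame: "((\<lambda>z::(real^'n) \<times> (real^'n^'n). snd z *v a) has_derivative (\<lambda>w. snd w *v a)) (at z)"
  by (rule has_derivative_eq_rhs[OF has_derivative_matvec[OF has_derivative_snd[OF has_derivative_ident]
        has_derivative_const]]) (simp add: matvec_simps)

lemma has_derivative_hor_field: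
  assumes "fst z \<in> S"
  shows "(hor_field G a has_derivative (\<lambda>w. (snd w *v a,
     - (cm (fst z) (snd z *v a) ** snd w + (D (fst z) (fst w) (snd z *v a) + cm (fst z) (snd w *v a)) ** snd z)))) (at z)"
  unfolding hor_field_def[abs_def] dchr_def
  by (intro has_derivative_Pair has_derivative_minus has_derivative_matmul has_derivative_frame
      has_derivative_linear_arg[OF open_S linear_chr_mat smooth_chr_mat] has_derivative_fst
      has_derivative_snd has_derivative_ident assms)

lemma has_derivative_ver_field: "(ver_field M has_derivative ver_field M) (at z)"
  unfolding ver_field_def[abs_def]
  using has_derivative_Pair[OF has_derivative_const[of 0]
      has_derivative_matmul[OF has_derivative_snd[OF has_derivative_ident] has_derivative_const[of M]]]
  by (simp add: matmul_simps)

text \<open>The base component of the bracket is the torsion and vanishes by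
  \<open>chr_mat_sym\<close>; the matrix component collects the derivatives and products of
  Christoffel matrices into the curvature.\<close>

lemma bracket_hor_hor:
  fixes h :: "(real^'n) \<times> (real^'n^'n) \<Rightarrow> 'c::euclidean_space"
  assumes "open V" "V \<subseteq> W" "smooth_on V h" "z \<in> V"
  shows "fd (\<lambda>y. fd h y (hor_field G b y)) z (hor_field G a z) - fd (\<lambda>y. fd h y (hor_field G a y)) z (hor_field G b z)
    = fd h z (0, - (R (fst z) (snd z *v a) (snd z *v b) ** snd z))"
proof -
  have S: "fst z \<in> S" using assms by auto
  show ?thesis
    apply (subst fd_bracket[OF assms(1,3,4) has_derivative_hor_field[OF S] has_derivative_hor_field[OF S]])
    apply (rule arg_cong[of _ _ "fd h z"])
    using chr_mat_sym[OF S, of "snd z *v a" "snd z *v b"]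
    by (simp add: hor_field_def curv_mat_def matmul_simps matvec_simps matrix_vector_mul_assoc[symmetric] matrix_mul_assoc chr_mat_simps)
qed

text \<open>The vertical field replaces E by E M in both places where \<open>hor_field\<close> uses
  E. The outer replacement is cancelled by the derivative of \<open>ver_field\<close>; the inner one
  turns \<open>a\<close> into \<open>M *v a\<close>.\<close>

lemma bracket_ver_hor:
  fixes h :: "(real^'n) \<times> (real^'n^'n) \<Rightarrow> 'c::euclidean_space"
  assumes "open V" "V \<subseteq> W" "smooth_on V h" "z \<in> V"
  shows "fd (\<lambda>y. fd h y (hor_field G a y)) z (ver_field M z) - fd (\<lambda>y. fd h y (ver_field M y)) z (hor_field G a z)
    = fd h z (hor_field G (M *v a) z)"
proof -
  have S: "fst z \<in> S" using assms by auto
  show ?thesis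
    apply (subst fd_bracket[OF assms(1,3,4) has_derivative_ver_field has_derivative_hor_field[OF S]])
    apply (rule arg_cong[of _ _ "fd h z"])
    by (simp add: hor_field_def ver_field_def matmul_simps matvec_simps matrix_vector_mul_assoc[symmetric]
        matrix_mul_assoc linear_0[OF linear_dchr_left[OF S]])
qed

text \<open>Horizontal motion is parallel transport of the columns of E, which preserves their inner
  products. Hence the extended fields are tangent to the set of orthonormal frames.\<close>

lemma fd_gram_hor:
  assumes "z \<in> W"
  shows "fd (\<lambda>z. transpose (snd z) ** G (fst z) ** snd z) z (hor_field G a z) = 0"
proof -
  have S: "fst z \<in> S" using assms by auto
  have g: "((\<lambda>z. G (fst z)) has_derivative (\<lambda>w. fd G (fst z) (fst w))) (at z)"
    using diff_chain_at[OF has_derivative_fst[OF has_derivative_ident] has_derivative_G[OF S]]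
    by (simp add: o_def)
  have d: "((\<lambda>z. transpose (snd z) ** G (fst z) ** snd z) has_derivative
     (\<lambda>w. transpose (snd z) ** G (fst z) ** snd w
      + (transpose (snd z) ** fd G (fst z) (fst w) + transpose (snd w) ** G (fst z)) ** snd z)) (at z)"
    by (intro has_derivative_matmul has_derivative_transpose g has_derivative_snd has_derivative_ident)
  show ?thesis unfolding fd_eqI[OF d]
    by (simp add: hor_field_def matmul_simps transpose_simps metric_compatible[OF S] matrix_transpose_mul matrix_mul_assoc)
qed

lemma smooth_gram: "smooth_on W (\<lambda>z. transpose (snd z) ** G (fst z) ** snd z)"
  by (intro smooth_on_matmul smooth_on_transpose smooth_on_snd smooth_on_W_fst smooth_G open_W)

text \<open>The horizontal fields annihilate \<open>E\<^sup>T G(x) E\<close>, hence so do their brackets.\<close>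

lemma curv_skew:
  assumes "x \<in> S" shows "transpose (R x v w) ** G x = - (G x ** R x v w)"
proof -
  let ?g = "\<lambda>z::(real^'n) \<times> (real^'n^'n). transpose (snd z) ** G (fst z) ** snd z"
  \<comment> \<open>In general \<open>mat 1\<close> is not orthonormal for \<open>G x\<close>. The
    extended fields exist there all the same, and with E = 1 the vertical part of the bracket is the
    curvature matrix itself.\<close>
  let ?z = "(x, mat 1) :: (real^'n) \<times> (real^'n^'n)"
  have z: "?z \<in> W" using assms by auto
  have "fd (\<lambda>y. fd ?g y (hor_field G b y)) ?z c = 0" for b c
  proof -
    have "fd (\<lambda>y. fd ?g y (hor_field G b y)) ?z = fd (\<lambda>y. 0) ?z"
      by (rule fd_cong[OF open_W z]) (simp add: fd_gram_hor)
    then show ?thesis by simp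
  qed
  then have 0: "fd ?g ?z (0, - (R x v w)) = 0"
    using bracket_hor_hor[OF open_W order_refl smooth_gram z, of w v] by simp
  have g: "((\<lambda>z::(real^'n) \<times> (real^'n^'n). G (fst z)) has_derivative (\<lambda>w. fd G (fst ?z) (fst w))) (at ?z)"
    using diff_chain_at[OF has_derivative_fst[OF has_derivative_ident] has_derivative_G[of "fst ?z"]] assms
    by (simp add: o_def)
  have 1: "(?g has_derivative (\<lambda>w. transpose (snd ?z) ** G (fst ?z) ** snd w
      + (transpose (snd ?z) ** fd G (fst ?z) (fst w) + transpose (snd w) ** G (fst ?z)) ** snd ?z)) (at ?z)"
    by (intro has_derivative_matmul has_derivative_transpose g has_derivative_snd has_derivative_ident)
  show ?thesis using 0 unfolding fd_eqI[OF 1]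
    by (simp add: transpose_simps matmul_simps transpose_mat linear_0[OF has_derivative_linear[OF has_derivative_G[OF assms]]])
qed

lemma fd_curv:
  assumes "x \<in> S"
  shows "fd (\<lambda>y. R y v w) x u = fd (\<lambda>y. D y v w) x u - fd (\<lambda>y. D y w v) x u
    + (cm x v ** D x u w + D x u v ** cm x w) - (cm x w ** D x u v + D x u w ** cm x v)"
  unfolding curv_mat_def
  by (rule fd_eqI) (intro has_derivative_diff has_derivative_add has_derivative_matmul
      has_derivative_chr_mat[OF assms] smooth_on_has_derivative[OF smooth_dchr assms])

text \<open>The second derivatives of the Christoffel symbols cancel by \<open>c\<close>, the
  connection terms inside the arguments by \<open>t\<close>, and the products by expanding the
  commutators, the cubic ones as in the Jacobi identity.\<close>

lemma second_bianchi:
  assumes "x \<in> S"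
  shows "nabla_curv G x u v w + nabla_curv G x v w u + nabla_curv G x w u v = 0"
proof -
  have c: "fd (\<lambda>y. D y v w) x u = fd (\<lambda>y. D y u w) x v" for u v w
    unfolding dchr_def by (rule fd_fd_commute[OF open_S smooth_chr_mat assms])
  \<comment> \<open>The inserted vector \<open>cm x u *v v\<close> is symmetric in \<open>u\<close>
    and \<open>v\<close>, while \<open>R\<close> is antisymmetric, so the six terms cancel in
    pairs.\<close>
  have t: "R x (cm x u *v v) w + R x v (cm x u *v w) + (R x (cm x v *v w) u + R x w (cm x v *v u))
     + (R x (cm x w *v u) v + R x u (cm x w *v v)) = 0"
    using chr_mat_sym[OF assms, of u v] chr_mat_sym[OF assms, of u w] chr_mat_sym[OF assms, of v w]
      curv_antisym[of x "cm x u *v v" w] curv_antisym[of x v "cm x u *v w"] curv_antisym[of x u "cm x v *v w"]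
    by (simp add: algebra_simps)
  have e: "nabla_curv G x u v w + nabla_curv G x v w u + nabla_curv G x w u v =
     (fd (\<lambda>y. R y v w) x u + cm x u ** R x v w - R x v w ** cm x u)
     + (fd (\<lambda>y. R y w u) x v + cm x v ** R x w u - R x w u ** cm x v)
     + (fd (\<lambda>y. R y u v) x w + cm x w ** R x u v - R x u v ** cm x w)
     - (R x (cm x u *v v) w + R x v (cm x u *v w) + (R x (cm x v *v w) u + R x w (cm x v *v u))
     + (R x (cm x w *v u) v + R x u (cm x w *v v)))"
    by (simp add: nabla_curv_def algebra_simps)
  show ?thesis unfolding e t fd_curv[OF assms]
    using c[of u v w] c[of u w v]
    by (simp add: curv_mat_def matmul_simps matrix_mul_assoc) (rule c)
qed

lemma smooth_curv_frame: "smooth_on W (curv_frame G a b)"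
  unfolding curv_frame_def[abs_def]
  by (intro smooth_on_matmul smooth_on_transpose smooth_on_snd open_W smooth_on_W_fst smooth_G
      smooth_on_bilinear_arg[OF open_S linear_curv_right linear_curv_left smooth_curv open_W smooth_on_fst]
      smooth_frame) auto

text \<open>Along a horizontal field E changes by - \<open>cm\<close> E, and metric compatibility
  turns the derivative of E^T G into E^T G \<open>cm\<close>. These are exactly the connection terms
  that complete the derivative of \<open>R\<close> to the covariant one.\<close>

lemma fd_curv_frame_hor:
  assumes "z \<in> W"
  shows "fd (curv_frame G a b) z (hor_field G c z) =
    transpose (snd z) ** G (fst z) ** nabla_curv G (fst z) (snd z *v c) (snd z *v a) (snd z *v b) ** snd z"
proof -
  have S: "fst z \<in> S" using assms by auto
  have g: "((\<lambda>z. G (fst z)) has_derivative (\<lambda>w. fd G (fst z) (fst w))) (at z)"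
    using diff_chain_at[OF has_derivative_fst[OF has_derivative_ident] has_derivative_G[OF S]]
    by (simp add: o_def)
  have r: "((\<lambda>z. R (fst z) (snd z *v a) (snd z *v b)) has_derivative
      (\<lambda>t. fd (\<lambda>y. R y (snd z *v a) (snd z *v b)) (fst z) (fst t)
        + R (fst z) (snd t *v a) (snd z *v b) + R (fst z) (snd z *v a) (snd t *v b))) (at z)"
    by (intro has_derivative_bilinear_arg[OF open_S linear_curv_right linear_curv_left smooth_curv]
        has_derivative_fst has_derivative_frame S has_derivative_ident)
  have d: "(curv_frame G a b has_derivative (\<lambda>t.
      (transpose (snd z) ** G (fst z) ** R (fst z) (snd z *v a) (snd z *v b)) ** snd t
      + ((transpose (snd z) ** G (fst z)) ** (fd (\<lambda>y. R y (snd z *v a) (snd z *v b)) (fst z) (fst t)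
        + R (fst z) (snd t *v a) (snd z *v b) + R (fst z) (snd z *v a) (snd t *v b))
       + (transpose (snd z) ** fd G (fst z) (fst t) + transpose (snd t) ** G (fst z))
          ** R (fst z) (snd z *v a) (snd z *v b)) ** snd z)) (at z)"
    unfolding curv_frame_def[abs_def]
    by (intro has_derivative_matmul has_derivative_transpose g r has_derivative_snd has_derivative_ident)
  show ?thesis unfolding fd_eqI[OF d]
    by (simp add: hor_field_def nabla_curv_def matmul_simps transpose_simps metric_compatible[OF S]
        matrix_transpose_mul matrix_mul_assoc matvec_simps matrix_vector_mul_assoc
        linear_neg[OF linear_curv_left[OF S]] linear_neg[OF linear_curv_right[OF S]])
qed

end

section \<open>Change of coordinates\<close>

definition jac :: "(real^'n::finite \<Rightarrow> real^'n) \<Rightarrow> real^'n \<Rightarrow> real^'n^'n" where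
  "jac \<phi> x = matrix (fd \<phi> x)"

definition frame_map :: "(real^'n::finite \<Rightarrow> real^'n) \<Rightarrow> (real^'n) \<times> (real^'n^'n) \<Rightarrow> (real^'n) \<times> (real^'n^'n)" where
  "frame_map \<phi> z = (\<phi> (fst z), jac \<phi> (fst z) ** snd z)"

lemma jac_mult:
  assumes "smooth_on T \<phi>" "x \<in> T" shows "jac \<phi> x *v v = fd \<phi> x v"
  unfolding jac_def
  by (rule matrix_works) (use has_derivative_linear[OF smooth_on_has_derivative[OF assms]] in \<open>simp add: linear_matrix_vector_mul_eq\<close>)

lemma smooth_on_jac:
  assumes "open T" "smooth_on T \<phi>" shows "smooth_on T (jac \<phi>)"
  unfolding jac_def[abs_def] matrix_def
  by (intro smooth_on_vecI assms(1)) (simp, intro smooth_on_nth smooth_on_fd assms)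

lemma fd_jac_mult:
  assumes "open T" "smooth_on T \<phi>" "x \<in> T"
  shows "fd (jac \<phi>) x u *v w = fd (\<lambda>y. fd \<phi> y w) x u"
proof -
  have "((\<lambda>y. jac \<phi> y *v w) has_derivative (\<lambda>u. jac \<phi> x *v 0 + fd (jac \<phi>) x u *v w)) (at x)"
    by (intro has_derivative_matvec smooth_on_has_derivative[OF smooth_on_jac[OF assms(1,2)] assms(3)] has_derivative_const)
  then have "((\<lambda>y. fd \<phi> y w) has_derivative (\<lambda>u. jac \<phi> x *v 0 + fd (jac \<phi>) x u *v w)) (at x)"
    by (rule has_derivative_transform_within_open[OF _ assms(1,3)]) (simp add: jac_mult[OF assms(2)])
  from fd_eqI[OF this] show ?thesis by (simp add: matvec_simps)
qed

lemma fd_jac_sym: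
  assumes "open T" "smooth_on T \<phi>" "x \<in> T"
  shows "fd (jac \<phi>) x u *v w = fd (jac \<phi>) x w *v u"
  unfolding fd_jac_mult[OF assms] by (rule fd_fd_commute[OF assms])

locale chart_change = A: local_metric S1 G1 + B: local_metric S2 G2
  for S1 :: "(real^'n::finite) set" and G1 and S2 :: "(real^'n) set" and G2 +
  fixes T :: "(real^'n) set" and \<phi> :: "real^'n \<Rightarrow> real^'n"
  assumes open_T: "open T" and T_sub: "T \<subseteq> S1" and \<phi>_in: "\<phi> ` T \<subseteq> S2"
    and smooth_\<phi>: "smooth_on T \<phi>"
    and G_change: "x \<in> T \<Longrightarrow> G1 x = transpose (jac \<phi> x) ** G2 (\<phi> x) ** jac \<phi> x"
begin

lemma has_derivative_\<phi>: "x \<in> T \<Longrightarrow> (\<phi> has_derivative (\<lambda>v. jac \<phi> x *v v)) (at x)"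
  using smooth_on_has_derivative[OF smooth_\<phi>] jac_mult[OF smooth_\<phi>] by (simp add: eta_contract_eq)

lemma has_derivative_jac: "x \<in> T \<Longrightarrow> (jac \<phi> has_derivative fd (jac \<phi>) x) (at x)"
  by (rule smooth_on_has_derivative[OF smooth_on_jac[OF open_T smooth_\<phi>]])

lemma invertible_jac: assumes "x \<in> T" shows "invertible (jac \<phi> x)"
proof -
  have "det (G1 x) \<noteq> 0" using A.inv_G[of x] T_sub assms invertible_det_nz by blast
  then show ?thesis unfolding G_change[OF assms] by (auto simp: det_mul invertible_det_nz)
qed

text \<open>The transformation law of the Christoffel symbols, obtained without differentiating
  their formula: the connection \<open>L\<close> pulled back from \<open>G2\<close> is symmetric and
  compatible with \<open>G1\<close>, so \<open>levi_civita_unique\<close> identifies it.\<close>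

lemma chr_mat_change:
  assumes "x \<in> T"
  shows "B.cm (\<phi> x) (jac \<phi> x *v v) ** jac \<phi> x = jac \<phi> x ** A.cm x v - fd (jac \<phi>) x v"
proof -
  let ?J = "jac \<phi> x" and ?I = "matrix_inv (jac \<phi> x)"
  have S: "x \<in> S1" "\<phi> x \<in> S2" using assms T_sub \<phi>_in by auto
  define L where "L v = ?I ** (B.cm (\<phi> x) (?J *v v) ** ?J + fd (jac \<phi>) x v)" for v
  have JL: "?J ** L v = B.cm (\<phi> x) (?J *v v) ** ?J + fd (jac \<phi>) x v" for v
    by (simp add: L_def matrix_mul_assoc matrix_inv_right invertible_jac[OF assms])
  have "L v = A.cm x v" for v
  proof (rule A.levi_civita_unique[OF S(1)])
    show "L v *v w = L w *v v" for v w
    proof -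
      have "(B.cm (\<phi> x) (?J *v v) ** ?J + fd (jac \<phi>) x v) *v w = (B.cm (\<phi> x) (?J *v w) ** ?J + fd (jac \<phi>) x w) *v v"
        using B.chr_mat_sym[OF S(2), of "?J *v v" "?J *v w"] fd_jac_sym[OF open_T smooth_\<phi> assms, of v w]
        by (simp add: matvec_simps matrix_vector_mul_assoc[symmetric])
      then show ?thesis by (simp add: L_def matrix_vector_mul_assoc[symmetric])
    qed
    have g: "((\<lambda>y. G2 (\<phi> y)) has_derivative (\<lambda>v. fd G2 (\<phi> x) (?J *v v))) (at x)"
      using diff_chain_at[OF has_derivative_\<phi>[OF assms] B.has_derivative_G[OF S(2)]] by (simp add: o_def)
    have "((\<lambda>y. transpose (jac \<phi> y) ** G2 (\<phi> y) ** jac \<phi> y) has_derivative (\<lambda>v.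
       (transpose ?J ** G2 (\<phi> x)) ** fd (jac \<phi>) x v + (transpose ?J ** fd G2 (\<phi> x) (?J *v v)
         + transpose (fd (jac \<phi>) x v) ** G2 (\<phi> x)) ** ?J)) (at x)"
      by (intro has_derivative_matmul has_derivative_transpose g has_derivative_jac assms)
    then have d: "(G1 has_derivative (\<lambda>v.
       (transpose ?J ** G2 (\<phi> x)) ** fd (jac \<phi>) x v + (transpose ?J ** fd G2 (\<phi> x) (?J *v v)
         + transpose (fd (jac \<phi>) x v) ** G2 (\<phi> x)) ** ?J)) (at x)"
      by (rule has_derivative_transform_within_open[OF _ open_T assms]) (simp add: G_change)
    fix v
    have "transpose (L v) ** G1 x + G1 x ** L v =
       transpose (?J ** L v) ** G2 (\<phi> x) ** ?J + transpose ?J ** G2 (\<phi> x) ** (?J ** L v)"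
      by (simp add: G_change[OF assms] matrix_transpose_mul matrix_mul_assoc)
    then show "fd G1 x v = transpose (L v) ** G1 x + G1 x ** L v"
      unfolding JL fd_eqI[OF d] B.metric_compatible[OF S(2)]
      by (simp add: matmul_simps transpose_simps matrix_transpose_mul matrix_mul_assoc)
  qed
  with JL[of v] show ?thesis by simp
qed

lemma smooth_frame_map: "smooth_on (T \<times> UNIV) (frame_map \<phi>)"
proof -
  have o: "open (T \<times> (UNIV::(real^'n^'n) set))" by (intro open_Times open_T open_UNIV)
  show ?thesis unfolding frame_map_def[abs_def]
    by (intro smooth_on_Pair o smooth_on_matmul smooth_on_snd
      smooth_on_compose[OF o open_T _ smooth_on_fst[OF o] smooth_\<phi>]
      smooth_on_compose[OF o open_T _ smooth_on_fst[OF o] smooth_on_jac[OF open_T smooth_\<phi>]]) auto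
qed

lemma has_derivative_frame_map:
  assumes "fst z \<in> T"
  shows "(frame_map \<phi> has_derivative
    (\<lambda>w. (jac \<phi> (fst z) *v fst w, jac \<phi> (fst z) ** snd w + fd (jac \<phi>) (fst z) (fst w) ** snd z))) (at z)"
proof -
  have 1: "((\<lambda>z. \<phi> (fst z)) has_derivative (\<lambda>w. jac \<phi> (fst z) *v fst w)) (at z)"
    using diff_chain_at[OF has_derivative_fst[OF has_derivative_ident] has_derivative_\<phi>[OF assms]] by (simp add: o_def)
  have 2: "((\<lambda>z. jac \<phi> (fst z)) has_derivative (\<lambda>w. fd (jac \<phi>) (fst z) (fst w))) (at z)"
    using diff_chain_at[OF has_derivative_fst[OF has_derivative_ident] has_derivative_jac[OF assms]] by (simp add: o_def)
  show ?thesis unfolding frame_map_def[abs_def]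
    by (intro has_derivative_Pair 1 has_derivative_matmul 2 has_derivative_snd has_derivative_ident)
qed

text \<open>The inhomogeneous term of \<open>chr_mat_change\<close> cancels the derivative of the
  Jacobian in the differential of \<open>frame_map\<close>. The extended horizontal fields therefore
  do not depend on the chart.\<close>

lemma frame_map_hor_field:
  assumes "fst z \<in> T"
  shows "fd (frame_map \<phi>) z (hor_field G1 a z) = hor_field G2 a (frame_map \<phi> z)"
proof -
  have "B.cm (\<phi> (fst z)) (jac \<phi> (fst z) *v (snd z *v a)) ** jac \<phi> (fst z) ** snd z =
     jac \<phi> (fst z) ** A.cm (fst z) (snd z *v a) ** snd z - fd (jac \<phi>) (fst z) (snd z *v a) ** snd z"
    by (simp add: chr_mat_change[OF assms] matmul_simps)
  then show ?thesis
    by (simp add: fd_eqI[OF has_derivative_frame_map[OF assms]] hor_field_def frame_map_def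
        matmul_simps matrix_mul_assoc matrix_vector_mul_assoc)
qed

text \<open>The brackets of the horizontal fields are related by \<open>frame_map\<close>, and they are given by the curvature.\<close>

lemma curv_mat_change:
  assumes "x \<in> T"
  shows "B.R (\<phi> x) (jac \<phi> x *v v) (jac \<phi> x *v w) ** jac \<phi> x = jac \<phi> x ** A.R x v w"
proof -
  let ?z = "(x, mat 1) :: (real^'n) \<times> (real^'n^'n)" and ?F = "frame_map \<phi>"
  let ?T = "T \<times> (UNIV :: (real^'n^'n) set)"
  have o: "open ?T" by (intro open_Times open_T open_UNIV)
  have z: "?z \<in> ?T" using assms by auto
  have Fz: "?F ?z \<in> B.W" using assms \<phi>_in by (auto simp: frame_map_def)
  have *: "fd (\<lambda>y. fd ?F y (hor_field G1 b y)) ?z (hor_field G1 a ?z)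
     = fd (hor_field G2 b) (?F ?z) (hor_field G2 a (?F ?z))" for a b
  proof -
    have "fd (\<lambda>y. fd ?F y (hor_field G1 b y)) ?z = fd (\<lambda>y. hor_field G2 b (?F y)) ?z"
      by (rule fd_cong[OF o z]) (auto simp: frame_map_hor_field)
    moreover have "((\<lambda>y. hor_field G2 b (?F y)) has_derivative
       (\<lambda>t. fd (hor_field G2 b) (?F ?z) (fd ?F ?z t))) (at ?z)"
      using diff_chain_at[OF smooth_on_has_derivative[OF smooth_frame_map z] smooth_on_has_derivative[OF B.smooth_hor_field Fz]]
      by (simp add: o_def)
    ultimately show ?thesis using z by (simp add: fd_eqI frame_map_hor_field)
  qed
  \<comment> \<open>On the target side the bracket formula is applied to the identity map, which
    returns the bracket as a vector.\<close>
  have i: "fd (\<lambda>z. z) y = (\<lambda>v. v)" for y :: "(real^'n) \<times> (real^'n^'n)"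
    by (rule fd_eq) (rule has_derivative_ident)
  have "fd ?F ?z (0, - (A.R x v w)) = (0, - (B.R (\<phi> x) (jac \<phi> x *v v) (jac \<phi> x *v w) ** jac \<phi> x))"
    using A.bracket_hor_hor[OF o _ smooth_frame_map z, of w v]
      B.bracket_hor_hor[OF B.open_W order_refl smooth_on_linear[OF bounded_linear_ident B.open_W] Fz, of w v]
    using T_sub by (simp add: * i Sigma_mono) (simp add: frame_map_def)
  moreover have "linear (fd (jac \<phi>) x)" using has_derivative_linear[OF has_derivative_jac[OF assms]] .
  ultimately show ?thesis
    using assms by (simp add: fd_eqI[OF has_derivative_frame_map] matmul_simps linear_0)
qed

end

section \<open>Tangent vectors and frames in charts\<close>

lemma has_vector_derivative_eventually:
  assumes "(f has_vector_derivative v) (at x)" "\<forall>\<^sub>F t in nhds x. f t = h t"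
  shows "(h has_vector_derivative v) (at x)"
proof -
  have "\<forall>\<^sub>F t in at x. f t = h t"
    unfolding eventually_at_filter using assms(2) by (rule eventually_mono) simp
  moreover have "f x = h x" by (rule eventually_nhds_x_imp_x[OF assms(2)])
  ultimately show ?thesis
    using assms(1) has_derivative_transform_eventually[of f _ x UNIV h]
    unfolding has_vector_derivative_def by blast
qed

lemma has_vector_derivative_chain:
  assumes "(\<gamma> has_vector_derivative v) (at t)" "(f has_derivative f') (at (\<gamma> t))"
  shows "((\<lambda>t. f (\<gamma> t)) has_vector_derivative f' v) (at t)"
proof -
  have "((\<lambda>t. f (\<gamma> t)) has_derivative (\<lambda>s. f' (s *\<^sub>R v))) (at t)"
    using diff_chain_at[OF assms(1)[unfolded has_vector_derivative_def] assms(2)] by (simp add: o_def)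
  then show ?thesis
    using linear_scale[OF has_derivative_linear[OF assms(2)]] by (simp add: has_vector_derivative_def)
qed

lemma has_vector_derivative_eventually_in:
  assumes "(\<gamma> has_vector_derivative v) (at t)" "open S" "\<gamma> t \<in> S"
  shows "\<forall>\<^sub>F s in nhds t. \<gamma> s \<in> S"
proof -
  have "isCont \<gamma> t" using assms(1) has_vector_derivative_continuous by blast
  then have "(\<gamma> \<longlongrightarrow> \<gamma> t) (nhds t)" by (simp add: continuous_at tendsto_at_iff_tendsto_nhds)
  then show ?thesis using topological_tendstoD assms(2,3) by blast
qed

lemmas inner_vecmat = inner_transpose[unfolded transpose_matrix_vector]

lemma vec_eqI_inner: "(\<And>v. v \<bullet> a = v \<bullet> b) \<Longrightarrow> a = (b :: real^'n::finite)"
  using vector_eq_ldot[of a b] by blast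

lemma inner_product_onD:
  assumes "inner_product_on S ip"
  shows "x \<in> S \<Longrightarrow> y \<in> S \<Longrightarrow> ip x y = ip y x"
    and "x \<in> S \<Longrightarrow> y \<in> S \<Longrightarrow> z \<in> S \<Longrightarrow> ip (x + y) z = ip x z + ip y z"
    and "x \<in> S \<Longrightarrow> y \<in> S \<Longrightarrow> ip (r *\<^sub>R x) y = r * ip x y"
    and "x \<in> S \<Longrightarrow> x \<noteq> 0 \<Longrightarrow> ip x x > 0"
  using assms by (simp_all add: inner_product_on_def)

definition loc_ric :: "(real^'n::finite \<Rightarrow> real^'n^'n) \<Rightarrow> real^'n \<Rightarrow> real^'n \<Rightarrow> real^'n \<Rightarrow> real" where
  "loc_ric G x v w = (\<Sum>i\<in>UNIV. (curv_mat G x (axis i 1) v *v w) $ i)"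

text \<open>With the Ricci tensor written as the trace of a matrix, its independence of the chart
  and its expression in an orthonormal frame both become invariance of the trace under
  conjugation.\<close>

lemma (in local_metric) loc_ric_trace:
  assumes "x \<in> S"
  shows "\<exists>M. (\<forall>u. M *v u = R x u v *v w) \<and> loc_ric G x v w = trace M"
proof -
  have l: "linear (\<lambda>u. R x u v *v w)"
    by (rule linearI) (simp_all add: linear_add[OF linear_curv_left[OF assms]]
        linear_scale[OF linear_curv_left[OF assms]] matvec_simps)
  show ?thesis
    by (rule exI[of _ "matrix (\<lambda>u. R x u v *v w)"])
      (simp add: matrix_works linear_matrix_vector_mul_eq l loc_ric_def trace_def, simp add: matrix_def)
qed

lemma (in chart_change) loc_ric_change:
  assumes "x \<in> T"
  shows "loc_ric G2 (\<phi> x) (jac \<phi> x *v v) (jac \<phi> x *v w) = loc_ric G1 x v w"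
proof -
  have S: "x \<in> S1" "\<phi> x \<in> S2" using assms T_sub \<phi>_in by auto
  obtain M where M: "\<And>u. M *v u = A.R x u v *v w" "loc_ric G1 x v w = trace M"
    using A.loc_ric_trace[OF S(1)] by metis
  obtain N where N: "\<And>u. N *v u = B.R (\<phi> x) u (jac \<phi> x *v v) *v (jac \<phi> x *v w)"
    "loc_ric G2 (\<phi> x) (jac \<phi> x *v v) (jac \<phi> x *v w) = trace N"
    using B.loc_ric_trace[OF S(2)] by metis
  have "(N ** jac \<phi> x) *v u = (jac \<phi> x ** M) *v u" for u
    using curv_mat_change[OF assms, of u v]
    by (simp add: N(1) M(1) matrix_vector_mul_assoc[symmetric]) (simp add: matrix_vector_mul_assoc)
  then have NM: "N ** jac \<phi> x = jac \<phi> x ** M" by (simp add: matrix_eq)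
  have "trace N = trace (N ** jac \<phi> x ** matrix_inv (jac \<phi> x))"
    by (simp add: matrix_mul_assoc[symmetric] matrix_inv_right invertible_jac[OF assms])
  also have "\<dots> = trace (matrix_inv (jac \<phi> x) ** (jac \<phi> x ** M))"
    unfolding NM by (rule trace_mul_sym)
  also have "\<dots> = trace M" by (simp add: matrix_mul_assoc matrix_inv_left invertible_jac[OF assms])
  finally show ?thesis using N(2) M(2) by simp
qed

lemma (in local_metric) loc_ric_frame:
  assumes "fst z \<in> S" "transpose (snd z) ** G (fst z) ** snd z = mat 1"
  shows "(\<Sum>i\<in>UNIV. (curv_frame G (axis i 1) a z *v b) $ i) = loc_ric G (fst z) (snd z *v a) (snd z *v b)"
proof -
  obtain M where M: "\<And>u. M *v u = R (fst z) u (snd z *v a) *v (snd z *v b)"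
    "loc_ric G (fst z) (snd z *v a) (snd z *v b) = trace M"
    using loc_ric_trace[OF assms(1)] by metis
  have "curv_frame G u a z *v b = (transpose (snd z) ** G (fst z) ** M ** snd z) *v u" for u
    by (simp add: curv_frame_def matrix_vector_mul_assoc[symmetric] M(1))
  then have "(\<Sum>i\<in>UNIV. (curv_frame G (axis i 1) a z *v b) $ i) = trace (transpose (snd z) ** G (fst z) ** M ** snd z)"
    by (simp add: trace_def matrix_vector_mult_basis column_def)
  also have "\<dots> = trace (snd z ** (transpose (snd z) ** G (fst z)) ** M)"
    using trace_mul_sym[of "transpose (snd z) ** G (fst z) ** M" "snd z"] by (simp add: matrix_mul_assoc)
  also have "snd z ** (transpose (snd z) ** G (fst z)) = mat 1"
    using assms(2) matrix_left_right_inverse by blast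
  finally show ?thesis using M(2) by simp
qed

section \<open>Charts, tangent vectors and the metric in coordinates\<close>

locale riem =
  fixes X :: "'a topology" and A :: "('a, 'n::finite) mchart set" and g :: "('a, 'n) metric"
  assumes riem: "riemannian_manifold X A g"
begin

abbreviation "img c \<equiv> snd c ` fst c"
abbreviation "G \<equiv> metric_matrix A g"
abbreviation "dom2 c c' \<equiv> snd c ` (fst c \<inter> fst c')"
abbreviation tr :: "('a, 'n) mchart \<Rightarrow> ('a, 'n) mchart \<Rightarrow> real^'n \<Rightarrow> real^'n" where
  "tr c c' \<equiv> (\<lambda>x. snd c' (chart_inv c x))"

lemma chart_facts:
  assumes "c \<in> A"
  shows "openin X (fst c)" "open (img c)"
    "homeomorphic_map (subtopology X (fst c)) (top_of_set (img c)) (snd c)" "fst c \<subseteq> topspace X"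
proof -
  show 1: "openin X (fst c)" and "open (img c)"
    and "homeomorphic_map (subtopology X (fst c)) (top_of_set (img c)) (snd c)"
    using riem assms by (simp_all add: riemannian_manifold_def smooth_manifold_def)
  show "fst c \<subseteq> topspace X" by (rule openin_subset[OF 1])
qed

lemma Union_charts: "(\<Union>c\<in>A. fst c) = topspace X"
  using riem by (simp add: riemannian_manifold_def smooth_manifold_def)

lemma chart_inj: assumes "c \<in> A" shows "inj_on (snd c) (fst c)"
  using homeomorphic_imp_injective_map[OF chart_facts(3)[OF assms]] chart_facts(4)[OF assms]
  by (simp add: Int_absorb1)

lemma chart_inv_left [simp]: "c \<in> A \<Longrightarrow> p \<in> fst c \<Longrightarrow> chart_inv c (snd c p) = p"
  unfolding chart_inv_def by (rule inv_into_f_f[OF chart_inj])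

lemma open_chart_image:
  assumes "c \<in> A" "openin X U" shows "open (snd c ` (fst c \<inter> U))"
proof -
  have "openin (subtopology X (fst c)) (fst c \<inter> U)"
    using assms(2) by (simp add: openin_subtopology_Int2)
  then have "openin (top_of_set (img c)) (snd c ` (fst c \<inter> U))"
    using homeomorphic_imp_open_map[OF chart_facts(3)[OF assms(1)]] by (simp add: open_map_def)
  then show ?thesis using chart_facts(2)[OF assms(1)] openin_open_trans by blast
qed

lemma open_dom2: "c \<in> A \<Longrightarrow> c' \<in> A \<Longrightarrow> open (dom2 c c')"
  by (simp add: open_chart_image chart_facts(1))

lemma smooth_tr: "c \<in> A \<Longrightarrow> c' \<in> A \<Longrightarrow> smooth_on (dom2 c c') (tr c c')"
  using riem by (simp add: riemannian_manifold_def smooth_manifold_def)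

lemma tr_in: "c \<in> A \<Longrightarrow> c' \<in> A \<Longrightarrow> tr c c' ` dom2 c c' \<subseteq> dom2 c' c"
  by auto

lemma has_derivative_tr:
  "c \<in> A \<Longrightarrow> c' \<in> A \<Longrightarrow> p \<in> fst c \<Longrightarrow> p \<in> fst c' \<Longrightarrow> (tr c c' has_derivative fd (tr c c') (snd c p)) (at (snd c p))"
  using smooth_on_has_derivative[OF smooth_tr] by auto

lemma fd_tr_id: assumes "c \<in> A" "p \<in> fst c" shows "fd (tr c c) (snd c p) v = v"
proof -
  have "fd (tr c c) (snd c p) = fd (\<lambda>x. x) (snd c p)"
    by (rule fd_cong[OF chart_facts(2)[OF assms(1)]]) (use assms in auto)
  then show ?thesis by (simp add: fd_eqI[OF has_derivative_ident])
qed

text \<open>The tangent vector with coordinates \<open>v\<close> in the chart \<open>c\<close>.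
  Since a tangent vector records its coordinates in all charts, the others come from the transition
  maps, with the default 0 prescribed by \<open>has_velocity\<close>.\<close>

definition push :: "('a, 'n) mchart \<Rightarrow> 'a \<Rightarrow> real^'n \<Rightarrow> ('a, 'n) tvec" where
  "push c p v = (\<lambda>c'. if c' \<in> A \<and> p \<in> fst c' then fd (tr c c') (snd c p) v else 0)"

lemma push_self [simp]: "c \<in> A \<Longrightarrow> p \<in> fst c \<Longrightarrow> push c p v c = v"
  by (simp add: push_def fd_tr_id)

lemma push_at: "c \<in> A \<Longrightarrow> c' \<in> A \<Longrightarrow> p \<in> fst c \<Longrightarrow> p \<in> fst c' \<Longrightarrow> push c p v c' = jac (tr c c') (snd c p) *v v"
  using jac_mult[OF smooth_tr] by (auto simp: push_def)

lemma linear_push: assumes "c \<in> A" "p \<in> fst c" shows "linear (push c p)"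
proof -
  have "linear (fd (tr c c') (snd c p))" if "c' \<in> A" "p \<in> fst c'" for c'
    using has_derivative_linear[OF has_derivative_tr[OF assms(1) that(1) assms(2) that(2)]] .
  then show ?thesis
    by (intro linearI) (auto simp: push_def fun_eq_iff scaleR_fun_def linear_add linear_scale)
qed

lemma velocity_change:
  assumes "has_velocity A (\<lambda>c. c) \<gamma> p v" "c \<in> A" "c' \<in> A" "p \<in> fst c" "p \<in> fst c'"
  shows "v c' = fd (tr c c') (snd c p) (v c)"
proof -
  have \<gamma>: "\<gamma> 0 = p" "\<forall>\<^sub>F t in nhds 0. \<gamma> t \<in> fst c" "((\<lambda>t. snd c (\<gamma> t)) has_vector_derivative v c) (at 0)"
    "((\<lambda>t. snd c' (\<gamma> t)) has_vector_derivative v c') (at 0)"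
    using assms unfolding has_velocity_def by metis+
  have "((\<lambda>t. tr c c' (snd c (\<gamma> t))) has_vector_derivative fd (tr c c') (snd c p) (v c)) (at 0)"
    by (rule has_vector_derivative_chain[OF \<gamma>(3)]) (use has_derivative_tr[OF assms(2-5)] \<gamma>(1) in simp)
  then have "((\<lambda>t. snd c' (\<gamma> t)) has_vector_derivative fd (tr c c') (snd c p) (v c)) (at 0)"
    by (rule has_vector_derivative_eventually) (use \<gamma>(2) assms(2) in \<open>auto elim: eventually_mono\<close>)
  then show ?thesis using \<gamma>(4) vector_derivative_unique_at by blast
qed

lemma push_velocity:
  assumes "c \<in> A" "p \<in> fst c"
  shows "has_velocity A (\<lambda>c. c) (\<lambda>t. chart_inv c (snd c p + t *\<^sub>R v)) p (push c p v)"
  unfolding has_velocity_def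
proof (intro conjI allI)
  show "chart_inv c (snd c p + 0 *\<^sub>R v) = p" using assms by simp
  fix c'
  have line: "((\<lambda>t. snd c p + t *\<^sub>R v) has_vector_derivative v) (at 0)"
    by (auto intro!: derivative_eq_intros)
  show "if c' \<in> A \<and> p \<in> fst c' then (\<forall>\<^sub>F t in nhds 0. chart_inv c (snd c p + t *\<^sub>R v) \<in> fst c') \<and>
          ((\<lambda>t. snd c' (chart_inv c (snd c p + t *\<^sub>R v))) has_vector_derivative push c p v c') (at 0)
        else push c p v c' = 0"
  proof (cases "c' \<in> A \<and> p \<in> fst c'")
    case True
    have "\<forall>\<^sub>F t in nhds 0. snd c p + t *\<^sub>R v \<in> dom2 c c'"
      by (rule has_vector_derivative_eventually_in[OF line]) (use assms True open_dom2 in auto)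
    then have "\<forall>\<^sub>F t in nhds 0. chart_inv c (snd c p + t *\<^sub>R v) \<in> fst c'"
      by (rule eventually_mono) (use assms in auto)
    moreover have "((\<lambda>t. tr c c' (snd c p + t *\<^sub>R v)) has_vector_derivative fd (tr c c') (snd c p) v) (at 0)"
      by (rule has_vector_derivative_chain[OF line]) (use has_derivative_tr assms True in simp)
    ultimately show ?thesis using True by (simp add: push_def)
  qed (auto simp: push_def)
qed

text \<open>By the chain rule, the coordinates in one chart force those in all others. So the range
  of \<open>push c p\<close> is the whole tangent space, and the \<open>THE\<close> in
  \<open>coord_tvec\<close> is determined.\<close>

lemma TM_push: assumes "c \<in> A" "p \<in> fst c" "w \<in> TM A p" shows "w = push c p (w c)"
proof -
  obtain \<gamma> where \<gamma>: "has_velocity A (\<lambda>c. c) \<gamma> p w" using assms(3) unfolding tangent_space_def by auto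
  have "w c' = push c p (w c) c'" for c'
  proof (cases "c' \<in> A \<and> p \<in> fst c'")
    case True
    then show ?thesis using velocity_change[OF \<gamma> assms(1) _ assms(2), of c'] by (simp add: push_def)
  next
    case False
    then have "w c' = 0" using \<gamma> unfolding has_velocity_def by metis
    then show ?thesis using False by (auto simp: push_def)
  qed
  then show ?thesis by (rule ext)
qed

lemma push_in_TM: "c \<in> A \<Longrightarrow> p \<in> fst c \<Longrightarrow> push c p v \<in> TM A p"
  using push_velocity unfolding tangent_space_def by blast

lemma coord_tvec_eq: assumes "c \<in> A" "p \<in> fst c" shows "coord_tvec A c p a = push c p a"
  unfolding coord_tvec_def
proof (rule the_equality)
  show "push c p a \<in> TM A p \<and> push c p a c = a" using push_in_TM assms by simp
  show "v = push c p a" if "v \<in> TM A p \<and> v c = a" for v using TM_push[OF assms, of v] that by metis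
qed

lemma push_push:
  assumes "c \<in> A" "c' \<in> A" "p \<in> fst c" "p \<in> fst c'"
  shows "push c' p (jac (tr c c') (snd c p) *v v) = push c p v"
  using TM_push[OF assms(2,4) push_in_TM[OF assms(1,3), of v]] unfolding push_at[OF assms] ..

lemma metric_inner: "c \<in> A \<Longrightarrow> p \<in> fst c \<Longrightarrow> inner_product_on (TM A p) (g p)"
  using riem chart_facts(4)[of c] by (auto simp: riemannian_manifold_def)

lemma metric_push:
  assumes "c \<in> A" "p \<in> fst c"
  shows "g p (push c p v) (push c p w) = v \<bullet> (G c (snd c p) *v w)"
proof -
  define b where "b v w = g p (push c p v) (push c p w)" for v w
  have ip: "inner_product_on (TM A p) (g p)" using metric_inner assms by blast
  have sym: "b v w = b w v" for v w
    unfolding b_def by (intro inner_product_onD(1)[OF ip] push_in_TM assms)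
  have lin: "linear (\<lambda>v. b v w)" for w
    unfolding b_def
    by (intro linearI) (simp_all add: linear_add[OF linear_push[OF assms]] linear_scale[OF linear_push[OF assms]]
        inner_product_onD(2,3)[OF ip] push_in_TM assms)
  have "b v w = (\<Sum>i\<in>UNIV. v $ i *\<^sub>R b (axis i 1) w)" by (rule linear_axis_sum[OF lin])
  moreover have "b (axis i 1) w = (\<Sum>j\<in>UNIV. w $ j *\<^sub>R b (axis i 1) (axis j 1))" for i
    using linear_axis_sum[OF lin, of w "axis i 1"] unfolding sym[of _ "axis i 1"] .
  ultimately show ?thesis
    using assms by (simp add: b_def inner_vec_def matrix_vector_mult_def metric_matrix_def coord_tvec_eq mult_ac)
qed

lemma local_metric_chart: assumes c: "c \<in> A" shows "local_metric (img c) (G c)"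
proof
  show "open (img c)" using chart_facts(2) c .
  show "smooth_on (img c) (G c)" using riem c by (simp add: riemannian_manifold_def)
  fix x assume "x \<in> img c"
  then obtain p where p: "p \<in> fst c" "x = snd c p" by auto
  have ip: "inner_product_on (TM A p) (g p)" using metric_inner c p by blast
  show "transpose (G c x) = G c x"
    unfolding p(2) using c p(1) by (simp add: vec_eq_iff transpose_def metric_matrix_def coord_tvec_eq
        inner_product_onD(1)[OF ip push_in_TM[OF c p(1)] push_in_TM[OF c p(1)], symmetric])
  have "v = 0" if "G c x *v v = 0" for v
  proof (rule ccontr)
    assume "v \<noteq> 0"
    then have "push c p v \<noteq> 0" using push_self[OF c p(1), of v] by auto
    then have "g p (push c p v) (push c p v) > 0"
      by (intro inner_product_onD(4)[OF ip] push_in_TM c p)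
    then show False using that p c by (simp add: metric_push)
  qed
  then have "\<exists>B. B ** G c x = mat 1" using matrix_left_invertible_ker by blast
  then show "invertible (G c x)" by (metis invertible_def matrix_left_right_inverse)
qed

lemma chart_change_charts:
  assumes "c \<in> A" "c' \<in> A"
  shows "chart_change (img c) (G c) (img c') (G c') (dom2 c c') (tr c c')"
proof -
  interpret A: local_metric "img c" "G c" by (rule local_metric_chart[OF assms(1)])
  interpret B: local_metric "img c'" "G c'" by (rule local_metric_chart[OF assms(2)])
  show ?thesis
  proof
    show "open (dom2 c c')" "smooth_on (dom2 c c') (tr c c')" using open_dom2 smooth_tr assms by auto
    show "dom2 c c' \<subseteq> img c" "tr c c' ` dom2 c c' \<subseteq> img c'" using assms by auto
    fix x assume "x \<in> dom2 c c'"
    then obtain p where p: "p \<in> fst c" "p \<in> fst c'" "x = snd c p" by auto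
    let ?J = "jac (tr c c') (snd c p)"
    have "v \<bullet> (G c x *v w) = v \<bullet> ((transpose ?J ** G c' (snd c' p) ** ?J) *v w)" for v w
      using metric_push[OF assms(1) p(1), of v w] metric_push[OF assms(2) p(2), of "?J *v v" "?J *v w"]
      by (simp add: push_push assms p matrix_vector_mul_assoc[symmetric] inner_vecmat)
    then have "G c x *v w = (transpose ?J ** G c' (snd c' p) ** ?J) *v w" for w
      by (intro vec_eqI_inner)
    then show "G c x = transpose (jac (tr c c') x) ** G c' (tr c c' x) ** jac (tr c c') x"
      using p assms by (simp add: matrix_eq)
  qed
qed

section \<open>Orthonormal frames in coordinates\<close>

abbreviation "FB \<equiv> frame_bundle A g"

definition fcoord :: "('a, 'n) mchart \<Rightarrow> ('a, 'n) frame \<Rightarrow> (real^'n) \<times> (real^'n^'n)" where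
  "fcoord c U = snd (frame_chart A g c) U"

lemma fst_fcoord [simp]: "fst (fcoord c U) = snd c (fst U)"
  by (simp add: fcoord_def frame_chart_def)

lemma snd_fcoord: "snd (fcoord c U) = matrix (\<lambda>x. snd U x c)"
  by (simp add: fcoord_def frame_chart_def)

lemma frame_facts:
  assumes "U \<in> FB"
  shows "fst U \<in> topspace X" "linear (snd U)" "snd U x \<in> TM A (fst U)" "g (fst U) (snd U x) (snd U y) = x \<bullet> y"
  using assms Union_charts unfolding frame_bundle_def by auto

lemma frame_vec:
  assumes "c \<in> A" "U \<in> FB" "fst U \<in> fst c"
  shows "snd U y c = snd (fcoord c U) *v y" "snd U y = push c (fst U) (snd (fcoord c U) *v y)"
proof -
  have "linear (\<lambda>x. snd U x c)"
    using frame_facts(2)[OF assms(2)]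
    by (intro linearI) (simp_all add: linear_add linear_scale scaleR_fun_def)
  then show 1: "snd U y c = snd (fcoord c U) *v y"
    by (simp add: matrix_works linear_matrix_vector_mul_eq snd_fcoord)
  show "snd U y = push c (fst U) (snd (fcoord c U) *v y)"
    using TM_push[OF assms(1,3) frame_facts(3)[OF assms(2)], of y] unfolding 1 .
qed

lemma frame_gram:
  assumes "c \<in> A" "U \<in> FB" "fst U \<in> fst c"
  shows "transpose (snd (fcoord c U)) ** G c (fst (fcoord c U)) ** snd (fcoord c U) = mat 1"
proof -
  let ?E = "snd (fcoord c U)"
  have "v \<bullet> ((transpose ?E ** G c (snd c (fst U)) ** ?E) *v w) = v \<bullet> w" for v w
    using frame_facts(4)[OF assms(2), of v w]
    unfolding frame_vec(2)[OF assms] metric_push[OF assms(1,3)]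
    by (simp add: matrix_vector_mul_assoc[symmetric] inner_vecmat)
  then have "(transpose ?E ** G c (snd c (fst U)) ** ?E) *v w = w" for w
    by (intro vec_eqI_inner)
  then show ?thesis by (simp add: matrix_eq)
qed

lemma frame_change:
  assumes "c \<in> A" "c' \<in> A" "U \<in> FB" "fst U \<in> fst c" "fst U \<in> fst c'"
  shows "fcoord c' U = frame_map (tr c c') (fcoord c U)"
proof -
  have "snd (fcoord c' U) *v y = (jac (tr c c') (snd c (fst U)) ** snd (fcoord c U)) *v y" for y
    using frame_vec(1)[OF assms(2,3,5), of y] push_at[OF assms(1,2,4,5)]
    unfolding frame_vec(2)[OF assms(1,3,4)] by (simp add: matrix_vector_mul_assoc)
  then show ?thesis using assms by (simp add: frame_map_def matrix_eq prod_eq_iff)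
qed

definition mkframe :: "('a, 'n) mchart \<Rightarrow> (real^'n) \<times> (real^'n^'n) \<Rightarrow> ('a, 'n) frame" where
  "mkframe c z = (chart_inv c (fst z), \<lambda>y. push c (chart_inv c (fst z)) (snd z *v y))"

lemma mkframe:
  assumes "c \<in> A" "fst z \<in> img c" "transpose (snd z) ** G c (fst z) ** snd z = mat 1"
  shows "mkframe c z \<in> FB" "fst (mkframe c z) \<in> fst c" "fcoord c (mkframe c z) = z"
proof -
  obtain p where p: "p \<in> fst c" "fst z = snd c p" using assms by auto
  have "linear (\<lambda>y. push c p (snd z *v y))"
    using linear_compose[OF matrix_vector_mul_linear linear_push[OF assms(1) p(1)]] by (simp add: o_def)
  moreover have "g p (push c p (snd z *v x)) (push c p (snd z *v y)) = x \<bullet> y" for x y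
  proof -
    have "(snd z *v x) \<bullet> (G c (fst z) *v (snd z *v y)) = x \<bullet> ((transpose (snd z) ** G c (fst z) ** snd z) *v y)"
      by (simp add: matrix_vector_mul_assoc[symmetric] inner_vecmat)
    then show ?thesis using p assms by (simp add: metric_push)
  qed
  ultimately show "mkframe c z \<in> FB"
    using p assms(1) by (auto simp: frame_bundle_def mkframe_def push_in_TM)
  show "fst (mkframe c z) \<in> fst c" "fcoord c (mkframe c z) = z"
    using p assms(1) by (auto simp: mkframe_def prod_eq_iff snd_fcoord)
qed

lemma mkframe_fcoord:
  assumes "c \<in> A" "U \<in> FB" "fst U \<in> fst c" shows "mkframe c (fcoord c U) = U"
proof -
  have "(\<lambda>y. push c (fst U) (snd (fcoord c U) *v y)) = snd U"
    by (rule ext) (rule frame_vec(2)[OF assms, symmetric])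
  then show ?thesis using assms by (simp add: mkframe_def prod_eq_iff)
qed

text \<open>\<open>riemann\<close> is computed separately in each chart;
  \<open>curv_mat_change\<close> shows that the results are the coordinates of a single tangent
  vector.\<close>

lemma riemann_push:
  assumes "c \<in> A" "p \<in> fst c"
  shows "riemann A g p (push c p v) (push c p w) (push c p y) = push c p (curv_mat (G c) (snd c p) v w *v y)"
proof
  fix c'
  show "riemann A g p (push c p v) (push c p w) (push c p y) c' = push c p (curv_mat (G c) (snd c p) v w *v y) c'"
  proof (cases "c' \<in> A \<and> p \<in> fst c'")
    case True
    interpret cc: chart_change "img c" "G c" "img c'" "G c'" "dom2 c c'" "tr c c'"
      using chart_change_charts assms True by blast
    have x: "snd c p \<in> dom2 c c'" "snd c' p \<in> img c'" using assms True by auto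
    show ?thesis using True assms cc.curv_mat_change[OF x(1), of v w] x(2)
      by (simp add: riemann_def push_at cc.B.local_riemann_eq matrix_vector_mul_assoc)
  qed (auto simp: riemann_def push_def)
qed

text \<open>Frees \<open>ricci\<close> from the chart chosen by \<open>chart_at\<close>: any chart
  around \<open>p\<close> may be used instead.\<close>

lemma ricci_push:
  assumes "c \<in> A" "p \<in> fst c"
  shows "ricci A g p (push c p v) (push c p w) = loc_ric (G c) (snd c p) v w"
proof -
  let ?d = "chart_at A p"
  have d: "?d \<in> A" "p \<in> fst ?d"
    using someI[of "\<lambda>d. d \<in> A \<and> p \<in> fst d" c] assms unfolding chart_at_def by auto
  interpret cc: chart_change "img c" "G c" "img ?d" "G ?d" "dom2 c ?d" "tr c ?d"
    using chart_change_charts assms d by blast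
  have x: "snd c p \<in> dom2 c ?d" using assms d by auto
  let ?J = "jac (tr c ?d) (snd c p)"
  have "push c p v = push ?d p (?J *v v)" for v
    by (rule push_push[symmetric]) (use assms d in auto)
  then have "ricci A g p (push c p v) (push c p w) =
     (\<Sum>i\<in>UNIV. riemann A g p (push ?d p (axis i 1)) (push ?d p (?J *v v)) (push ?d p (?J *v w)) ?d $ i)"
    by (simp add: ricci_def Let_def coord_tvec_eq d)
  also have "\<dots> = loc_ric (G ?d) (snd ?d p) (?J *v v) (?J *v w)"
    by (simp add: riemann_push d loc_ric_def)
  also have "\<dots> = loc_ric (G c) (snd c p) v w"
    using cc.loc_ric_change[OF x] assms by simp
  finally show ?thesis .
qed

lemma curvature_form_eq:
  assumes "c \<in> A" "U \<in> FB" "fst U \<in> fst c" "dproj \<xi> = snd U a" "dproj \<eta> = snd U b"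
  shows "curvature_form A g U \<xi> \<eta> = curv_frame (G c) a b (fcoord c U)"
proof -
  let ?E = "snd (fcoord c U)" and ?G = "G c (snd c (fst U))" and ?z = "fcoord c U"
  have g1: "transpose ?E ** ?G ** ?E = mat 1" using frame_gram[OF assms(1-3)] by simp
  then have g2: "?E ** (transpose ?E ** ?G) = mat 1" using matrix_left_right_inverse by blast
  \<comment> \<open>\<open>snd U\<close> is not onto the type of functions on charts, so
    \<open>inv (snd U)\<close> is meaningful on its range only. Hence injectivity is combined with
    an explicit preimage of the curvature vector.\<close>
  have "inj (snd U)"
  proof (rule injI)
    fix x y assume "snd U x = snd U y"
    then have "?E *v x = ?E *v y" using frame_vec(1)[OF assms(1-3)] by metis
    then have "(transpose ?E ** ?G ** ?E) *v x = (transpose ?E ** ?G ** ?E) *v y"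
      by (simp add: matrix_vector_mul_assoc[symmetric])
    then show "x = y" unfolding g1 by simp
  qed
  moreover have "riemann A g (fst U) (dproj \<xi>) (dproj \<eta>) (snd U x) = snd U (curv_frame (G c) a b ?z *v x)" for x
  proof -
    have "?E *v (curv_frame (G c) a b ?z *v x) = (?E ** (transpose ?E ** ?G)) *v
        (curv_mat (G c) (snd c (fst U)) (?E *v a) (?E *v b) *v (?E *v x))"
      by (simp add: curv_frame_def matrix_vector_mul_assoc matrix_mul_assoc)
    then show ?thesis
      unfolding assms(4,5) frame_vec(2)[OF assms(1-3)] riemann_push[OF assms(1,3)] g2 by simp
  qed
  ultimately show ?thesis by (simp add: curvature_form_def)
qed

end

section \<open>Curves of frames and fundamental horizontal fields\<close>

lemma has_vector_derivative_chainI: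
  assumes "(\<gamma> has_vector_derivative v) (at t)" "(f has_derivative f') (at z)" "\<gamma> t = z" "f' v = u"
  shows "((\<lambda>t. f (\<gamma> t)) has_vector_derivative u) (at t)"
  using has_vector_derivative_chain[OF assms(1), of f f'] assms(2-4) by simp

lemma isCont_nhds: "isCont f a \<Longrightarrow> (f \<longlongrightarrow> f a) (nhds a)"
  by (simp add: continuous_at tendsto_at_iff_tendsto_nhds)

lemma open_invertible: "open {A :: real^'n::finite^'n. invertible A}"
proof -
  have "smooth_on UNIV (\<lambda>A :: real^'n^'n. det A)"
    by (intro smooth_on_det smooth_on_linear bounded_linear_ident open_UNIV)
  then have "open (det -` (- {0}) :: (real^'n^'n) set)"
    by (intro open_vimage smooth_on_continuous) auto
  then show ?thesis by (simp add: invertible_det_nz vimage_def Compl_eq)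
qed

text \<open>\<open>Q\<close> is the local inverse of squaring, whose derivative at the identity is
  multiplication by 2. If \<open>N\<close> is symmetric, the transpose of \<open>Q N\<close> is
  another root of \<open>N\<close> near the identity, so local uniqueness makes \<open>Q N\<close>
  symmetric.\<close>

lemma matrix_sqrt_near_one:
  obtains Q :: "real^'n::finite^'n \<Rightarrow> real^'n^'n" and Q' where
    "Q (mat 1) = mat 1" "(Q has_derivative Q') (at (mat 1))"
    "\<forall>\<^sub>F N in nhds (mat 1). Q N ** Q N = N \<and> (transpose N = N \<longrightarrow> transpose (Q N) = Q N)"
proof -
  define f where "f P = P ** P" for P :: "real^'n^'n"
  define f' where "f' P = Blinfun (\<lambda>X. P ** X + X ** P)" for P :: "real^'n^'n"
  have bl: "bounded_linear (\<lambda>X. P ** X + X ** P)" for P :: "real^'n^'n"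
    using bounded_bilinear.bounded_linear_right[OF bounded_bilinear_matmul, of P]
      bounded_bilinear.bounded_linear_left[OF bounded_bilinear_matmul, of P] bounded_linear_add by blast
  have f'_apply: "blinfun_apply (f' P) X = P ** X + X ** P" for P X
    unfolding f'_def by (simp add: bounded_linear_Blinfun_apply[OF bl])
  have der: "(f has_derivative blinfun_apply (f' P)) (at P)" for P
    unfolding f_def f'_apply[abs_def] by (rule has_derivative_matmul[OF has_derivative_ident has_derivative_ident])
  have cont: "continuous_on UNIV f'"
    by (rule continuous_on_blinfun_componentwise)
      (auto simp: f'_apply intro!: continuous_intros bounded_bilinear.continuous_on[OF bounded_bilinear_matmul])
  have inv: "blinfun_scaleR_right (1/2) o\<^sub>L f' (mat 1) = id_blinfun"
    by (rule blinfun_eqI) (simp add: f'_apply flip: scaleR_2)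
  obtain U V Q Q' where Q: "open U" "mat 1 \<in> U" "open V" "f (mat 1) \<in> V" "homeomorphism U V f Q"
    "\<And>y. y \<in> V \<Longrightarrow> (Q has_derivative Q' y) (at y)"
    using inverse_function_theorem[OF open_UNIV der cont UNIV_I inv] by (metis)
  have f1: "f (mat 1) = mat 1" by (simp add: f_def)
  have Q1: "Q (mat 1) = mat 1" using Q(2,5) f1 homeomorphism_apply1 by metis
  have V1: "mat 1 \<in> V" using Q(4) f1 by simp
  have dQ: "(Q has_derivative Q' (mat 1)) (at (mat 1))" using Q(6)[OF V1] .
  then have "isCont Q (mat 1)" using has_derivative_continuous by blast
  then have lim: "(Q \<longlongrightarrow> mat 1) (nhds (mat 1))"
    unfolding continuous_at tendsto_at_iff_tendsto_nhds by (simp only: Q1)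
  have "((\<lambda>N. transpose (Q N)) \<longlongrightarrow> mat 1) (nhds (mat 1))"
    using bounded_linear.tendsto[OF bounded_linear_transpose lim] by (simp add: transpose_mat)
  then have "\<forall>\<^sub>F N in nhds (mat 1). transpose (Q N) \<in> U"
    using Q(1,2) topological_tendstoD by blast
  moreover have "\<forall>\<^sub>F N in nhds (mat 1). N \<in> V" using Q(3) V1 by (rule eventually_nhds_in_open)
  ultimately have "\<forall>\<^sub>F N in nhds (mat 1). Q N ** Q N = N \<and> (transpose N = N \<longrightarrow> transpose (Q N) = Q N)"
  proof eventually_elim
    case (elim N)
    have fQ: "f (Q N) = N" using homeomorphism_apply2[OF Q(5)] elim by blast
    moreover have "transpose (Q N) = Q N" if "transpose N = N"
    proof -
      have "f (transpose (Q N)) = N" using fQ that by (simp add: f_def matrix_transpose_mul[symmetric])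
      then show ?thesis using homeomorphism_apply1[OF Q(5), of "transpose (Q N)"] elim by simp
    qed
    ultimately show ?case by (simp add: f_def)
  qed
  with that Q1 dQ show ?thesis by blast
qed

text \<open>A curve with the given velocity is moved into the set of orthonormal frames by the factor
  \<open>(E\<^sup>T G E)\<^sup>-\<^sup>1\<^sup>/\<^sup>2\<close>, which is stationary at time \<open>0\<close>.\<close>

lemma (in local_metric) frame_curve:
  fixes z w :: "(real^'n) \<times> (real^'n^'n)"
  assumes z: "fst z \<in> S" "transpose (snd z) ** G (fst z) ** snd z = mat 1"
    and w: "fd (\<lambda>z. transpose (snd z) ** G (fst z) ** snd z) z w = 0"
  obtains \<zeta> where "\<zeta> 0 = z" "(\<zeta> has_vector_derivative w) (at (0::real))"
    "\<forall>\<^sub>F t in nhds 0. transpose (snd (\<zeta> t)) ** G (fst (\<zeta> t)) ** snd (\<zeta> t) = mat 1"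
proof -
  let ?gram = "\<lambda>z. transpose (snd z) ** G (fst z) ** snd z"
  obtain Q :: "real^'n^'n \<Rightarrow> real^'n^'n" and Q' where Q: "Q (mat 1) = mat 1" "(Q has_derivative Q') (at (mat 1))"
    "\<forall>\<^sub>F N in nhds (mat 1). Q N ** Q N = N \<and> (transpose N = N \<longrightarrow> transpose (Q N) = Q N)"
    using matrix_sqrt_near_one by blast
  define l where "l t = z + t *\<^sub>R w" for t
  have l0: "l 0 = z" by (simp add: l_def)
  have dl: "(l has_vector_derivative w) (at 0)" unfolding l_def by (auto intro!: derivative_eq_intros)
  have zW: "z \<in> W" using z(1) by (cases z) auto
  have dN: "((\<lambda>t. ?gram (l t)) has_vector_derivative 0) (at 0)"
    by (rule has_vector_derivative_chainI[OF dl smooth_on_has_derivative[OF smooth_gram zW] l0 w])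
  have dQN: "((\<lambda>t. Q (?gram (l t))) has_vector_derivative Q' 0) (at 0)"
    by (rule has_vector_derivative_chainI[OF dN Q(2) _ refl]) (simp add: l0 z(2))
  have Q'0: "Q' 0 = 0" using linear_0[OF has_derivative_linear[OF Q(2)]] .
  have inv1: "mat 1 \<in> {A :: real^'n^'n. invertible A}" by (auto simp: invertible_def)
  have sm: "smooth_on {A :: real^'n^'n. invertible A} (\<lambda>A. matrix_inv A)"
    by (intro smooth_on_matrix_inv open_invertible smooth_on_linear bounded_linear_ident) auto
  have dinv: "(matrix_inv has_derivative fd matrix_inv (mat 1)) (at (mat 1 :: real^'n^'n))"
    using smooth_on_has_derivative[OF sm inv1] .
  define P where "P t = matrix_inv (Q (?gram (l t)))" for t
  have dP: "(P has_vector_derivative 0) (at 0)"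
    unfolding P_def
    by (rule has_vector_derivative_chainI[OF dQN dinv])
      (simp_all add: z(2) l0 Q(1) Q'0 linear_0[OF has_derivative_linear[OF dinv]])
  have P0: "P 0 = mat 1" using z(2) l0 Q(1) by (simp add: P_def matrix_inv_unique)
  define \<zeta> where "\<zeta> t = (fst (l t), snd (l t) ** P t)" for t
  have "\<zeta> 0 = z" by (simp add: \<zeta>_def l0 P0)
  moreover have "(\<zeta> has_vector_derivative w) (at 0)"
  proof -
    have "(\<zeta> has_derivative (\<lambda>t. (fst (t *\<^sub>R w), snd (l 0) ** (t *\<^sub>R 0) + snd (t *\<^sub>R w) ** P 0))) (at 0)"
      unfolding \<zeta>_def using dl dP unfolding has_vector_derivative_def
      by (intro has_derivative_Pair has_derivative_matmul has_derivative_fst has_derivative_snd)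
    then show ?thesis unfolding has_vector_derivative_def
      by (rule has_derivative_eq_rhs) (auto simp: P0 matmul_simps prod_eq_iff)
  qed
  moreover have "\<forall>\<^sub>F t in nhds 0. ?gram (\<zeta> t) = mat 1"
  proof -
    have "((\<lambda>t. ?gram (l t)) \<longlongrightarrow> mat 1) (nhds 0)"
      using isCont_nhds[OF has_vector_derivative_continuous[OF dN]] by (simp only: l0 z(2))
    then have "\<forall>\<^sub>F t in nhds 0. Q (?gram (l t)) ** Q (?gram (l t)) = ?gram (l t) \<and>
        (transpose (?gram (l t)) = ?gram (l t) \<longrightarrow> transpose (Q (?gram (l t))) = Q (?gram (l t)))"
      using Q(3) unfolding filterlim_iff by blast
    moreover have "\<forall>\<^sub>F t in nhds 0. l t \<in> W"
      by (rule has_vector_derivative_eventually_in[OF dl open_W]) (simp add: l0 zW)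
    moreover have "\<forall>\<^sub>F t in nhds 0. Q (?gram (l t)) \<in> {A. invertible A}"
      by (rule has_vector_derivative_eventually_in[OF dQN open_invertible]) (use inv1 in \<open>simp add: l0 z(2) Q(1)\<close>)
    ultimately show ?thesis
    proof eventually_elim
      case (elim t)
      let ?N = "?gram (l t)"
      have "transpose ?N = ?N" using elim(2) sym_G[of "fst (l t)"] by (auto simp: matrix_transpose_mul matrix_mul_assoc)
      then have sQ: "transpose (Q ?N) = Q ?N" and QQ: "Q ?N ** Q ?N = ?N" using elim(1) by auto
      have QP: "Q ?N ** P t = mat 1" using elim(3) by (simp add: P_def matrix_inv_right)
      then have PQ: "transpose (P t) ** Q ?N = mat 1"
        using sQ by (metis matrix_transpose_mul transpose_mat)
      have "?gram (\<zeta> t) = transpose (P t) ** ?N ** P t"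
        by (simp add: \<zeta>_def matrix_transpose_mul matrix_mul_assoc)
      also have "\<dots> = (transpose (P t) ** Q ?N) ** (Q ?N ** P t)"
        by (subst QQ[symmetric]) (simp only: matrix_mul_assoc)
      finally show ?case by (simp add: QP PQ)
    qed
  qed
  ultimately show ?thesis using that by blast
qed

context riem
begin

abbreviation "K \<equiv> frame_chart A g"

lemma in_frame_chart [simp]: "U \<in> fst (K c) \<longleftrightarrow> U \<in> FB \<and> fst U \<in> fst c"
  by (simp add: frame_chart_def)

lemma snd_frame_chart [simp]: "snd (K c) U = fcoord c U"
  by (simp add: fcoord_def)

lemma frame_in_chart: assumes "U \<in> FB" obtains c where "c \<in> A" "fst U \<in> fst c"
  using frame_facts(1)[OF assms] Union_charts by blast

lemma fcoord_in: "c \<in> A \<Longrightarrow> fst U \<in> fst c \<Longrightarrow> fcoord c U \<in> img c \<times> UNIV"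
  by (simp add: mem_Times_iff)

lemma fcoord_dom2: "fst U \<in> fst c \<Longrightarrow> fst U \<in> fst c' \<Longrightarrow> fcoord c U \<in> dom2 c c' \<times> UNIV"
  by (simp add: mem_Times_iff)

text \<open>The candidate for the horizontal lift of u(a), given by its coordinates in all charts at
  once. Being linear in \<open>a\<close>, it is also the combination of the fundamental fields with
  coefficients \<open>a\<close>.\<close>

definition hvec :: "('a, 'n) frame \<Rightarrow> real^'n \<Rightarrow> ('a, 'n) ftvec" where
  "hvec U a = (\<lambda>c. if c \<in> A \<and> fst U \<in> fst c then hor_field (G c) a (fcoord c U) else 0)"

lemma frame_velocity_change:
  assumes "has_velocity A K \<gamma> U \<xi>" "c \<in> A" "c' \<in> A" "U \<in> FB" "fst U \<in> fst c" "fst U \<in> fst c'"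
  shows "\<xi> c' = fd (frame_map (tr c c')) (fcoord c U) (\<xi> c)"
proof -
  interpret cc: chart_change "img c" "G c" "img c'" "G c'" "dom2 c c'" "tr c c'"
    by (rule chart_change_charts[OF assms(2,3)])
  have \<gamma>: "\<gamma> 0 = U" "\<forall>\<^sub>F t in nhds 0. \<gamma> t \<in> fst (K c)" "((\<lambda>t. fcoord c (\<gamma> t)) has_vector_derivative \<xi> c) (at 0)"
    "\<forall>\<^sub>F t in nhds 0. \<gamma> t \<in> fst (K c')" "((\<lambda>t. fcoord c' (\<gamma> t)) has_vector_derivative \<xi> c') (at 0)"
    using assms unfolding has_velocity_def by (metis in_frame_chart snd_frame_chart[abs_def])+
  have z: "fcoord c (\<gamma> 0) \<in> dom2 c c' \<times> UNIV"
    unfolding \<gamma>(1) by (rule fcoord_dom2[OF assms(5,6)])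
  have "((\<lambda>t. frame_map (tr c c') (fcoord c (\<gamma> t))) has_vector_derivative fd (frame_map (tr c c')) (fcoord c (\<gamma> 0)) (\<xi> c)) (at 0)"
    by (rule has_vector_derivative_chain[OF \<gamma>(3) smooth_on_has_derivative[OF cc.smooth_frame_map z]])
  moreover have "\<forall>\<^sub>F t in nhds 0. frame_map (tr c c') (fcoord c (\<gamma> t)) = fcoord c' (\<gamma> t)"
    using \<gamma>(2,4) by eventually_elim (simp add: frame_change[OF assms(2,3)])
  ultimately have "((\<lambda>t. fcoord c' (\<gamma> t)) has_vector_derivative fd (frame_map (tr c c')) (fcoord c (\<gamma> 0)) (\<xi> c)) (at 0)"
    by (rule has_vector_derivative_eventually)
  then show ?thesis using \<gamma>(1,5) vector_derivative_unique_at by blast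
qed

lemma fd_frame_map_hvec:
  assumes "c \<in> A" "c' \<in> A" "U \<in> FB" "fst U \<in> fst c" "fst U \<in> fst c'"
  shows "fd (frame_map (tr c c')) (fcoord c U) (hor_field (G c) a (fcoord c U)) = hor_field (G c') a (fcoord c' U)"
proof -
  interpret cc: chart_change "img c" "G c" "img c'" "G c'" "dom2 c c'" "tr c c'"
    by (rule chart_change_charts[OF assms(1,2)])
  show ?thesis unfolding frame_change[OF assms]
    by (rule cc.frame_map_hor_field) (use assms in auto)
qed

text \<open>Tangency requires an actual curve of frames. As \<open>hor_field\<close> annihilates E^T
  G E, \<open>frame_curve\<close> provides one in a single chart, and
  \<open>fd_frame_map_hvec\<close> shows that it has the right velocity in all others. Without it
  the \<open>THE\<close> in \<open>deriv_along\<close> would not be determined.\<close>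

lemma hvec_velocity:
  assumes "U \<in> FB" shows "\<exists>\<gamma>. has_velocity A K \<gamma> U (hvec U a)"
proof -
  obtain c where c: "c \<in> A" "fst U \<in> fst c" using frame_in_chart assms by blast
  interpret L: local_metric "img c" "G c" by (rule local_metric_chart[OF c(1)])
  let ?z = "fcoord c U"
  have z: "fst ?z \<in> img c" "?z \<in> L.W" using c fcoord_in by auto
  obtain \<zeta> where \<zeta>: "\<zeta> 0 = ?z" "(\<zeta> has_vector_derivative hor_field (G c) a ?z) (at (0::real))"
    "\<forall>\<^sub>F t in nhds 0. transpose (snd (\<zeta> t)) ** G c (fst (\<zeta> t)) ** snd (\<zeta> t) = mat 1"
    using L.frame_curve[OF z(1) frame_gram[OF c(1) assms c(2)] L.fd_gram_hor[OF z(2)]] by blast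
  have "has_velocity A K (\<lambda>t. mkframe c (\<zeta> t)) U (hvec U a)"
    unfolding has_velocity_def
  proof (intro conjI allI)
    show "mkframe c (\<zeta> 0) = U" unfolding \<zeta>(1) by (rule mkframe_fcoord[OF c(1) assms c(2)])
    fix c'
    show "if c' \<in> A \<and> U \<in> fst (K c') then (\<forall>\<^sub>F t in nhds 0. mkframe c (\<zeta> t) \<in> fst (K c')) \<and>
       ((\<lambda>t. snd (K c') (mkframe c (\<zeta> t))) has_vector_derivative hvec U a c') (at 0)
       else hvec U a c' = 0"
    proof (cases "c' \<in> A \<and> fst U \<in> fst c'")
      case True
      interpret cc: chart_change "img c" "G c" "img c'" "G c'" "dom2 c c'" "tr c c'"
        using chart_change_charts c True by blast
      have o: "open (dom2 c c' \<times> (UNIV :: (real^'n^'n) set))"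
        using open_dom2 c True by (intro open_Times) auto
      have z': "\<zeta> 0 \<in> dom2 c c' \<times> UNIV"
        unfolding \<zeta>(1) using c True by (intro fcoord_dom2) auto
      have ev: "\<forall>\<^sub>F t in nhds 0. mkframe c (\<zeta> t) \<in> FB \<and> fst (mkframe c (\<zeta> t)) \<in> fst c' \<and>
          frame_map (tr c c') (\<zeta> t) = fcoord c' (mkframe c (\<zeta> t))"
        using has_vector_derivative_eventually_in[OF \<zeta>(2) o z'] \<zeta>(3)
      proof eventually_elim
        case (elim t)
        then obtain q where q: "q \<in> fst c" "q \<in> fst c'" "fst (\<zeta> t) = snd c q" by auto
        have m: "mkframe c (\<zeta> t) \<in> FB" "fst (mkframe c (\<zeta> t)) \<in> fst c" "fcoord c (mkframe c (\<zeta> t)) = \<zeta> t"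
          using mkframe[OF c(1) _ elim(2)] q by auto
        have "fst (mkframe c (\<zeta> t)) = q" using q c by (simp add: mkframe_def)
        then show ?case using m frame_change[OF c(1) _ m(1,2), of c'] True q by simp
      qed
      have "((\<lambda>t. frame_map (tr c c') (\<zeta> t)) has_vector_derivative
          fd (frame_map (tr c c')) (\<zeta> 0) (hor_field (G c) a ?z)) (at 0)"
        by (rule has_vector_derivative_chain[OF \<zeta>(2) smooth_on_has_derivative[OF cc.smooth_frame_map z']])
      then have "((\<lambda>t. frame_map (tr c c') (\<zeta> t)) has_vector_derivative hor_field (G c') a (fcoord c' U)) (at 0)"
        unfolding \<zeta>(1) using fd_frame_map_hvec c True assms by simp
      then have "((\<lambda>t. fcoord c' (mkframe c (\<zeta> t))) has_vector_derivative hor_field (G c') a (fcoord c' U)) (at 0)"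
        by (rule has_vector_derivative_eventually) (use ev in \<open>auto elim: eventually_mono\<close>)
      moreover have "\<forall>\<^sub>F t in nhds 0. mkframe c (\<zeta> t) \<in> fst (K c')"
        using ev by eventually_elim simp
      ultimately show ?thesis using True assms by (simp add: hvec_def)
    qed (auto simp: hvec_def)
  qed
  then show ?thesis by blast
qed

section \<open>Connection form and horizontal lifts\<close>

lemma chart_at: assumes "c \<in> A" "p \<in> fst c" shows "chart_at A p \<in> A" "p \<in> fst (chart_at A p)"
  using someI[of "\<lambda>d. d \<in> A \<and> p \<in> fst d" c] assms unfolding chart_at_def by auto

lemma connection_form_eq:
  assumes "c = chart_at A (fst U)"
  shows "connection_form A g U \<xi> = matrix_inv (snd (fcoord c U)) **
     (snd (\<xi> c) + chr_mat (G c) (snd c (fst U)) (fst (\<xi> c)) ** snd (fcoord c U))"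
  by (simp add: connection_form_def Let_def assms snd_fcoord local_chr_eq matrix_vector_mul_assoc)

lemma hvec_horizontal:
  assumes "U \<in> FB" shows "hvec U a \<in> horizontal_space A g U"
proof -
  obtain c where c: "c \<in> A" "fst U \<in> fst c" using frame_in_chart assms by blast
  have d: "chart_at A (fst U) \<in> A" "fst U \<in> fst (chart_at A (fst U))" using chart_at c by auto
  have "connection_form A g U (hvec U a) = 0"
    using d by (simp add: connection_form_eq hvec_def hor_field_def matmul_simps)
  then show ?thesis using hvec_velocity[OF assms] by (simp add: horizontal_space_def tangent_space_def)
qed

lemma dproj_hvec:
  assumes "U \<in> FB" shows "dproj (hvec U a) = snd U a"
proof
  fix c
  obtain d where d: "d \<in> A" "fst U \<in> fst d" using frame_in_chart assms by blast
  show "dproj (hvec U a) c = snd U a c"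
  proof (cases "c \<in> A \<and> fst U \<in> fst c")
    case True
    then show ?thesis using frame_vec(1) assms by (simp add: dproj_def hvec_def hor_field_def)
  next
    case False
    then show ?thesis using frame_vec(2)[OF d(1) assms d(2), of a] by (auto simp: dproj_def hvec_def push_def)
  qed
qed

text \<open>For uniqueness: in the chart used by the connection form, its vanishing expresses the
  matrix part of \<open>\<xi>\<close> through the base part, and
  \<open>frame_velocity_change\<close> carries this equality to the other charts.\<close>

lemma horizontal_lift_eq:
  assumes "U \<in> FB" shows "horizontal_lift A g U (snd U a) = hvec U a"
  unfolding horizontal_lift_def
proof (rule the_equality)
  show "hvec U a \<in> horizontal_space A g U \<and> dproj (hvec U a) = snd U a"
    using hvec_horizontal dproj_hvec assms by blast
  fix \<xi> assume \<xi>: "\<xi> \<in> horizontal_space A g U \<and> dproj \<xi> = snd U a"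
  then obtain \<gamma> where \<gamma>: "has_velocity A K \<gamma> U \<xi>" and con: "connection_form A g U \<xi> = 0"
    by (auto simp: horizontal_space_def tangent_space_def)
  let ?d = "chart_at A (fst U)"
  obtain c where c: "c \<in> A" "fst U \<in> fst c" using frame_in_chart assms by blast
  have d: "?d \<in> A" "fst U \<in> fst ?d" using chart_at c by auto
  let ?E = "snd (fcoord ?d U)"
  have "invertible ?E"
    using frame_gram[OF d(1) assms d(2)] by (metis invertible_def matrix_left_right_inverse)
  then have EI: "?E ** matrix_inv ?E = mat 1" by (rule matrix_inv_right)
  have 1: "fst (\<xi> ?d) = ?E *v a"
    using \<xi> frame_vec(1)[OF d(1) assms d(2), of a] by (metis dproj_def)
  have "?E ** connection_form A g U \<xi> = snd (\<xi> ?d) + chr_mat (G ?d) (snd ?d (fst U)) (fst (\<xi> ?d)) ** ?E"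
    unfolding connection_form_eq[OF refl] matrix_mul_assoc EI by simp
  then have "snd (\<xi> ?d) = - (chr_mat (G ?d) (snd ?d (fst U)) (?E *v a) ** ?E)"
    unfolding con 1 by (simp add: matmul_simps eq_neg_iff_add_eq_0)
  with 1 have \<xi>d: "\<xi> ?d = hor_field (G ?d) a (fcoord ?d U)"
    by (simp add: hor_field_def prod_eq_iff)
  show "\<xi> = hvec U a"
  proof
    fix c'
    show "\<xi> c' = hvec U a c'"
    proof (cases "c' \<in> A \<and> fst U \<in> fst c'")
      case True
      then show ?thesis
        using frame_velocity_change[OF \<gamma> d(1) _ assms d(2), of c'] fd_frame_map_hvec[OF d(1) _ assms d(2), of c'] \<xi>d
        by (simp add: hvec_def)
    next
      case False
      then have "\<xi> c' = 0" using \<gamma> unfolding has_velocity_def by (metis in_frame_chart)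
      then show ?thesis using False by (auto simp: hvec_def)
    qed
  qed
qed

lemma fundamental_field_eq: "U \<in> FB \<Longrightarrow> fundamental_field A g i U = hvec U (axis i 1)"
  by (simp add: fundamental_field_def horizontal_lift_eq)

lemma linear_hvec: "linear (hvec U)"
proof (rule linearI)
  have l: "linear (\<lambda>a. hor_field G a z)" for G :: "real^'n \<Rightarrow> real^'n^'n" and z
    by (rule linearI) (simp_all add: hor_field_def matvec_simps matmul_simps chr_mat_simps
        linear_scale[OF linear_chr_mat])
  show "hvec U (a + b) = hvec U a + hvec U b" "hvec U (r *\<^sub>R a) = r *\<^sub>R hvec U a" for a b r
    by (auto simp: hvec_def fun_eq_iff scaleR_fun_def linear_add[OF l] linear_scale[OF l])
qed

lemma sum_fundamental_field:
  assumes "U \<in> FB" shows "(\<Sum>i\<in>UNIV. a $ i *\<^sub>R fundamental_field A g i U) = hvec U a"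
  unfolding fundamental_field_eq[OF assms] by (rule linear_axis_sum[OF linear_hvec, symmetric])

lemma horizontal_coeffs_hvec:
  assumes "U \<in> FB" shows "horizontal_coeffs A g U (hvec U a) = a"
  unfolding horizontal_coeffs_def sum_fundamental_field[OF assms]
proof (rule the_equality)
  fix b assume "hvec U a = hvec U b"
  then have "snd U a = snd U b" using dproj_hvec[OF assms] by metis
  then have "(a - b) \<bullet> (a - b) = 0"
    using frame_facts(4)[OF assms, of "a - b" "a - b"] linear_diff[OF frame_facts(2)[OF assms], of a b]
      frame_facts(4)[OF assms, of 0 0] linear_0[OF frame_facts(2)[OF assms]] by simp
  then show "b = a" by simp
qed simp

end

section \<open>The matrix exponential of a skew matrix\<close>

definition mat_pow :: "real^'n::finite^'n \<Rightarrow> nat \<Rightarrow> real^'n^'n" where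
  "mat_pow M k = ((\<lambda>N. M ** N) ^^ k) (mat 1)"

lemma mat_pow_0: "mat_pow M 0 = mat 1" and mat_pow_Suc: "mat_pow M (Suc k) = M ** mat_pow M k"
  by (simp_all add: mat_pow_def)

lemma mat_pow_scaleR: "mat_pow (t *\<^sub>R M) k = t ^ k *\<^sub>R mat_pow M k"
  by (induction k) (simp_all add: mat_pow_0 mat_pow_Suc matmul_simps)

lemma summable_mat_exp:
  fixes M :: "real^'n::finite^'n"
  shows "summable (\<lambda>k. (1 / fact k) *\<^sub>R mat_pow M k)"
proof -
  obtain C where C: "C > 0" "\<And>(A :: real^'n^'n) (B :: real^'n^'n). norm (A ** B) \<le> norm A * norm B * C"
    using bounded_bilinear.pos_bounded[OF bounded_bilinear_matmul] by blast
  have b: "norm (mat_pow M k) \<le> (norm M * C) ^ k * norm (mat 1 :: real^'n^'n)" for k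
  proof (induction k)
    case (Suc k)
    have "norm (mat_pow M (Suc k)) \<le> norm M * norm (mat_pow M k) * C" unfolding mat_pow_Suc by (rule C)
    also have "\<dots> \<le> norm M * ((norm M * C) ^ k * norm (mat 1 :: real^'n^'n)) * C"
      using C(1) Suc by (intro mult_left_mono mult_right_mono) auto
    finally show ?case by (simp add: mult_ac)
  qed (simp add: mat_pow_0)
  show ?thesis
  proof (rule summable_comparison_test'[where N=0])
    show "summable (\<lambda>k. (inverse (fact k) * (norm M * C) ^ k) * norm (mat 1 :: real^'n^'n))"
      by (rule summable_mult2[OF summable_exp])
    show "norm ((1 / fact k) *\<^sub>R mat_pow M k) \<le> (inverse (fact k) * (norm M * C) ^ k) * norm (mat 1 :: real^'n^'n)" for k
      using b[of k] by (simp add: divide_inverse mult.assoc mult_left_mono)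
  qed
qed

lemma mat_exp_eq: "mat_exp M = (\<Sum>k. (1 / fact k) *\<^sub>R mat_pow M k)"
  by (simp add: mat_exp_def mat_pow_def)

lemma mat_exp_0: "mat_exp (0 :: real^'n::finite^'n) = mat 1"
proof -
  have "(\<Sum>k. (1 / fact k) *\<^sub>R mat_pow (0 :: real^'n^'n) k) = (\<Sum>k\<in>{0}. (1 / fact k) *\<^sub>R mat_pow (0 :: real^'n^'n) k)"
  proof (rule suminf_finite)
    fix k :: nat assume "k \<notin> {0}"
    then show "(1 / fact k) *\<^sub>R mat_pow (0 :: real^'n^'n) k = 0" by (cases k) (simp_all add: mat_pow_Suc matmul_simps)
  qed simp
  then show ?thesis by (simp add: mat_exp_eq mat_pow_0)
qed

text \<open>Each entry is an everywhere convergent power series in \<open>t\<close>, so it may be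
  differentiated term by term.\<close>

lemma has_derivative_mat_exp:
  fixes M :: "real^'n::finite^'n"
  shows "((\<lambda>t. mat_exp (t *\<^sub>R M)) has_vector_derivative (M ** mat_exp (t *\<^sub>R M))) (at t)"
proof -
  define e where "e i j = (\<lambda>N :: real^'n^'n. N $ i $ j)" for i j
  have bl: "bounded_linear (e i j)" for i j
    unfolding e_def by (intro bounded_linear_compose[OF bounded_linear_vec_nth bounded_linear_vec_nth, unfolded o_def])
  define a where "a i j k = e i j (mat_pow M k) / fact k" for i j k
  have s: "e i j (mat_exp (t *\<^sub>R M)) = (\<Sum>k. a i j k * t ^ k)" "summable (\<lambda>k. a i j k * t ^ k)" for i j t
  proof -
    have *: "e i j ((1 / fact k) *\<^sub>R mat_pow (t *\<^sub>R M) k) = a i j k * t ^ k" for k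
      by (simp add: a_def e_def mat_pow_scaleR)
    show "e i j (mat_exp (t *\<^sub>R M)) = (\<Sum>k. a i j k * t ^ k)"
      unfolding mat_exp_eq using bounded_linear.suminf[OF bl summable_mat_exp, of i j "t *\<^sub>R M"] unfolding * by simp
    show "summable (\<lambda>k. a i j k * t ^ k)"
      using bounded_linear.summable[OF bl summable_mat_exp, of i j "t *\<^sub>R M"] unfolding * .
  qed
  have "((\<lambda>t. e i j (mat_exp (t *\<^sub>R M))) has_real_derivative e i j (M ** mat_exp (t *\<^sub>R M))) (at t)" for i j
  proof -
    \<comment> \<open>Passing to coefficient \<open>k + 1\<close> brings one more factor
      \<open>M\<close>, and the factor \<open>k + 1\<close> from differentiation reduces the
      factorial.\<close>
    have "diffs (a i j) k * t ^ k = e i j (M ** ((1 / fact k) *\<^sub>R mat_pow (t *\<^sub>R M) k))" for k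
      by (simp add: diffs_def a_def e_def mat_pow_Suc mat_pow_scaleR matmul_simps field_simps del: of_nat_Suc)
    moreover have "bounded_linear (\<lambda>N. e i j (M ** N))"
      by (rule bounded_linear_compose[OF bl bounded_bilinear.bounded_linear_right[OF bounded_bilinear_matmul]])
    ultimately have "e i j (M ** mat_exp (t *\<^sub>R M)) = (\<Sum>k. diffs (a i j) k * t ^ k)"
      unfolding mat_exp_eq using bounded_linear.suminf[OF _ summable_mat_exp, of "\<lambda>N. e i j (M ** N)" "t *\<^sub>R M"] by simp
    then show ?thesis
      using termdiffs_strong_converges_everywhere[of "a i j" t] s by simp
  qed
  then have "((\<lambda>t. mat_exp (t *\<^sub>R M) $ i $ j) has_vector_derivative (M ** mat_exp (t *\<^sub>R M)) $ i $ j) (at t)" for i j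
    unfolding e_def has_real_derivative_iff_has_vector_derivative .
  then show ?thesis
    unfolding has_vector_derivative_def
    by (subst has_derivative_componentwise_within)
      (auto simp: Basis_vec_def inner_axis)
qed

text \<open>With P the exponential, P^T P has derivative P^T (M^T + M) P = 0, hence stays at its
  value at 0. This keeps the curves that define \<open>Vder\<close> among the orthonormal
  frames.\<close>

lemma mat_exp_orthogonal:
  fixes M :: "real^'n::finite^'n"
  assumes "M \<in> skew_matrices"
  shows "transpose (mat_exp (t *\<^sub>R M)) ** mat_exp (t *\<^sub>R M) = mat 1"
proof -
  let ?P = "\<lambda>t. mat_exp (t *\<^sub>R M)"
  have M: "transpose M = - M" using assms by (simp add: skew_matrices_def)
  have "((\<lambda>t. transpose (?P t) ** ?P t) has_derivative (\<lambda>s. 0)) (at t within UNIV)" for t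
  proof -
    note d = has_derivative_mat_exp[of M t, unfolded has_vector_derivative_def]
    show ?thesis
      by (rule has_derivative_eq_rhs[OF has_derivative_matmul[OF has_derivative_transpose[OF d] d]])
        (simp add: fun_eq_iff matmul_simps transpose_simps matrix_transpose_mul M matrix_mul_assoc)
  qed
  then obtain c where "\<And>t. transpose (?P t) ** ?P t = c"
    using has_derivative_zero_constant[of UNIV "\<lambda>t. transpose (?P t) ** ?P t"] by auto
  moreover have "transpose (?P 0) ** ?P 0 = mat 1" by (simp add: mat_exp_0 transpose_mat)
  ultimately show ?thesis by metis
qed

section \<open>Differentiation on the frame bundle\<close>

context riem
begin

abbreviation "smooth \<equiv> smooth_fun A K"

text \<open>\<open>h\<close> is a local extension of \<open>F\<close> in coordinates. It is pinned
  down only at coordinates of frames, so identities between functions are always read off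
  there.\<close>

definition rep :: "('a, 'n) mchart \<Rightarrow> ((real^'n) \<times> (real^'n^'n)) set \<Rightarrow> ((real^'n) \<times> (real^'n^'n) \<Rightarrow> real) \<Rightarrow>
    (('a, 'n) frame \<Rightarrow> real) \<Rightarrow> bool" where
  "rep c W h F \<longleftrightarrow> c \<in> A \<and> open W \<and> W \<subseteq> img c \<times> UNIV \<and> smooth_on W h \<and>
     (\<forall>U\<in>FB. fst U \<in> fst c \<longrightarrow> fcoord c U \<in> W \<longrightarrow> F U = h (fcoord c U))"

lemma smooth_rep:
  assumes "smooth F" "c \<in> A" "U \<in> FB" "fst U \<in> fst c"
  shows "\<exists>W h. rep c W h F \<and> fcoord c U \<in> W"
proof -
  have U: "U \<in> fst (K c)" using assms by simp
  obtain W h where W: "open W" "fcoord c U \<in> W" "smooth_on W h"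
    "\<And>V. V \<in> fst (K c) \<Longrightarrow> fcoord c V \<in> W \<Longrightarrow> F V = h (fcoord c V)"
    using bspec[OF bspec[OF assms(1)[unfolded smooth_fun_def] assms(2), unfolded smooth_in_chart_def] U]
    unfolding snd_frame_chart by metis
  have "open (W \<inter> (img c \<times> UNIV))"
    using chart_facts(2)[OF assms(2)] W(1) by (intro open_Int open_Times open_UNIV)
  then have "rep c (W \<inter> (img c \<times> UNIV)) h F"
    using W assms(2) smooth_on_subset[OF W(3)] by (auto simp: rep_def)
  moreover have "fcoord c U \<in> W \<inter> (img c \<times> UNIV)" using W(2) fcoord_in[OF assms(2,4)] by blast
  ultimately show ?thesis by (intro exI conjI)
qed

lemma rep_smooth:
  assumes "\<And>c U. c \<in> A \<Longrightarrow> U \<in> FB \<Longrightarrow> fst U \<in> fst c \<Longrightarrow> \<exists>W h. rep c W h F \<and> fcoord c U \<in> W"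
  shows "smooth F"
  unfolding smooth_fun_def smooth_in_chart_def
proof (intro ballI)
  fix c U assume "c \<in> A" "U \<in> fst (K c)"
  then obtain W h where "rep c W h F" "fcoord c U \<in> W" using assms[of c U] by auto
  then show "\<exists>W h. open W \<and> snd (K c) U \<in> W \<and> smooth_on W h \<and>
       (\<forall>q\<in>fst (K c). snd (K c) q \<in> W \<longrightarrow> F q = h (snd (K c) q))"
    unfolding rep_def by (intro exI[of _ W] exI[of _ h]) auto
qed

lemma rep_cong: "rep c W h F \<Longrightarrow> (\<And>U. U \<in> FB \<Longrightarrow> F U = F' U) \<Longrightarrow> rep c W h F'"
  by (simp add: rep_def)

lemma rep_value: "rep c W h F \<Longrightarrow> U \<in> FB \<Longrightarrow> fst U \<in> fst c \<Longrightarrow> fcoord c U \<in> W \<Longrightarrow> F U = h (fcoord c U)"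
  by (simp add: rep_def)

lemma rep_has_derivative: "rep c W h F \<Longrightarrow> z \<in> W \<Longrightarrow> (h has_derivative fd h z) (at z)"
  unfolding rep_def using smooth_on_has_derivative by blast

lemma rep_const: "c \<in> A \<Longrightarrow> rep c (img c \<times> UNIV) (\<lambda>z. a) (\<lambda>U. a)"
  using chart_facts(2) by (simp add: rep_def open_Times smooth_on_const)

lemma rep_add: "rep c W h F \<Longrightarrow> rep c W' h' F' \<Longrightarrow> rep c (W \<inter> W') (\<lambda>z. h z + h' z) (\<lambda>U. F U + F' U)"
  unfolding rep_def by (auto intro!: smooth_on_add elim: smooth_on_subset)

lemma rep_mult: "rep c W h F \<Longrightarrow> rep c W' h' F' \<Longrightarrow> rep c (W \<inter> W') (\<lambda>z. h z * h' z) (\<lambda>U. F U * F' U)"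
  unfolding rep_def by (auto intro!: smooth_on_mult elim: smooth_on_subset)

lemma smooth_cong:
  assumes "smooth F" "\<And>U. U \<in> FB \<Longrightarrow> F U = F' U" shows "smooth F'"
proof (rule rep_smooth)
  fix c U assume "c \<in> A" "U \<in> FB" "fst U \<in> fst c"
  from smooth_rep[OF assms(1) this] obtain W h where "rep c W h F" "fcoord c U \<in> W" by blast
  with rep_cong[where F=F and F'=F', OF _ assms(2)] show "\<exists>W h. rep c W h F' \<and> fcoord c U \<in> W" by blast
qed

lemma smooth_const: "smooth (\<lambda>U. a)"
  by (rule rep_smooth) (use rep_const fcoord_in in blast)

lemma smooth_add:
  assumes "smooth F" "smooth F'" shows "smooth (\<lambda>U. F U + F' U)"
proof (rule rep_smooth)
  fix c U assume "c \<in> A" "U \<in> FB" "fst U \<in> fst c"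
  from smooth_rep[OF assms(1) this] smooth_rep[OF assms(2) this]
  show "\<exists>W h. rep c W h (\<lambda>U. F U + F' U) \<and> fcoord c U \<in> W" using rep_add by blast
qed

lemma smooth_mult:
  assumes "smooth F" "smooth F'" shows "smooth (\<lambda>U. F U * F' U)"
proof (rule rep_smooth)
  fix c U assume "c \<in> A" "U \<in> FB" "fst U \<in> fst c"
  from smooth_rep[OF assms(1) this] smooth_rep[OF assms(2) this]
  show "\<exists>W h. rep c W h (\<lambda>U. F U * F' U) \<and> fcoord c U \<in> W" using rep_mult by blast
qed

lemma smooth_sum: "(\<And>i. i \<in> I \<Longrightarrow> smooth (F i)) \<Longrightarrow> smooth (\<lambda>U. \<Sum>i\<in>I. F i U)"
  by (induction I rule: infinite_finite_induct) (auto intro: smooth_const smooth_add)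

text \<open>Common abstraction of \<open>Hder\<close> and \<open>Vder\<close>: in each chart a field
  \<open>\<Xi> c\<close> on pairs sends extensions to extensions on the same open set. This one
  property yields smoothness, the Leibniz rule and the possibility to iterate.\<close>

definition derivation :: "((('a, 'n) frame \<Rightarrow> real) \<Rightarrow> ('a, 'n) frame \<Rightarrow> real) \<Rightarrow> bool" where
  "derivation D \<longleftrightarrow> (\<exists>\<Xi>. \<forall>c W h F. rep c W h F \<longrightarrow> rep c W (\<lambda>z. fd h z (\<Xi> c z)) (D F))"

lemma derivation_smooth:
  assumes "derivation D" "smooth F" shows "smooth (D F)"
proof (rule rep_smooth)
  fix c U assume "c \<in> A" "U \<in> FB" "fst U \<in> fst c"
  from smooth_rep[OF assms(2) this]
  show "\<exists>W h. rep c W h (D F) \<and> fcoord c U \<in> W"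
    using assms(1) unfolding derivation_def by blast
qed

text \<open>The type of frames also contains pairs that are not frames; equality on the bundle
  suffices, since both functions then have the same local extensions.\<close>

lemma derivation_cong:
  assumes "derivation D" "smooth F" "\<And>U. U \<in> FB \<Longrightarrow> F U = F' U" "U \<in> FB"
  shows "D F U = D F' U"
proof -
  obtain c where c: "c \<in> A" "fst U \<in> fst c" using frame_in_chart assms(4) by blast
  obtain W h where W: "rep c W h F" "fcoord c U \<in> W" using smooth_rep[OF assms(2) c(1) assms(4) c(2)] by blast
  obtain \<Xi> where *: "\<And>c W h F. rep c W h F \<Longrightarrow> rep c W (\<lambda>z. fd h z (\<Xi> c z)) (D F)"
    using assms(1) unfolding derivation_def by blast
  show ?thesis
    using rep_value[OF *[OF W(1)] assms(4) c(2) W(2)]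
      rep_value[OF *[OF rep_cong[OF W(1) assms(3)]] assms(4) c(2) W(2)] by simp
qed

lemma derivation_const: assumes "derivation D" "U \<in> FB" shows "D (\<lambda>_. a) U = 0"
proof -
  obtain c where c: "c \<in> A" "fst U \<in> fst c" using frame_in_chart assms(2) by blast
  obtain \<Xi> where "\<And>c W h F. rep c W h F \<Longrightarrow> rep c W (\<lambda>z. fd h z (\<Xi> c z)) (D F)"
    using assms(1) unfolding derivation_def by blast
  from rep_value[OF this[OF rep_const[OF c(1)]] assms(2) c(2) fcoord_in[OF c]]
  show ?thesis by simp
qed

lemma derivation_add_mult:
  assumes "derivation D" "smooth F" "smooth F'" "U \<in> FB"
  shows "D (\<lambda>U. F U + F' U) U = D F U + D F' U"
    and "D (\<lambda>U. F U * F' U) U = F U * D F' U + D F U * F' U"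
proof -
  obtain c where c: "c \<in> A" "fst U \<in> fst c" using frame_in_chart assms(4) by blast
  obtain W h where W: "rep c W h F" "fcoord c U \<in> W" using smooth_rep[OF assms(2) c(1) assms(4) c(2)] by blast
  obtain W' h' where W': "rep c W' h' F'" "fcoord c U \<in> W'" using smooth_rep[OF assms(3) c(1) assms(4) c(2)] by blast
  have in2: "fcoord c U \<in> W \<inter> W'" using W W' by blast
  obtain \<Xi> where *: "\<And>c W h F. rep c W h F \<Longrightarrow> rep c W (\<lambda>z. fd h z (\<Xi> c z)) (D F)"
    using assms(1) unfolding derivation_def by blast
  note v = rep_value[OF _ assms(4) c(2)]
  note d = rep_has_derivative[OF W] rep_has_derivative[OF W']
  show "D (\<lambda>U. F U + F' U) U = D F U + D F' U"
    unfolding v[OF *[OF rep_add[OF W(1) W'(1)]] in2] v[OF *[OF W(1)] W(2)] v[OF *[OF W'(1)] W'(2)]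
    by (rule fd_eqI[OF has_derivative_add[OF d]])
  show "D (\<lambda>U. F U * F' U) U = F U * D F' U + D F U * F' U"
    unfolding v[OF *[OF rep_mult[OF W(1) W'(1)]] in2] v[OF *[OF W(1)] W(2)] v[OF *[OF W'(1)] W'(2)]
      v[OF W] v[OF W']
    by (rule fd_eqI[OF has_derivative_mult[OF d]])
qed

lemmas derivation_add = derivation_add_mult(1) and derivation_mult = derivation_add_mult(2)

lemma derivation_cmult:
  assumes "derivation D" "smooth F" "U \<in> FB" shows "D (\<lambda>U. a * F U) U = a * D F U"
  using derivation_mult[OF assms(1) smooth_const assms(2,3)] derivation_const[OF assms(1,3)] by simp

lemma derivation_sum:
  assumes "derivation D" "U \<in> FB"
  shows "(\<And>i. i \<in> I \<Longrightarrow> smooth (F i)) \<Longrightarrow> D (\<lambda>U. \<Sum>i\<in>I. F i U) U = (\<Sum>i\<in>I. D (F i) U)"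
proof (induction I rule: infinite_finite_induct)
  case (insert i I)
  then have "D (\<lambda>U. F i U + (\<Sum>i\<in>I. F i U)) U = D (F i) U + D (\<lambda>U. \<Sum>i\<in>I. F i U) U"
    by (intro derivation_add[OF assms(1)] smooth_sum assms(2)) auto
  then show ?case using insert by simp
qed (use derivation_const[OF assms] in simp_all)

section \<open>Horizontal and vertical derivatives in coordinates\<close>

lemma rep_has_real_derivative:
  assumes "rep c W h F" "fcoord c U \<in> W" "\<gamma> 0 = U" "\<forall>\<^sub>F t in nhds 0. \<gamma> t \<in> FB \<and> fst (\<gamma> t) \<in> fst c"
    "((\<lambda>t. fcoord c (\<gamma> t)) has_vector_derivative w) (at 0)"
  shows "((\<lambda>t. F (\<gamma> t)) has_real_derivative fd h (fcoord c U) w) (at 0)"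
proof -
  have "((\<lambda>t. h (fcoord c (\<gamma> t))) has_vector_derivative fd h (fcoord c U) w) (at 0)"
    by (rule has_vector_derivative_chainI[OF assms(5) rep_has_derivative[OF assms(1,2)] _ refl]) (simp add: assms(3))
  moreover have "\<forall>\<^sub>F t in nhds 0. fcoord c (\<gamma> t) \<in> W"
    by (rule has_vector_derivative_eventually_in[OF assms(5)]) (use assms(1-3) in \<open>auto simp: rep_def\<close>)
  then have "\<forall>\<^sub>F t in nhds 0. h (fcoord c (\<gamma> t)) = F (\<gamma> t)"
    using assms(4) by eventually_elim (use rep_value[OF assms(1)] in auto)
  ultimately have "((\<lambda>t. F (\<gamma> t)) has_vector_derivative fd h (fcoord c U) w) (at 0)"
    by (rule has_vector_derivative_eventually)
  then show ?thesis by (simp add: has_real_derivative_iff_has_vector_derivative)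
qed

text \<open>A curve with the horizontal velocity exists by \<open>hvec_velocity\<close>, and along
  every such curve the chain rule gives the same number, so the \<open>THE\<close> is determined and
  equals the derivative of the extension.\<close>

lemma rep_Hder:
  assumes "rep c W h F" shows "rep c W (\<lambda>z. fd h z (hor_field (G c) (axis i 1) z)) (Hder A g i F)"
proof -
  have c: "c \<in> A" and W: "open W" "W \<subseteq> img c \<times> UNIV" "smooth_on W h" using assms by (auto simp: rep_def)
  interpret L: local_metric "img c" "G c" by (rule local_metric_chart[OF c])
  have "Hder A g i F U = fd h (fcoord c U) (hor_field (G c) (axis i 1) (fcoord c U))"
    if U: "U \<in> FB" "fst U \<in> fst c" "fcoord c U \<in> W" for U
  proof -
    have hv: "hvec U (axis i 1) c = hor_field (G c) (axis i 1) (fcoord c U)" using c U by (simp add: hvec_def)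
    have *: "((\<lambda>t. F (\<gamma> t)) has_real_derivative fd h (fcoord c U) (\<xi> c)) (at 0)"
      if "has_velocity A K \<gamma> U \<xi>" for \<gamma> \<xi>
    proof -
      have \<gamma>: "\<gamma> 0 = U" "\<forall>\<^sub>F t in nhds 0. \<gamma> t \<in> fst (K c)" "((\<lambda>t. snd (K c) (\<gamma> t)) has_vector_derivative \<xi> c) (at 0)"
        using that c U unfolding has_velocity_def by (metis in_frame_chart)+
      show ?thesis
        by (rule rep_has_real_derivative[where \<gamma> = \<gamma>, OF assms U(3) \<gamma>(1)]) (use \<gamma> in simp_all)
    qed
    obtain \<gamma> where \<gamma>: "has_velocity A K \<gamma> U (hvec U (axis i 1))" using hvec_velocity[OF U(1)] by blast
    show ?thesis
      unfolding Hder_def deriv_along_def fundamental_field_eq[OF U(1)]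
    proof (rule the_equality)
      show "\<forall>\<gamma>. has_velocity A K \<gamma> U (hvec U (axis i 1)) \<longrightarrow> ((\<lambda>t. F (\<gamma> t)) has_real_derivative
          fd h (fcoord c U) (hor_field (G c) (axis i 1) (fcoord c U))) (at 0)"
        using * unfolding hv[symmetric] by blast
    next
      fix D assume "\<forall>\<gamma>. has_velocity A K \<gamma> U (hvec U (axis i 1)) \<longrightarrow> ((\<lambda>t. F (\<gamma> t)) has_real_derivative D) (at 0)"
      then have "((\<lambda>t. F (\<gamma> t)) has_real_derivative D) (at 0)" using \<gamma> by blast
      from DERIV_unique[OF this *[OF \<gamma>]] show "D = fd h (fcoord c U) (hor_field (G c) (axis i 1) (fcoord c U))"
        unfolding hv .
    qed
  qed
  moreover have "smooth_on W (\<lambda>z. fd h z (hor_field (G c) (axis i 1) z))"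
    by (rule smooth_on_fd_field[OF W(1,3) smooth_on_subset[OF L.smooth_hor_field W(2)]])
  ultimately show ?thesis using c W by (simp add: rep_def)
qed

text \<open>The defining curve stays in the bundle because \<open>mat_exp\<close> of a skew matrix
  is orthogonal; in coordinates it is E times the exponential, with velocity E M at 0.\<close>

lemma rep_Vder:
  assumes "rep c W h F" "M \<in> skew_matrices" shows "rep c W (\<lambda>z. fd h z (ver_field M z)) (Vder M F)"
proof -
  have c: "c \<in> A" and W: "open W" "W \<subseteq> img c \<times> UNIV" "smooth_on W h" using assms by (auto simp: rep_def)
  interpret L: local_metric "img c" "G c" by (rule local_metric_chart[OF c])
  have "Vder M F U = fd h (fcoord c U) (ver_field M (fcoord c U))"
    if U: "U \<in> FB" "fst U \<in> fst c" "fcoord c U \<in> W" for U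
  proof -
    define \<gamma> where "\<gamma> t = (fst U, \<lambda>x. snd U (mat_exp (t *\<^sub>R M) *v x))" for t
    have \<gamma>0: "\<gamma> 0 = U" by (simp add: \<gamma>_def mat_exp_0)
    have FB: "\<gamma> t \<in> FB" for t
    proof -
      let ?P = "mat_exp (t *\<^sub>R M)"
      have "(?P *v x) \<bullet> (?P *v y) = x \<bullet> ((transpose ?P ** ?P) *v y)" for x y
        by (simp add: matrix_vector_mul_assoc[symmetric] inner_vecmat)
      then have "(?P *v x) \<bullet> (?P *v y) = x \<bullet> y" for x y
        unfolding mat_exp_orthogonal[OF assms(2)] by simp
      moreover have "linear (\<lambda>x. snd U (?P *v x))"
        using linear_compose[OF matrix_vector_mul_linear frame_facts(2)[OF U(1)]] by (simp add: o_def)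
      ultimately show ?thesis
        using frame_facts[OF U(1)] Union_charts by (simp add: frame_bundle_def \<gamma>_def)
    qed
    have co: "fcoord c (\<gamma> t) = (snd c (fst U), snd (fcoord c U) ** mat_exp (t *\<^sub>R M))" for t
    proof -
      have "matrix (\<lambda>x. snd (\<gamma> t) x c) = snd (fcoord c U) ** mat_exp (t *\<^sub>R M)"
        by (simp add: \<gamma>_def frame_vec(1)[OF c U(1,2)] matrix_vector_mul_assoc)
      then show ?thesis by (simp add: prod_eq_iff snd_fcoord[symmetric]) (simp add: \<gamma>_def)
    qed
    have "((\<lambda>t. fcoord c (\<gamma> t)) has_vector_derivative ver_field M (fcoord c U)) (at 0)"
    proof -
      have "((\<lambda>t. (snd c (fst U), snd (fcoord c U) ** mat_exp (t *\<^sub>R M))) has_derivative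
         (\<lambda>s. (0, snd (fcoord c U) ** (s *\<^sub>R (M ** mat_exp (0 *\<^sub>R M))) + 0 ** mat_exp (0 *\<^sub>R M)))) (at 0)"
        by (intro has_derivative_Pair has_derivative_const has_derivative_matmul
            has_derivative_mat_exp[unfolded has_vector_derivative_def])
      then show ?thesis unfolding co has_vector_derivative_def
        by (rule has_derivative_eq_rhs) (simp add: fun_eq_iff ver_field_def matmul_simps mat_exp_0)
    qed
    then have "((\<lambda>t. F (\<gamma> t)) has_real_derivative fd h (fcoord c U) (ver_field M (fcoord c U))) (at 0)"
      by (intro rep_has_real_derivative[where \<gamma> = \<gamma>, OF assms(1) U(3) \<gamma>0]) (use FB U(2) in \<open>simp add: \<gamma>_def\<close>)
    then have "((\<lambda>t. (F (\<gamma> t) - F U) / t) \<longlongrightarrow> fd h (fcoord c U) (ver_field M (fcoord c U))) (at 0)"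
      by (simp add: DERIV_def \<gamma>0)
    then show ?thesis unfolding Vder_def \<gamma>_def by (intro tendsto_Lim) auto
  qed
  moreover have "smooth_on W (\<lambda>z. fd h z (ver_field M z))"
    by (rule smooth_on_fd_field[OF W(1,3) smooth_on_subset[OF L.smooth_ver_field W(2)]])
  ultimately show ?thesis using c W by (simp add: rep_def)
qed

lemma derivation_Hder: "derivation (Hder A g i)"
  unfolding derivation_def using rep_Hder by (intro exI[of _ "\<lambda>c. hor_field (G c) (axis i 1)"]) blast

lemma derivation_Vder: "M \<in> skew_matrices \<Longrightarrow> derivation (Vder M)"
  unfolding derivation_def using rep_Vder by (intro exI[of _ "\<lambda>c. ver_field M"]) blast

end

section \<open>Commutation relations and the curvature form\<close>

lemma skew_combination: "(\<And>m. m \<in> I \<Longrightarrow> M m \<in> skew_matrices) \<Longrightarrow> (\<Sum>m\<in>I. a m *\<^sub>R M m) \<in> skew_matrices"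
  by (induction I rule: infinite_finite_induct) (auto simp: skew_matrices_def transpose_simps)

lemma skew_entry: assumes "M \<in> skew_matrices" shows "M $ i $ j = - M $ j $ i"
proof -
  have "transpose M $ j $ i = (- M) $ j $ i" using assms by (simp only: skew_matrices_def mem_Collect_eq)
  then show ?thesis by (simp add: transpose_def)
qed

section \<open>Symmetries of the curvature on frames and commutators\<close>

context riem
begin

abbreviation "H \<equiv> Hder A g"

definition Om :: "'n \<Rightarrow> 'n \<Rightarrow> ('a, 'n) frame \<Rightarrow> real^'n^'n" where
  "Om i j U = curvature_form A g U (fundamental_field A g i U) (fundamental_field A g j U)"

lemma Om_eq:
  assumes "c \<in> A" "U \<in> FB" "fst U \<in> fst c"
  shows "Om i j U = curv_frame (G c) (axis i 1) (axis j 1) (fcoord c U)"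
  unfolding Om_def fundamental_field_eq[OF assms(2)]
  by (rule curvature_form_eq[OF assms]) (rule dproj_hvec[OF assms(2)])+

lemma gram_inverse:
  assumes "c \<in> A" "U \<in> FB" "fst U \<in> fst c"
  shows "snd (fcoord c U) ** (transpose (snd (fcoord c U)) ** G c (snd c (fst U))) = mat 1"
  using frame_gram[OF assms] matrix_left_right_inverse by auto

lemma Om_skew: assumes "U \<in> FB" shows "Om i j U \<in> skew_matrices" "Om i j U $ a $ b = - Om i j U $ b $ a"
proof -
  obtain c where c: "c \<in> A" "fst U \<in> fst c" using frame_in_chart assms by blast
  interpret L: local_metric "img c" "G c" by (rule local_metric_chart[OF c(1)])
  have x: "snd c (fst U) \<in> img c" using c by auto
  have "transpose (Om i j U) = transpose (snd (fcoord c U)) ** (transpose (L.R (snd c (fst U)) (snd (fcoord c U) *v axis i 1)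
     (snd (fcoord c U) *v axis j 1)) ** G c (snd c (fst U))) ** snd (fcoord c U)"
    unfolding Om_eq[OF c(1) assms c(2)]
    by (simp add: curv_frame_def matrix_transpose_mul L.sym_G[OF x] matrix_mul_assoc)
  also have "\<dots> = - Om i j U"
    unfolding L.curv_skew[OF x] Om_eq[OF c(1) assms c(2)] by (simp add: curv_frame_def matmul_simps matrix_mul_assoc)
  finally have *: "transpose (Om i j U) = - Om i j U" .
  then show "Om i j U \<in> skew_matrices" by (simp add: skew_matrices_def)
  show "Om i j U $ a $ b = - Om i j U $ b $ a"
    using arg_cong[OF *, of "\<lambda>M. M $ b $ a"] by (simp add: transpose_def)
qed

lemma Om_antisym: assumes "U \<in> FB" shows "Om i j U = - Om j i U"
proof -
  obtain c where c: "c \<in> A" "fst U \<in> fst c" using frame_in_chart assms by blast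
  interpret L: local_metric "img c" "G c" by (rule local_metric_chart[OF c(1)])
  show ?thesis unfolding Om_eq[OF c(1) assms c(2)]
    using L.curv_antisym[of "snd c (fst U)" "snd (fcoord c U) *v axis i 1" "snd (fcoord c U) *v axis j 1"]
    by (simp add: curv_frame_def matmul_simps)
qed

lemma Om_bianchi:
  assumes "U \<in> FB"
  shows "Om i j U $ a $ k + Om j k U $ a $ i + Om k i U $ a $ j = 0"
proof -
  obtain c where c: "c \<in> A" "fst U \<in> fst c" using frame_in_chart assms by blast
  interpret L: local_metric "img c" "G c" by (rule local_metric_chart[OF c(1)])
  have x: "snd c (fst U) \<in> img c" using c by auto
  let ?E = "snd (fcoord c U)"
  have "Om i j U *v axis k 1 + Om j k U *v axis i 1 + Om k i U *v axis j 1 =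
     (transpose ?E ** G c (snd c (fst U))) *v
       (L.R (snd c (fst U)) (?E *v axis i 1) (?E *v axis j 1) *v (?E *v axis k 1)
      + L.R (snd c (fst U)) (?E *v axis j 1) (?E *v axis k 1) *v (?E *v axis i 1)
      + L.R (snd c (fst U)) (?E *v axis k 1) (?E *v axis i 1) *v (?E *v axis j 1))"
    unfolding Om_eq[OF c(1) assms c(2)]
    by (simp only: curv_frame_def matvec_simps matrix_vector_mul_assoc matrix_mul_assoc fst_fcoord)
  also have "\<dots> = 0" unfolding L.first_bianchi[OF x] by (simp add: matvec_simps)
  finally have "(Om i j U *v axis k 1 + Om j k U *v axis i 1 + Om k i U *v axis j 1) $ a = 0" by simp
  then show ?thesis by (simp add: matrix_vector_mult_basis column_def)
qed

text \<open>The octahedron argument: four instances of the first Bianchi identity are added up.\<close>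

lemma Om_pair: assumes "U \<in> FB" shows "Om i j U $ k $ l = Om k l U $ i $ j"
proof -
  note a = Om_antisym[OF assms] and s = Om_skew(2)[OF assms] and b = Om_bianchi[OF assms]
  have a': "Om i j U $ k $ l = - Om j i U $ k $ l" for i j k l by (subst a) simp
  have "Om i j U $ k $ l + Om j l U $ k $ i + Om l i U $ k $ j = 0"
    "Om j l U $ i $ k + Om l k U $ i $ j + Om k j U $ i $ l = 0"
    "Om l k U $ j $ i + Om k i U $ j $ l + Om i l U $ j $ k = 0"
    "Om k i U $ l $ j + Om i j U $ l $ k + Om j k U $ l $ i = 0"
    using b by blast+
  moreover have "Om j l U $ i $ k = - Om j l U $ k $ i" "Om i l U $ j $ k = Om l i U $ k $ j"
    "Om k i U $ l $ j = - Om k i U $ j $ l" "Om j k U $ l $ i = Om k j U $ i $ l"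
    "Om l k U $ i $ j = - Om k l U $ i $ j" "Om l k U $ j $ i = Om k l U $ i $ j" "Om i j U $ l $ k = - Om i j U $ k $ l"
    using a'[of i l j k] s[of l i j k] a'[of j k l i] s[of k j l i] a'[of l k i j] a'[of l k j i] s[of k l j i]
      s[of j l i k] s[of k i l j] s[of i j l k] by linarith+
  ultimately show ?thesis by linarith
qed

lemma Om_ricci:
  assumes "U \<in> FB"
  shows "(\<Sum>i\<in>UNIV. Om i a U $ i $ b) = ricci A g (fst U) (snd U (axis a 1)) (snd U (axis b 1))"
proof -
  obtain c where c: "c \<in> A" "fst U \<in> fst c" using frame_in_chart assms by blast
  interpret L: local_metric "img c" "G c" by (rule local_metric_chart[OF c(1)])
  have "(\<Sum>i\<in>UNIV. Om i a U $ i $ b) = (\<Sum>i\<in>UNIV. (curv_frame (G c) (axis i 1) (axis a 1) (fcoord c U) *v axis b 1) $ i)"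
    by (simp add: Om_eq[OF c(1) assms c(2)] matrix_vector_mult_basis column_def)
  also have "\<dots> = loc_ric (G c) (snd c (fst U)) (snd (fcoord c U) *v axis a 1) (snd (fcoord c U) *v axis b 1)"
    using L.loc_ric_frame[of "fcoord c U" "axis a 1" "axis b 1"] frame_gram[OF c(1) assms c(2)] c(2) by simp
  also have "\<dots> = ricci A g (fst U) (snd U (axis a 1)) (snd U (axis b 1))"
    unfolding frame_vec(2)[OF c(1) assms c(2)] ricci_push[OF c] ..
  finally show ?thesis .
qed

lemma rep_Om:
  assumes "c \<in> A"
  shows "rep c (img c \<times> UNIV) (\<lambda>z. curv_frame (G c) (axis i 1) (axis j 1) z $ a $ b) (\<lambda>U. Om i j U $ a $ b)"
proof -
  interpret L: local_metric "img c" "G c" by (rule local_metric_chart[OF assms])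
  show ?thesis unfolding rep_def using assms L.open_W
    by (auto simp: Om_eq intro!: smooth_on_nth L.smooth_curv_frame)
qed

lemma smooth_Om: "smooth (\<lambda>U. Om i j U $ a $ b)"
  by (rule rep_smooth) (use rep_Om fcoord_in in blast)

text \<open>By \<open>fd_curv_frame_hor\<close>, horizontal derivatives of the entries are frame
  components of the covariant derivative, so the coordinate identity passes over with no connection
  terms.\<close>

lemma Om_second_bianchi:
  assumes "U \<in> FB"
  shows "H k (\<lambda>U. Om i j U $ a $ b) U + H i (\<lambda>U. Om j k U $ a $ b) U + H j (\<lambda>U. Om k i U $ a $ b) U = 0"
proof -
  obtain c where c: "c \<in> A" "fst U \<in> fst c" using frame_in_chart assms by blast
  interpret L: local_metric "img c" "G c" by (rule local_metric_chart[OF c(1)])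
  let ?z = "fcoord c U" and ?x = "snd c (fst U)"
  let ?E = "snd ?z"
  have z: "?z \<in> L.W" "?x \<in> img c" using fcoord_in c by auto
  have "H k (\<lambda>U. Om i j U $ a $ b) U =
      (transpose ?E ** G c ?x ** nabla_curv (G c) ?x (?E *v axis k 1) (?E *v axis i 1) (?E *v axis j 1) ** ?E) $ a $ b" for i j k
  proof -
    have "((\<lambda>z. curv_frame (G c) (axis i 1) (axis j 1) z $ a $ b) has_derivative
       (\<lambda>w. fd (curv_frame (G c) (axis i 1) (axis j 1)) ?z w $ a $ b)) (at ?z)"
      by (intro bounded_linear.has_derivative[OF bounded_linear_vec_nth]
          smooth_on_has_derivative[OF L.smooth_curv_frame z(1)])
    from fd_eqI[OF this] show ?thesis
      using rep_value[OF rep_Hder[OF rep_Om[OF c(1)]] assms c(2) z(1)] L.fd_curv_frame_hor[OF z(1)] by simp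
  qed
  then have "H k (\<lambda>U. Om i j U $ a $ b) U + H i (\<lambda>U. Om j k U $ a $ b) U + H j (\<lambda>U. Om k i U $ a $ b) U
    = (transpose ?E ** G c ?x ** (nabla_curv (G c) ?x (?E *v axis k 1) (?E *v axis i 1) (?E *v axis j 1)
     + nabla_curv (G c) ?x (?E *v axis i 1) (?E *v axis j 1) (?E *v axis k 1)
     + nabla_curv (G c) ?x (?E *v axis j 1) (?E *v axis k 1) (?E *v axis i 1)) ** ?E) $ a $ b"
    by (simp add: matmul_simps)
  then show ?thesis unfolding L.second_bianchi[OF z(2)] by (simp add: matmul_simps)
qed

text \<open>The bracket has matrix part - R E. At an orthonormal frame E E^T G = 1, so R E is E
  times \<open>Om i j U\<close>: the vertical field of the curvature matrix, frozen at
  \<open>U\<close>.\<close>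

lemma comm_H_H:
  assumes "smooth F" "U \<in> FB"
  shows "H i (H j F) U - H j (H i F) U = - Vder (Om i j U) F U"
proof -
  obtain c where c: "c \<in> A" "fst U \<in> fst c" using frame_in_chart assms by blast
  interpret L: local_metric "img c" "G c" by (rule local_metric_chart[OF c(1)])
  obtain W h where W: "rep c W h F" "fcoord c U \<in> W" using smooth_rep[OF assms(1) c(1) assms(2) c(2)] by blast
  have W': "open W" "W \<subseteq> L.W" "smooth_on W h" using W(1) by (auto simp: rep_def)
  note v = rep_value[OF _ assms(2) c(2) W(2)]
  let ?z = "fcoord c U"
  let ?E = "snd ?z"
  have l: "linear (fd h ?z)" using has_derivative_linear[OF rep_has_derivative[OF W]] .
  have "ver_field (Om i j U) ?z = (0, (?E ** (transpose ?E ** G c (snd c (fst U)))) **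
       L.R (snd c (fst U)) (?E *v axis i 1) (?E *v axis j 1) ** ?E)"
    by (simp add: ver_field_def Om_eq[OF c(1) assms(2) c(2)] curv_frame_def matrix_mul_assoc)
  then have "ver_field (Om i j U) ?z = - (0, - (L.R (snd c (fst U)) (?E *v axis i 1) (?E *v axis j 1) ** ?E))"
    unfolding gram_inverse[OF c(1) assms(2) c(2)] by simp
  then have "Vder (Om i j U) F U = - fd h ?z (0, - (L.R (snd c (fst U)) (?E *v axis i 1) (?E *v axis j 1) ** ?E))"
    unfolding v[OF rep_Vder[OF W(1) Om_skew(1)[OF assms(2)]]] by (simp only: linear_neg[OF l])
  then show ?thesis
    unfolding v[OF rep_Hder[OF rep_Hder[OF W(1)]]]
    using L.bracket_hor_hor[OF W' W(2), of "axis j 1" "axis i 1"] by simp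
qed

lemma comm_V_H:
  assumes "smooth F" "U \<in> FB" "M \<in> skew_matrices"
  shows "Vder M (H i F) U - H i (Vder M F) U = (\<Sum>k\<in>UNIV. M $ k $ i * H k F U)"
proof -
  obtain c where c: "c \<in> A" "fst U \<in> fst c" using frame_in_chart assms by blast
  interpret L: local_metric "img c" "G c" by (rule local_metric_chart[OF c(1)])
  obtain W h where W: "rep c W h F" "fcoord c U \<in> W" using smooth_rep[OF assms(1) c(1) assms(2) c(2)] by blast
  have W': "open W" "W \<subseteq> L.W" "smooth_on W h" using W(1) by (auto simp: rep_def)
  note v = rep_value[OF _ assms(2) c(2) W(2)]
  let ?z = "fcoord c U"
  have l: "linear (fd h ?z)" using has_derivative_linear[OF rep_has_derivative[OF W]] .
  have lh: "linear (\<lambda>a. hor_field (G c) a ?z)"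
    by (rule linearI) (simp_all add: hor_field_def matvec_simps matmul_simps chr_mat_simps
        linear_scale[OF linear_chr_mat])
  have "fd h ?z (hor_field (G c) (M *v axis i 1) ?z) =
     (\<Sum>k\<in>UNIV. (M *v axis i 1) $ k *\<^sub>R fd h ?z (hor_field (G c) (axis k 1) ?z))"
    by (rule linear_axis_sum[OF linear_compose[OF lh l, unfolded o_def]])
  also have "\<dots> = (\<Sum>k\<in>UNIV. M $ k $ i * H k F U)"
    unfolding v[OF rep_Hder[OF W(1)]] by (simp add: matrix_vector_mult_basis column_def)
  finally show ?thesis
    unfolding v[OF rep_Vder[OF rep_Hder[OF W(1)] assms(3)]] v[OF rep_Hder[OF rep_Vder[OF W(1) assms(3)]]]
    using L.bracket_ver_hor[OF W' W(2), of "axis i 1" M] by simp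
qed

lemma Vder_combination:
  assumes "smooth F" "U \<in> FB" "\<And>m. m \<in> I \<Longrightarrow> M m \<in> skew_matrices"
  shows "Vder (\<Sum>m\<in>I. a m *\<^sub>R M m) F U = (\<Sum>m\<in>I. a m * Vder (M m) F U)"
proof -
  obtain c where c: "c \<in> A" "fst U \<in> fst c" using frame_in_chart assms by blast
  obtain W h where W: "rep c W h F" "fcoord c U \<in> W" using smooth_rep[OF assms(1) c(1) assms(2) c(2)] by blast
  note v = rep_value[OF _ assms(2) c(2) W(2)]
  have l: "linear (fd h (fcoord c U))" using has_derivative_linear[OF rep_has_derivative[OF W]] .
  have lv: "linear (\<lambda>M. ver_field M (fcoord c U))"
    by (rule linearI) (simp_all add: ver_field_def matmul_simps)
  note lc = linear_compose[OF lv l, unfolded o_def]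
  have "Vder (\<Sum>m\<in>I. a m *\<^sub>R M m) F U = fd h (fcoord c U) (ver_field (\<Sum>m\<in>I. a m *\<^sub>R M m) (fcoord c U))"
    by (rule v[OF rep_Vder[OF W(1) skew_combination]]) (rule assms(3))
  also have "\<dots> = (\<Sum>m\<in>I. a m * fd h (fcoord c U) (ver_field (M m) (fcoord c U)))"
    by (simp add: linear_sum[OF lc] linear_scale[OF lc])
  also have "\<dots> = (\<Sum>m\<in>I. a m * Vder (M m) F U)"
    by (intro sum.cong arg_cong2[where f="(*)"] refl v[OF rep_Vder[OF W(1) assms(3)], symmetric])
  finally show ?thesis .
qed

end

section \<open>Bump functions\<close>

text \<open>The factor \<open>1 / s ^ k\<close> makes the family closed under differentiation, up to linear combinations.\<close>

definition flat_fun :: "nat \<Rightarrow> real \<Rightarrow> real" where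
  "flat_fun k s = (if s > 0 then exp (- 1 / s) / s ^ k else 0)"

lemma flat_fun_tendsto: "(flat_fun k \<longlongrightarrow> 0) (at 0)"
proof -
  have "((\<lambda>s::real. inverse s ^ k / exp (inverse s)) \<longlongrightarrow> 0) (at_right 0)"
    by (rule filterlim_compose[OF tendsto_power_div_exp_0 filterlim_inverse_at_top_right])
  moreover have "\<forall>\<^sub>F s in at_right 0. inverse s ^ k / exp (inverse s) = flat_fun k s"
    unfolding eventually_at_right_field
    by (intro exI[of _ 1]) (auto simp: flat_fun_def exp_minus divide_inverse power_inverse mult_ac)
  ultimately have r: "(flat_fun k \<longlongrightarrow> 0) (at_right 0)" by (rule Lim_transform_eventually)
  have "\<forall>\<^sub>F s in at_left 0. 0 = flat_fun k s"
    unfolding eventually_at_left_field by (intro exI[of _ "-1"]) (auto simp: flat_fun_def)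
  then have "(flat_fun k \<longlongrightarrow> 0) (at_left 0)" by (rule Lim_transform_eventually[OF tendsto_const])
  with r show ?thesis by (simp add: filterlim_at_split)
qed

lemma flat_fun_deriv:
  "(flat_fun k has_real_derivative (flat_fun (k + 2) s - real k * flat_fun (k + 1) s)) (at s)"
proof (cases "s = 0")
  case True
  \<comment> \<open>At 0 the difference quotient is the next member of the family, which also tends
    to 0.\<close>
  have "flat_fun k h / h = flat_fun (Suc k) h" if "h \<noteq> 0" for h
    using that by (auto simp: flat_fun_def field_simps)
  then have "((\<lambda>h. flat_fun k h / h) \<longlongrightarrow> 0) (at 0)"
    using flat_fun_tendsto[of "Suc k"] by (rule_tac Lim_transform_eventually) (auto simp: eventually_at_filter)
  then show ?thesis using True by (simp add: DERIV_def flat_fun_def)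
next
  case False
  show ?thesis
  proof (cases "s > 0")
    case True
    have "((\<lambda>s. exp (- 1 / s) / s ^ k) has_real_derivative (flat_fun (k + 2) s - real k * flat_fun (k + 1) s)) (at s)"
    proof -
      have e: "((\<lambda>s. exp (- 1 / s)) has_real_derivative exp (- 1 / s) / s\<^sup>2) (at s)"
        using True by (auto intro!: derivative_eq_intros simp: power2_eq_square)
      have "exp (- 1 / s) / s\<^sup>2 * s ^ k - exp (- 1 / s) * (real k * s ^ (k - Suc 0)) =
         (flat_fun (k + 2) s - real k * flat_fun (k + 1) s) * (s ^ k * s ^ k)"
        using True by (cases k) (auto simp: flat_fun_def field_simps power2_eq_square)
      then have q: "(exp (- 1 / s) / s\<^sup>2 * s ^ k - exp (- 1 / s) * (real k * s ^ (k - Suc 0))) / (s ^ k * s ^ k)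
         = flat_fun (k + 2) s - real k * flat_fun (k + 1) s"
        using True by (simp add: nonzero_divide_eq_eq)
      show ?thesis using DERIV_divide[OF e DERIV_pow[of k s]] True unfolding q by simp
    qed
    then show ?thesis
      by (rule has_field_derivative_transform_within_open[of _ _ _ "{0<..}"]) (use True in \<open>auto simp: flat_fun_def\<close>)
  next
    case neg: False
    have "((\<lambda>s. 0) has_real_derivative (flat_fun (k + 2) s - real k * flat_fun (k + 1) s)) (at s)"
      using neg by (simp add: flat_fun_def)
    then show ?thesis
      by (rule has_field_derivative_transform_within_open[of _ _ _ "{..<0}"]) (use neg False in \<open>auto simp: flat_fun_def\<close>)
  qed
qed

lemma smooth_flat_fun: "smooth_on UNIV (flat_fun k)"
proof -
  have "Ck_on n UNIV (flat_fun k)" for n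
  proof (induction n arbitrary: k)
    case 0
    show ?case using DERIV_isCont[OF flat_fun_deriv] by (simp add: continuous_on_eq_continuous_at)
  next
    case (Suc n)
    have "Ck_on n UNIV (\<lambda>s. (flat_fun (k + 2) s + (- real k) * flat_fun (k + 1) s) * v)" for v
      by (intro Ck_on_bilinear[OF bounded_bilinear_mult] Ck_on_add Ck_on_const Suc open_UNIV)
    then show ?case
      by (rule Ck_on_SucI'[OF open_UNIV, rotated])
        (use flat_fun_deriv in \<open>simp add: has_field_derivative_def\<close>)
  qed
  then show ?thesis by (rule smooth_onI)
qed

lemma bump_function:
  fixes x0 :: "'a::euclidean_space"
  assumes "r > 0"
  obtains \<beta> :: "'a \<Rightarrow> real" where "smooth_on UNIV \<beta>" "\<beta> x0 = 1" "\<And>x. x \<notin> ball x0 r \<Longrightarrow> \<beta> x = 0"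
proof
  \<comment> \<open>The factor \<open>exp 1\<close> normalises the value at the centre, where the
    flat function has argument 1; outside the ball the argument is at most 0.\<close>
  let ?\<beta> = "\<lambda>x. exp 1 * flat_fun 0 (1 - (x - x0) \<bullet> (x - x0) / r\<^sup>2)"
  have q: "smooth_on UNIV (\<lambda>x::'a. 1 - ((x - x0) \<bullet> (x - x0)) * inverse (r\<^sup>2))"
    by (intro smooth_on_diff smooth_on_mult smooth_on_inner smooth_on_const smooth_on_linear bounded_linear_ident open_UNIV)
  have "smooth_on UNIV (\<lambda>x::'a. exp 1 * flat_fun 0 (1 - ((x - x0) \<bullet> (x - x0)) * inverse (r\<^sup>2)))"
    by (intro smooth_on_mult smooth_on_const open_UNIV smooth_on_compose[OF open_UNIV open_UNIV _ q smooth_flat_fun]) auto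
  then show "smooth_on UNIV ?\<beta>" by (simp add: divide_inverse)
  show "?\<beta> x0 = 1" by (simp add: flat_fun_def mult_exp_exp)
  fix x assume "x \<notin> ball x0 r"
  then have "r \<le> norm (x - x0)" by (simp add: dist_norm norm_minus_commute)
  then have "r\<^sup>2 \<le> (x - x0) \<bullet> (x - x0)" using assms by (simp add: power2_norm_eq_inner[symmetric])
  then show "?\<beta> x = 0" using assms by (simp add: flat_fun_def)
qed

section \<open>The Codazzi condition on frames\<close>

context local_metric
begin

lemma assumes "x \<in> S" shows linear_loc_ric_right: "linear (loc_ric G x v)"
  and linear_loc_ric_left: "linear (\<lambda>v. loc_ric G x v w)"
  unfolding loc_ric_def
  by (rule linearI; simp add: linear_add[OF linear_curv_right[OF assms]] linear_scale[OF linear_curv_right[OF assms]]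
      matvec_simps sum.distrib sum_distrib_left)+

lemma smooth_loc_ric: "smooth_on S (\<lambda>x. loc_ric G x v w)"
  unfolding loc_ric_def
  by (intro smooth_on_sum smooth_on_nth smooth_on_matvec smooth_on_const smooth_curv open_S)

text \<open>The covariant derivative of the Ricci tensor as a function of vectors at
  \<open>x\<close>. It is the meeting point of \<open>H_ricci\<close>, on frames, and
  \<open>nabla_tensor_ricci\<close>, for vector fields.\<close>

definition nabla_ric :: "real^'n \<Rightarrow> real^'n \<Rightarrow> real^'n \<Rightarrow> real^'n \<Rightarrow> real" where
  "nabla_ric x a b e = fd (\<lambda>y. loc_ric G y b e) x a - loc_ric G x (cm x a *v b) e - loc_ric G x b (cm x a *v e)"

end

context riem
begin

lemma rep_ricci:
  assumes "c \<in> A"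
  shows "rep c (img c \<times> UNIV) (\<lambda>z. loc_ric (G c) (fst z) (snd z *v axis i 1) (snd z *v axis j 1))
    (\<lambda>U. ricci A g (fst U) (snd U (axis i 1)) (snd U (axis j 1)))"
proof -
  interpret L: local_metric "img c" "G c" by (rule local_metric_chart[OF assms])
  have "smooth_on L.W (\<lambda>z. loc_ric (G c) (fst z) (snd z *v axis i 1) (snd z *v axis j 1))"
    by (intro smooth_on_bilinear_arg[OF L.open_S L.linear_loc_ric_right L.linear_loc_ric_left L.smooth_loc_ric L.open_W]
        smooth_on_fst L.smooth_frame L.open_W) auto
  moreover have "ricci A g (fst U) (snd U (axis i 1)) (snd U (axis j 1)) =
      loc_ric (G c) (snd c (fst U)) (snd (fcoord c U) *v axis i 1) (snd (fcoord c U) *v axis j 1)"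
    if "U \<in> FB" "fst U \<in> fst c" for U
    unfolding frame_vec(2)[OF assms that] ricci_push[OF assms that(2)] ..
  ultimately show ?thesis unfolding rep_def using assms L.open_W by simp
qed

text \<open>As for the curvature: the frame vectors are parallel along horizontal fields, and their
  coordinate derivatives supply the connection terms.\<close>

lemma H_ricci:
  assumes "U \<in> FB" "c \<in> A" "fst U \<in> fst c"
  shows "H k (\<lambda>U. ricci A g (fst U) (snd U (axis i 1)) (snd U (axis j 1))) U =
    local_metric.nabla_ric (G c) (snd c (fst U)) (snd (fcoord c U) *v axis k 1) (snd (fcoord c U) *v axis i 1) (snd (fcoord c U) *v axis j 1)"
proof -
  interpret L: local_metric "img c" "G c" by (rule local_metric_chart[OF assms(2)])
  let ?z = "fcoord c U"
  have S: "fst ?z \<in> img c" using assms by auto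
  have d: "((\<lambda>z. loc_ric (G c) (fst z) (snd z *v axis i 1) (snd z *v axis j 1)) has_derivative
     (\<lambda>w. fd (\<lambda>y. loc_ric (G c) y (snd ?z *v axis i 1) (snd ?z *v axis j 1)) (fst ?z) (fst w)
        + loc_ric (G c) (fst ?z) (snd w *v axis i 1) (snd ?z *v axis j 1)
        + loc_ric (G c) (fst ?z) (snd ?z *v axis i 1) (snd w *v axis j 1))) (at ?z)"
    by (intro has_derivative_bilinear_arg[OF L.open_S L.linear_loc_ric_right L.linear_loc_ric_left L.smooth_loc_ric]
        has_derivative_fst L.has_derivative_frame has_derivative_ident S)
  show ?thesis
    unfolding rep_value[OF rep_Hder[OF rep_ricci[OF assms(2)]] assms(1,3) fcoord_in[OF assms(2,3)]] fd_eqI[OF d]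
    using S by (simp add: hor_field_def L.nabla_ric_def matvec_simps linear_neg[OF L.linear_loc_ric_left]
        linear_neg[OF L.linear_loc_ric_right] matrix_vector_mul_assoc)
qed

text \<open>In contrast to \<open>ricci_push\<close>, the vectors are arbitrary functions on charts.
  This allows \<open>v\<close> to be \<open>nabla A g V Y p\<close>, which is known only through its
  coordinate formula.\<close>

lemma ricci_chart_at:
  assumes "c = chart_at A p" "c \<in> A" "p \<in> fst c"
  shows "ricci A g p v w = loc_ric (G c) (snd c p) (v c) (w c)"
proof -
  interpret L: local_metric "img c" "G c" by (rule local_metric_chart[OF assms(2)])
  show ?thesis using assms(2,3) L.local_riemann_eq[of "snd c p"]
    by (simp add: ricci_def Let_def assms(1)[symmetric] riemann_def coord_tvec_eq loc_ric_def)
qed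

lemma smooth_in_chart_deriv:
  fixes f :: "'a \<Rightarrow> 'b::real_normed_vector"
  assumes "smooth_in_chart c f" "c \<in> A" "p \<in> fst c"
  shows "((\<lambda>x. f (chart_inv c x)) has_derivative fd (\<lambda>x. f (chart_inv c x)) (snd c p)) (at (snd c p))"
proof -
  obtain W h where W: "open W" "snd c p \<in> W" "smooth_on W h" "\<And>q. q \<in> fst c \<Longrightarrow> snd c q \<in> W \<Longrightarrow> f q = h (snd c q)"
    using bspec[OF assms(1)[unfolded smooth_in_chart_def] assms(3)] by metis
  have o: "open (W \<inter> img c)" "snd c p \<in> W \<inter> img c" using W chart_facts(2)[OF assms(2)] assms(3) by auto
  have "((\<lambda>x. f (chart_inv c x)) has_derivative fd h (snd c p)) (at (snd c p))"
    by (rule has_derivative_transform_within_open[OF smooth_on_has_derivative[OF W(3,2)] o]) (use W(4) assms(2) in auto)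
  then show ?thesis using fd_eq by metis
qed

text \<open>The derivatives of the components of \<open>Y\<close> and \<open>Z\<close> in the
  product rule cancel those inside the two covariant derivatives, so only the values of the fields
  at \<open>p\<close> remain.\<close>

lemma nabla_tensor_ricci:
  assumes "vector_field A (\<lambda>c. c) V" "vector_field A (\<lambda>c. c) Y" "vector_field A (\<lambda>c. c) Z"
    and c: "c = chart_at A p" "c \<in> A" "p \<in> fst c"
  shows "nabla_tensor A g (ricci A g) V Y Z p = local_metric.nabla_ric (G c) (snd c p) (V p c) (Y p c) (Z p c)"
proof -
  interpret L: local_metric "img c" "G c" by (rule local_metric_chart[OF c(2)])
  let ?x = "snd c p"
  have S: "?x \<in> img c" using c by auto
  have TM: "V q \<in> TM A q" "Y q \<in> TM A q" "Z q \<in> TM A q" if "q \<in> fst c" for q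
    using assms(1-3) that c(2) unfolding vector_field_def by auto
  define y where "y x = Y (chart_inv c x) c" for x
  define z where "z x = Z (chart_inv c x) c" for x
  have dy: "(y has_derivative fd y ?x) (at ?x)" and dz: "(z has_derivative fd z ?x) (at ?x)"
    unfolding y_def z_def using assms(2,3) c(2,3) by (auto intro!: smooth_in_chart_deriv simp: vector_field_def)
  have yz: "y ?x = Y p c" "z ?x = Z p c" using c by (simp_all add: y_def z_def)
  have d: "((\<lambda>x. loc_ric (G c) x (y x) (z x)) has_derivative
     (\<lambda>w. fd (\<lambda>x. loc_ric (G c) x (y ?x) (z ?x)) ?x w + loc_ric (G c) ?x (fd y ?x w) (z ?x)
        + loc_ric (G c) ?x (y ?x) (fd z ?x w))) (at ?x)"
    by (intro has_derivative_bilinear_arg[OF L.open_S L.linear_loc_ric_right L.linear_loc_ric_left L.smooth_loc_ric]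
        has_derivative_ident dy dz S)
  let ?D = "fd (\<lambda>x. loc_ric (G c) x (y ?x) (z ?x)) ?x (V p c) + loc_ric (G c) ?x (fd y ?x (V p c)) (z ?x)
        + loc_ric (G c) ?x (y ?x) (fd z ?x (V p c))"
  have *: "((\<lambda>t. ricci A g (\<gamma> t) (Y (\<gamma> t)) (Z (\<gamma> t))) has_real_derivative ?D) (at 0)"
    if "has_velocity A (\<lambda>c. c) \<gamma> p (V p)" for \<gamma>
  proof -
    have \<gamma>: "\<gamma> 0 = p" "\<forall>\<^sub>F t in nhds 0. \<gamma> t \<in> fst c" "((\<lambda>t. snd c (\<gamma> t)) has_vector_derivative V p c) (at 0)"
      using that c unfolding has_velocity_def by metis+
    have "((\<lambda>t. loc_ric (G c) (snd c (\<gamma> t)) (y (snd c (\<gamma> t))) (z (snd c (\<gamma> t)))) has_vector_derivative ?D) (at 0)"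
      by (rule has_vector_derivative_chainI[OF \<gamma>(3) d _ refl]) (simp add: \<gamma>(1))
    moreover have "\<forall>\<^sub>F t in nhds 0. loc_ric (G c) (snd c (\<gamma> t)) (y (snd c (\<gamma> t))) (z (snd c (\<gamma> t)))
        = ricci A g (\<gamma> t) (Y (\<gamma> t)) (Z (\<gamma> t))"
      using \<gamma>(2)
    proof eventually_elim
      case (elim t)
      have "ricci A g (\<gamma> t) (push c (\<gamma> t) (Y (\<gamma> t) c)) (push c (\<gamma> t) (Z (\<gamma> t) c)) =
          loc_ric (G c) (snd c (\<gamma> t)) (y (snd c (\<gamma> t))) (z (snd c (\<gamma> t)))"
        unfolding ricci_push[OF c(2) elim] using c(2) elim by (simp add: y_def z_def)
      then show ?case
        unfolding TM_push[OF c(2) elim TM(2)[OF elim], symmetric] TM_push[OF c(2) elim TM(3)[OF elim], symmetric] ..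
    qed
    ultimately show ?thesis
      unfolding has_real_derivative_iff_has_vector_derivative by (rule has_vector_derivative_eventually)
  qed
  obtain \<gamma> where \<gamma>: "has_velocity A (\<lambda>c. c) \<gamma> p (V p)"
    using TM(1)[OF c(3)] unfolding tangent_space_def by blast
  have "deriv_along A (\<lambda>c. c) (\<lambda>q. ricci A g q (Y q) (Z q)) p (V p) = ?D"
    unfolding deriv_along_def by (rule the_equality) (use * DERIV_unique[OF _ *[OF \<gamma>]] \<gamma> in blast)+
  moreover have "nabla A g V W p c = fd (\<lambda>x. W (chart_inv c x) c) ?x (V p c) + L.cm ?x (V p c) *v W p c" for W
    using c(2,3) by (simp add: nabla_def local_nabla_def local_chr_eq)
  ultimately show ?thesis
    unfolding nabla_tensor_def ricci_chart_at[OF c] L.nabla_ric_def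
    by (simp add: yz linear_add[OF L.linear_loc_ric_left[OF S]] linear_add[OF L.linear_loc_ric_right[OF S]]
        flip: y_def z_def)
qed

text \<open>The Codazzi condition speaks of global fields; this is what allows it to be used on
  vectors at one point. A field constant in the chart is cut off by a bump function.\<close>

lemma vector_field_extension:
  assumes c: "c \<in> A" "p \<in> fst c"
  obtains V where "vector_field A (\<lambda>c. c) V" "V p c = v"
proof -
  obtain r where r: "r > 0" "cball (snd c p) r \<subseteq> img c"
    using bspec[OF iffD1[OF open_contains_cball chart_facts(2)[OF c(1)]], of "snd c p"] c(2) by auto
  obtain \<beta> :: "real^'n \<Rightarrow> real" where \<beta>: "smooth_on UNIV \<beta>" "\<beta> (snd c p) = 1" "\<And>x. x \<notin> ball (snd c p) r \<Longrightarrow> \<beta> x = 0"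
    using bump_function[OF r(1), of "snd c p"] by blast
  define V where "V q = (if q \<in> fst c then push c q (\<beta> (snd c q) *\<^sub>R v) else 0)" for q
  \<comment> \<open>The complement of a compact set, closed because the space is Hausdorff.
    \<open>N\<close> is therefore an open set that contains all points outside \<open>fst c\<close>
    and on which the cut-off field vanishes.\<close>
  define N where "N = topspace X - {q \<in> fst c. snd c q \<in> cball (snd c p) r}"
  have N: "openin X N"
  proof -
    let ?U = "{q \<in> fst c. snd c q \<in> cball (snd c p) r}"
    have "snd c ` ?U = cball (snd c p) r" using r(2) by auto
    then have "compactin (top_of_set (img c)) (snd c ` ?U)" using r(2) by (simp add: compactin_subtopology)
    moreover have "?U \<subseteq> topspace (subtopology X (fst c))" using chart_facts(4)[OF c(1)] by auto
    ultimately have "compactin (subtopology X (fst c)) ?U"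
      using homeomorphic_map_compactness[OF chart_facts(3)[OF c(1)]] by blast
    then have "compactin X ?U" by (simp add: compactin_subtopology)
    moreover have "Hausdorff_space X" using riem by (simp add: riemannian_manifold_def smooth_manifold_def)
    ultimately show ?thesis unfolding N_def using compactin_imp_closedin closedin_def by blast
  qed
  have "vector_field A (\<lambda>c. c) V"
    unfolding vector_field_def
  proof (intro conjI ballI)
    fix q assume "q \<in> (\<Union>c\<in>A. fst c)"
    then obtain d where d: "d \<in> A" "q \<in> fst d" by blast
    show "V q \<in> TM A q"
      using push_in_TM[OF c(1)] push_in_TM[OF d, of 0] linear_0[OF linear_push[OF d]] by (simp add: V_def)
  next
    fix d assume d: "d \<in> A"
    show "smooth_in_chart d (\<lambda>q. V q d)"
      unfolding smooth_in_chart_def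
    proof
      fix q assume q: "q \<in> fst d"
      show "\<exists>W h. open W \<and> snd d q \<in> W \<and> smooth_on W h \<and> (\<forall>p\<in>fst d. snd d p \<in> W \<longrightarrow> V p d = h (snd d p))"
      proof (cases "q \<in> fst c")
        case True
        let ?W = "dom2 d c" and ?h = "\<lambda>x. \<beta> (tr d c x) *\<^sub>R (jac (tr c d) (tr d c x) *v v)"
        have o: "open ?W" by (rule open_dom2[OF d c(1)])
        have "smooth_on ?W ?h"
          by (intro smooth_on_scaleR smooth_on_matvec smooth_on_const o
              smooth_on_compose[OF o open_UNIV _ smooth_tr[OF d c(1)] \<beta>(1)]
              smooth_on_compose[OF o open_dom2[OF c(1) d] tr_in[OF d c(1)] smooth_tr[OF d c(1)]
                smooth_on_jac[OF open_dom2[OF c(1) d] smooth_tr[OF c(1) d]]]) auto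
        moreover have "V p' d = ?h (snd d p')" if p': "p' \<in> fst d" "snd d p' \<in> ?W" for p'
        proof -
          have "p' \<in> fst c" using p' chart_inj[OF d] by (auto dest: inj_onD)
          then show ?thesis using p' c(1) d
            by (simp add: V_def push_at matvec_simps)
        qed
        ultimately show ?thesis using o q True by (intro exI[of _ ?W] exI[of _ ?h]) auto
      next
        case False
        let ?W = "snd d ` (fst d \<inter> N)"
        have o: "open ?W" by (rule open_chart_image[OF d N])
        have "V p' d = 0" if p': "p' \<in> fst d" "snd d p' \<in> ?W" for p'
        proof -
          have "p' \<in> N" using p' chart_inj[OF d] by (auto dest: inj_onD)
          then have "p' \<in> fst c \<Longrightarrow> \<beta> (snd c p') = 0" using \<beta>(3)[of "snd c p'"] by (auto simp: N_def)
          then show ?thesis using linear_0[OF linear_push[OF c(1), of p']] by (simp add: V_def)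
        qed
        moreover have "q \<in> N" using q False chart_facts(4)[OF d] by (auto simp: N_def)
        ultimately show ?thesis using o q smooth_on_const[OF o]
          by (intro exI[of _ ?W] exI[of _ "\<lambda>x. 0"]) auto
      qed
    qed
  qed
  moreover have "V p c = v" using c \<beta>(2) by (simp add: V_def)
  ultimately show ?thesis using that by blast
qed

lemma codazzi_nabla_ric:
  assumes "codazzi_tensor A g (ricci A g)" "c = chart_at A p" "c \<in> A" "p \<in> fst c"
  shows "local_metric.nabla_ric (G c) (snd c p) a b e = local_metric.nabla_ric (G c) (snd c p) b a e"
proof -
  obtain V where V: "vector_field A (\<lambda>c. c) V" "V p c = a" using vector_field_extension[OF assms(3,4)] .
  obtain Y where Y: "vector_field A (\<lambda>c. c) Y" "Y p c = b" using vector_field_extension[OF assms(3,4)] .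
  obtain Z where Z: "vector_field A (\<lambda>c. c) Z" "Z p c = e" using vector_field_extension[OF assms(3,4)] .
  have "nabla_tensor A g (ricci A g) V Y Z p = nabla_tensor A g (ricci A g) Y V Z p"
    using assms(1)[unfolded codazzi_tensor_def, rule_format, of V Y Z p] assms(3,4) V Y Z by auto
  then show ?thesis
    using nabla_tensor_ricci[OF V(1) Y(1) Z(1) assms(2-4)] nabla_tensor_ricci[OF Y(1) V(1) Z(1) assms(2-4)] V(2) Y(2) Z(2)
    by simp
qed

text \<open>Pair symmetry moves the summed index into a matrix entry, and the second Bianchi
  identity then moves the derivative from \<open>H i\<close> to \<open>H k\<close> and
  \<open>H l\<close>. The remaining sums over \<open>i\<close> are Ricci traces, whose difference is
  zero by the Codazzi condition.\<close>

lemma divergence_Om: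
  assumes "codazzi_tensor A g (ricci A g)" "U \<in> FB"
  shows "(\<Sum>i\<in>UNIV. H i (\<lambda>U. Om i j U $ k $ l) U) = 0"
proof -
  define ric where "ric i j U = ricci A g (fst U) (snd U (axis i 1)) (snd U (axis j 1))" for i j and U :: "('a, 'n) frame"
  have sm: "smooth (ric i j)" for i j
    unfolding ric_def[abs_def] by (rule rep_smooth) (use rep_ricci fcoord_in in blast)
  obtain d where "d \<in> A" "fst U \<in> fst d" using frame_in_chart assms(2) by blast
  then have c: "chart_at A (fst U) \<in> A" "fst U \<in> fst (chart_at A (fst U))" using chart_at by auto
  have cod: "H k (ric l j) U = H l (ric k j) U"
    unfolding ric_def[abs_def] H_ricci[OF assms(2) c]
    by (rule codazzi_nabla_ric[OF assms(1) refl c])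
  have tr1: "(\<Sum>i\<in>UNIV. H k (\<lambda>U. Om i a U $ i $ j) U) = H k (ric a j) U" for k a
  proof -
    have "(\<Sum>i\<in>UNIV. H k (\<lambda>U. Om i a U $ i $ j) U) = H k (\<lambda>U. \<Sum>i\<in>UNIV. Om i a U $ i $ j) U"
      by (rule derivation_sum[OF derivation_Hder assms(2) smooth_Om, symmetric])
    also have "\<dots> = H k (ric a j) U"
      by (rule derivation_cong[OF derivation_Hder smooth_sum[OF smooth_Om] _ assms(2)]) (simp add: Om_ricci ric_def)
    finally show ?thesis .
  qed
  have neg: "H k (\<lambda>U. Om l i U $ i $ j) U = - H k (\<lambda>U. Om i l U $ i $ j) U" for i
  proof -
    have "H k (\<lambda>U. Om l i U $ i $ j) U = H k (\<lambda>U. (-1) * (Om i l U $ i $ j)) U"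
      by (rule derivation_cong[OF derivation_Hder smooth_Om _ assms(2)]) (metis Om_antisym mult_minus1 vector_uminus_component)
    also have "\<dots> = (-1) * H k (\<lambda>U. Om i l U $ i $ j) U"
      by (rule derivation_cmult[OF derivation_Hder smooth_Om assms(2)])
    finally show ?thesis by simp
  qed
  have "H i (\<lambda>U. Om i j U $ k $ l) U = H i (\<lambda>U. Om k l U $ i $ j) U" for i
    by (rule derivation_cong[OF derivation_Hder smooth_Om _ assms(2)]) (rule Om_pair)
  then have "(\<Sum>i\<in>UNIV. H i (\<lambda>U. Om i j U $ k $ l) U) =
     (\<Sum>i\<in>UNIV. - H k (\<lambda>U. Om l i U $ i $ j) U - H l (\<lambda>U. Om i k U $ i $ j) U)"
    using Om_second_bianchi[OF assms(2)] by (intro sum.cong) (auto simp: algebra_simps eq_neg_iff_add_eq_0)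
  also have "\<dots> = H k (ric l j) U - H l (ric k j) U"
    by (simp add: neg sum_subtractf tr1)
  finally show ?thesis by (simp add: cod)
qed

end

section \<open>Orthonormal bases of the skew matrices\<close>

text \<open>The entries are halved so that a skew matrix is the sum of its entries times these units
  over all ordered pairs: each unordered pair is counted twice, and diagonal pairs give 0.\<close>

definition skew_unit :: "'n \<times> 'n \<Rightarrow> real^'n::finite^'n" where
  "skew_unit q = (\<chi> i j. (if q = (i, j) then 1/2 else 0) - (if q = (j, i) then 1/2 else 0))"

lemma skew_unit_entry:
  "skew_unit q $ i $ j = (if q = (i, j) then 1/2 else 0) - (if q = (j, i) then 1/2 else 0)"
  by (simp add: skew_unit_def)

lemma skew_unit_skew: "skew_unit q \<in> skew_matrices"
  unfolding skew_matrices_def mem_Collect_eq vec_eq_iff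
  by (simp only: transpose_def vec_lambda_beta vector_uminus_component skew_unit_entry minus_diff_eq) simp

locale skew_basis =
  fixes ip :: "real^'n::finite^'n \<Rightarrow> real^'n^'n \<Rightarrow> real" and B :: "(real^'n^'n) set"
  assumes ip: "inner_product_on skew_matrices ip"
    and basis: "orthonormal_basis_of skew_matrices ip B"
begin

lemma B_facts: "finite B" "m \<in> B \<Longrightarrow> m \<in> skew_matrices" "span B = skew_matrices"
  "m \<in> B \<Longrightarrow> m' \<in> B \<Longrightarrow> ip m m' = (if m = m' then 1 else 0)"
  using basis unfolding orthonormal_basis_of_def by auto

lemma zero_skew: "(0 :: real^'n^'n) \<in> skew_matrices"
  by (simp add: skew_matrices_def transpose_simps)

lemma ip_sum:
  assumes "\<And>i. i \<in> I \<Longrightarrow> M i \<in> skew_matrices" "N \<in> skew_matrices"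
  shows "ip (\<Sum>i\<in>I. a i *\<^sub>R M i) N = (\<Sum>i\<in>I. a i * ip (M i) N)"
  using assms(1)
proof (induction I rule: infinite_finite_induct)
  case (insert i I)
  have "a i *\<^sub>R M i \<in> skew_matrices" "(\<Sum>i\<in>I. a i *\<^sub>R M i) \<in> skew_matrices"
    using insert.prems skew_combination[of "{i}" M a] skew_combination[of I M a] by auto
  then show ?case
    using insert inner_product_onD(2,3)[OF ip] assms(2) by simp
qed (use inner_product_onD(3)[OF ip zero_skew assms(2), of 0] in simp_all)

lemma basis_expansion: assumes "N \<in> skew_matrices" shows "N = (\<Sum>m\<in>B. ip N m *\<^sub>R m)"
proof -
  obtain a where a: "N = (\<Sum>m\<in>B. a m *\<^sub>R m)"
    using assms B_facts(1,3) span_finite[of B] by auto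
  have "ip N m = a m" if "m \<in> B" for m
  proof -
    have "ip N m = (\<Sum>m'\<in>B. a m' * ip m' m)" unfolding a using B_facts(2) that by (intro ip_sum) auto
    also have "\<dots> = (\<Sum>m'\<in>B. if m' = m then a m' else 0)" using B_facts(4) that by (intro sum.cong) auto
    finally show ?thesis using that B_facts(1) by simp
  qed
  then have "(\<Sum>m\<in>B. ip N m *\<^sub>R m) = (\<Sum>m\<in>B. a m *\<^sub>R m)" by (intro sum.cong) auto
  then show ?thesis using a by metis
qed

lemma ip_parseval:
  assumes "N \<in> skew_matrices" "N' \<in> skew_matrices" shows "ip N N' = (\<Sum>m\<in>B. ip N m * ip N' m)"
proof -
  have "ip N N' = ip (\<Sum>m\<in>B. ip N m *\<^sub>R m) N'" using basis_expansion[OF assms(1)] by metis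
  also have "\<dots> = (\<Sum>m\<in>B. ip N m * ip m N')" by (intro ip_sum assms(2) B_facts(2))
  also have "\<dots> = (\<Sum>m\<in>B. ip N m * ip N' m)"
    by (intro sum.cong refl arg_cong2[where f="(*)"] inner_product_onD(1)[OF ip] B_facts(2) assms(2))
  finally show ?thesis .
qed

lemma ip_combination:
  assumes "m \<in> B" shows "ip (\<Sum>m\<in>B. a m *\<^sub>R m) m = a m"
proof -
  have "ip (\<Sum>m\<in>B. a m *\<^sub>R m) m = (\<Sum>m'\<in>B. a m' * ip m' m)" using B_facts(2) assms by (intro ip_sum) auto
  also have "\<dots> = (\<Sum>m'\<in>B. if m' = m then a m' else 0)" using B_facts(4) assms by (intro sum.cong) auto
  finally show ?thesis using assms B_facts(1) by simp
qed

text \<open>The coefficients are constants, so smoothness and the vanishing divergence pass from the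
  entries of the curvature to its components in \<open>B\<close>.\<close>

lemma ip_entries:
  assumes N: "N \<in> skew_matrices" and m: "m \<in> B"
  shows "ip N m = (\<Sum>q\<in>UNIV. ip (skew_unit q) m * N $ fst q $ snd q)"
proof -
  have *: "N $ i $ j = (\<Sum>q\<in>UNIV. N $ fst q $ snd q *\<^sub>R skew_unit q) $ i $ j" for i j
  proof -
    have e: "(\<Sum>q\<in>UNIV. N $ fst q $ snd q * (if q = p then 1/2 else 0)) = N $ fst p $ snd p / 2" for p
      by (simp add: if_distrib[of "\<lambda>x. _ * x"] cong: if_cong)
    have "(\<Sum>q\<in>UNIV. N $ fst q $ snd q *\<^sub>R skew_unit q) $ i $ j =
       (\<Sum>q\<in>UNIV. N $ fst q $ snd q * (if q = (i, j) then 1/2 else 0))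
       - (\<Sum>q\<in>UNIV. N $ fst q $ snd q * (if q = (j, i) then 1/2 else 0))"
      by (simp only: sum_component vector_scaleR_component real_scaleR_def skew_unit_entry right_diff_distrib sum_subtractf)
    also have "\<dots> = N $ i $ j" unfolding e using skew_entry[OF N, of j i] by simp
    finally show ?thesis by (rule sym)
  qed
  have "N = (\<Sum>q\<in>UNIV. N $ fst q $ snd q *\<^sub>R skew_unit q)"
    unfolding vec_eq_iff by (intro allI) (rule *)
  then have "ip N m = ip (\<Sum>q\<in>UNIV. N $ fst q $ snd q *\<^sub>R skew_unit q) m"
    by (rule arg_cong[where f="\<lambda>x. ip x m"])
  also have "\<dots> = (\<Sum>q\<in>UNIV. N $ fst q $ snd q * ip (skew_unit q) m)"
    by (intro ip_sum skew_unit_skew B_facts(2) m)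
  finally show ?thesis by (simp only: mult.commute)
qed

end

section \<open>Bochner formulas\<close>

context riem
begin

abbreviation "L \<equiv> horizontal_bochner A g"

lemma L_eq: "L F = (\<lambda>U. \<Sum>i\<in>UNIV. H i (H i F) U)"
  by (simp add: horizontal_bochner_def fun_eq_iff)

lemma smooth_H: "smooth F \<Longrightarrow> smooth (H i F)"
  by (rule derivation_smooth[OF derivation_Hder])

lemma smooth_L: "smooth F \<Longrightarrow> smooth (L F)"
  unfolding L_eq by (intro smooth_sum smooth_H)

lemmas H_cong = derivation_cong[OF derivation_Hder]

lemma L_cong:
  assumes "smooth F" "\<And>U. U \<in> FB \<Longrightarrow> F U = F' U" "U \<in> FB" shows "L F U = L F' U"
  unfolding L_eq by (intro sum.cong refl H_cong smooth_H assms)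

lemma H_H_mult:
  assumes "smooth F" "smooth F'" "U \<in> FB"
  shows "H i (H i (\<lambda>U. F U * F' U)) U = F U * H i (H i F') U + 2 * (H i F U * H i F' U) + H i (H i F) U * F' U"
proof -
  note D = derivation_Hder[of i]
  have "H i (H i (\<lambda>U. F U * F' U)) U = H i (\<lambda>U. F U * H i F' U + H i F U * F' U) U"
    by (rule H_cong) (use assms smooth_mult smooth_H derivation_mult[OF D] in auto)
  also have "\<dots> = (F U * H i (H i F') U + H i F U * H i F' U) + (H i F U * H i F' U + H i (H i F) U * F' U)"
    using assms by (simp add: derivation_add[OF D] derivation_mult[OF D] smooth_mult smooth_H)
  finally show ?thesis by simp
qed

lemma L_mult:
  assumes "smooth F" "smooth F'" "U \<in> FB"
  shows "L (\<lambda>U. F U * F' U) U = F U * L F' U + F' U * L F U + 2 * (\<Sum>i\<in>UNIV. H i F U * H i F' U)"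
  unfolding L_eq H_H_mult[OF assms]
  by (simp add: sum.distrib sum_distrib_left mult.commute[of _ "F' U"])

lemma L_sum:
  assumes "\<And>m. m \<in> I \<Longrightarrow> smooth (F m)" "U \<in> FB" shows "L (\<lambda>U. \<Sum>m\<in>I. F m U) U = (\<Sum>m\<in>I. L (F m) U)"
proof -
  have "H i (H i (\<lambda>U. \<Sum>m\<in>I. F m U)) U = (\<Sum>m\<in>I. H i (H i (F m)) U)" for i
  proof -
    have "H i (H i (\<lambda>U. \<Sum>m\<in>I. F m U)) U = H i (\<lambda>U. \<Sum>m\<in>I. H i (F m) U) U"
      by (intro H_cong smooth_H smooth_sum assms derivation_sum[OF derivation_Hder])
    then show ?thesis using assms by (simp add: derivation_sum[OF derivation_Hder] smooth_H)
  qed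
  then show ?thesis unfolding L_eq by (simp add: sum.swap[of _ _ I])
qed

lemma Gamma_eq:
  assumes "smooth F" "smooth F'" "U \<in> FB" shows "Gamma A g F F' U = (\<Sum>i\<in>UNIV. H i F U * H i F' U)"
  unfolding Gamma_def carre_du_champ_def L_mult[OF assms] by simp

text \<open>The Leibniz rule for \<open>L\<close> on each square gives the gradient squares, and the
  remaining terms form the commutators of \<open>L\<close> with \<open>D m\<close>. Both
  \<open>Gamma2\<close> and \<open>GammaZ2\<close> are instances.\<close>

lemma iterated_form_eq:
  assumes Q: "\<And>F F' U. smooth F \<Longrightarrow> smooth F' \<Longrightarrow> U \<in> FB \<Longrightarrow> Q F F' U = (\<Sum>m\<in>I. D m F U * D m F' U)"
    and D: "\<And>m. m \<in> I \<Longrightarrow> derivation (D m)" and F: "smooth F" and U: "U \<in> FB"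
  shows "iterated_form L Q F U = (\<Sum>m\<in>I. \<Sum>i\<in>UNIV. (H i (D m F) U)\<^sup>2)
    + (\<Sum>m\<in>I. D m F U * (L (D m F) U - D m (L F) U))"
proof -
  have sm: "smooth (D m F)" if "m \<in> I" for m using derivation_smooth[OF D[OF that] F] .
  \<comment> \<open>\<open>Q\<close> is known as a sum of products on frames only, so the
    substitution under \<open>L\<close> goes through \<open>L_cong\<close>.\<close>
  have "L (Q F F) U = L (\<lambda>U. \<Sum>m\<in>I. D m F U * D m F U) U"
    by (rule L_cong[symmetric]) (use sm Q F U in \<open>auto intro!: smooth_sum smooth_mult\<close>)
  also have "\<dots> = (\<Sum>m\<in>I. L (\<lambda>U. D m F U * D m F U) U)"
    by (intro L_sum smooth_mult sm U)
  also have "\<dots> = (\<Sum>m\<in>I. 2 * (D m F U * L (D m F) U) + 2 * (\<Sum>i\<in>UNIV. (H i (D m F) U)\<^sup>2))"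
    by (intro sum.cong refl) (simp add: L_mult sm U power2_eq_square)
  finally show ?thesis
    unfolding iterated_form_def Q[OF F smooth_L[OF F] U]
    by (simp add: sum.distrib sum_subtractf sum_distrib_left algebra_simps)
qed

text \<open>Commuting \<open>Vder M\<close> past both factors of \<open>H i (H i F)\<close> leaves
  the entries of \<open>M\<close> contracted with the symmetrised second derivatives; a skew matrix
  against a symmetric one gives 0.\<close>

lemma L_Vder:
  assumes "M \<in> skew_matrices" "smooth F" "U \<in> FB" shows "L (Vder M F) U = Vder M (L F) U"
proof -
  note V = derivation_Vder[OF assms(1)]
  have sV: "smooth (Vder M F')" if "smooth F'" for F' using derivation_smooth[OF V that] .
  have *: "Vder M (H i (H i F)) U = H i (H i (Vder M F)) U + (\<Sum>k\<in>UNIV. M $ k $ i * (H i (H k F) U + H k (H i F) U))" for i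
  proof -
    have "H i (Vder M (H i F)) U = H i (\<lambda>U. H i (Vder M F) U + (\<Sum>k\<in>UNIV. M $ k $ i * H k F U)) U"
      by (rule H_cong) (use comm_V_H[OF assms(2) _ assms(1), of _ i] sV smooth_H assms in \<open>auto simp: algebra_simps\<close>)
    also have "\<dots> = H i (H i (Vder M F)) U + (\<Sum>k\<in>UNIV. M $ k $ i * H i (H k F) U)"
      using assms by (simp add: derivation_add[OF derivation_Hder] derivation_sum[OF derivation_Hder]
        derivation_cmult[OF derivation_Hder] smooth_H sV smooth_sum smooth_mult smooth_const)
    finally show ?thesis
      using comm_V_H[OF smooth_H[OF assms(2)] assms(3,1), of i i] by (simp add: distrib_left sum.distrib)
  qed
  note anti = skew_entry[OF assms(1)]
  have "(\<Sum>i\<in>UNIV. \<Sum>k\<in>UNIV. M $ k $ i * (H i (H k F) U + H k (H i F) U)) =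
     (\<Sum>i\<in>UNIV. \<Sum>k\<in>UNIV. M $ i $ k * (H i (H k F) U + H k (H i F) U))"
    by (subst sum.swap) (simp add: add.commute)
  also have "\<dots> = - (\<Sum>i\<in>UNIV. \<Sum>k\<in>UNIV. M $ k $ i * (H i (H k F) U + H k (H i F) U))"
    unfolding sum_negf[symmetric] by (intro sum.cong refl) (subst anti, simp)
  finally have z: "(\<Sum>i\<in>UNIV. \<Sum>k\<in>UNIV. M $ k $ i * (H i (H k F) U + H k (H i F) U)) = 0" by simp
  have "Vder M (L F) U = (\<Sum>i\<in>UNIV. Vder M (H i (H i F)) U)"
    unfolding L_eq by (intro derivation_sum[OF V assms(3)] smooth_H assms)
  also have "\<dots> = L (Vder M F) U" unfolding * sum.distrib z L_eq by simp
  finally show ?thesis ..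
qed

end

section \<open>The commutator of L with the horizontal derivatives\<close>

locale bochner = riem X A g + skew_basis ip B
  for X :: "'a topology" and A :: "('a, 'n::finite) mchart set" and g :: "('a, 'n) metric"
    and ip :: "real^'n^'n \<Rightarrow> real^'n^'n \<Rightarrow> real" and B :: "(real^'n^'n) set" +
  assumes codazzi: "codazzi_tensor A g (ricci A g)"
begin

definition om :: "real^'n^'n \<Rightarrow> 'n \<Rightarrow> 'n \<Rightarrow> ('a, 'n) frame \<Rightarrow> real" where
  "om m i j U = ip (Om i j U) m"

lemma smooth_V: "m \<in> B \<Longrightarrow> smooth F \<Longrightarrow> smooth (Vder m F)"
  using derivation_smooth[OF derivation_Vder[OF B_facts(2)]] .

lemma smooth_om: assumes "m \<in> B" shows "smooth (om m i j)"
proof -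
  note l = ip_entries[OF Om_skew(1) assms]
  have "smooth (\<lambda>U. \<Sum>q\<in>UNIV. ip (skew_unit q) m * Om i j U $ fst q $ snd q)"
    by (intro smooth_sum smooth_mult smooth_const smooth_Om)
  then show ?thesis by (rule smooth_cong) (simp add: om_def l)
qed

lemma divergence_om:
  assumes "m \<in> B" "U \<in> FB" shows "(\<Sum>i\<in>UNIV. H i (om m i j) U) = 0"
proof -
  note l = ip_entries[OF Om_skew(1) assms(1)]
  have "H i (om m i j) U = (\<Sum>q\<in>UNIV. ip (skew_unit q) m * H i (\<lambda>U. Om i j U $ fst q $ snd q) U)" for i
  proof -
    have "H i (om m i j) U = H i (\<lambda>U. \<Sum>q\<in>UNIV. ip (skew_unit q) m * Om i j U $ fst q $ snd q) U"
      by (rule H_cong[OF smooth_om[OF assms(1)] _ assms(2)]) (simp add: om_def l)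
    also have "\<dots> = (\<Sum>q\<in>UNIV. H i (\<lambda>U. ip (skew_unit q) m * Om i j U $ fst q $ snd q) U)"
      by (intro derivation_sum[OF derivation_Hder assms(2)] smooth_mult smooth_const smooth_Om)
    finally show ?thesis by (simp add: derivation_cmult[OF derivation_Hder smooth_Om assms(2)])
  qed
  then have "(\<Sum>i\<in>UNIV. H i (om m i j) U) = (\<Sum>q\<in>UNIV. \<Sum>i\<in>UNIV. ip (skew_unit q) m * H i (\<lambda>U. Om i j U $ fst q $ snd q) U)"
    by (simp add: sum.swap[of _ "UNIV :: ('n \<times> 'n) set"])
  also have "\<dots> = 0"
    unfolding sum_distrib_left[symmetric] divergence_Om[OF codazzi assms(2)] by simp
  finally show ?thesis .
qed

text \<open>In \<open>comm_H_H\<close> the vertical direction depends on the frame. Expanding it in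
  \<open>B\<close> moves that dependence into the scalar coefficients \<open>om\<close>, so that the
  identity can be differentiated once more.\<close>

lemma comm_H_H_basis:
  assumes "smooth F" "U \<in> FB"
  shows "H i (H j F) U = H j (H i F) U - (\<Sum>m\<in>B. om m i j U * Vder m F U)"
proof -
  have "Vder (Om i j U) F U = Vder (\<Sum>m\<in>B. om m i j U *\<^sub>R m) F U"
    unfolding om_def by (rule arg_cong[where f="\<lambda>M. Vder M F U"]) (rule basis_expansion[OF Om_skew(1)[OF assms(2)]])
  also have "\<dots> = (\<Sum>m\<in>B. om m i j U * Vder m F U)"
    by (rule Vder_combination[where M="\<lambda>m. m", OF assms B_facts(2)])
  finally show ?thesis using comm_H_H[OF assms, of i j] by simp
qed

text \<open>The divergence-free curvature kills the only term containing derivatives of the curvature.\<close>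

lemma L_Hder:
  assumes "smooth F" "U \<in> FB"
  shows "L (H j F) U - H j (L F) U = - 2 * (\<Sum>i\<in>UNIV. \<Sum>m\<in>B. om m i j U * H i (Vder m F) U)
     + (\<Sum>k\<in>UNIV. ricci A g (fst U) (snd U (axis j 1)) (snd U (axis k 1)) * H k F U)"
proof -
  note D = derivation_Hder
  \<comment> \<open>\<open>H j\<close> is moved left past two copies of \<open>H i\<close>. Each
    passage yields a term \<open>om m i j U * H i (Vder m F) U\<close>, whence the 2; the first
    passage also differentiates \<open>om\<close>, and the second has to commute
    \<open>Vder m\<close> with \<open>H i\<close>.\<close>
  have *: "H i (H i (H j F)) U = H j (H i (H i F)) U - (\<Sum>m\<in>B. 2 * (om m i j U * H i (Vder m F) U)
      + om m i j U * (\<Sum>k\<in>UNIV. m $ k $ i * H k F U) + H i (om m i j) U * Vder m F U)" for i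
  proof -
    have "H i (H i (H j F)) U = H i (\<lambda>U. H j (H i F) U + (-1) * (\<Sum>m\<in>B. om m i j U * Vder m F U)) U"
    proof (rule H_cong[OF smooth_H[OF smooth_H[OF assms(1)]] _ assms(2)])
      show "H i (H j F) V = H j (H i F) V + (-1) * (\<Sum>m\<in>B. om m i j V * Vder m F V)" if "V \<in> FB" for V
        unfolding mult_minus1 add_uminus_conv_diff by (rule comm_H_H_basis[OF assms(1) that])
    qed
    also have "\<dots> = H i (H j (H i F)) U - (\<Sum>m\<in>B. H i (\<lambda>U. om m i j U * Vder m F U) U)"
    proof -
      have s: "smooth (\<lambda>U. om m i j U * Vder m F U)" if "m \<in> B" for m
        by (intro smooth_mult smooth_om smooth_V assms that)
      show ?thesis
        by (simp only: derivation_add[OF D smooth_H[OF smooth_H[OF assms(1)]] smooth_mult[OF smooth_const smooth_sum[OF s]] assms(2)]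
            derivation_cmult[OF D smooth_sum[OF s] assms(2)] derivation_sum[OF D assms(2) s])
    qed
    also have "(\<Sum>m\<in>B. H i (\<lambda>U. om m i j U * Vder m F U) U) =
        (\<Sum>m\<in>B. om m i j U * H i (Vder m F) U + H i (om m i j) U * Vder m F U)"
      by (intro sum.cong refl derivation_mult[OF D] smooth_om smooth_V assms)
    also have "H i (H j (H i F)) U = H j (H i (H i F)) U - (\<Sum>m\<in>B. om m i j U * Vder m (H i F) U)"
      by (rule comm_H_H_basis[OF smooth_H[OF assms(1)] assms(2)])
    also have "(\<Sum>m\<in>B. om m i j U * Vder m (H i F) U) =
        (\<Sum>m\<in>B. om m i j U * (H i (Vder m F) U + (\<Sum>k\<in>UNIV. m $ k $ i * H k F U)))"
      using comm_V_H[OF assms B_facts(2), of _ i] by (intro sum.cong refl) (simp add: algebra_simps)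
    finally show ?thesis by (simp add: sum.distrib algebra_simps flip: sum_distrib_left)
  qed
  \<comment> \<open>Summation over \<open>B\<close> reassembles the curvature matrix from its
    components; its skewness gives the sign, and the sum over \<open>i\<close> is the Ricci
    trace.\<close>
  have r: "(\<Sum>i\<in>UNIV. \<Sum>m\<in>B. om m i j U * (\<Sum>k\<in>UNIV. m $ k $ i * H k F U)) =
     - (\<Sum>k\<in>UNIV. ricci A g (fst U) (snd U (axis j 1)) (snd U (axis k 1)) * H k F U)"
  proof -
    have "(\<Sum>m\<in>B. om m i j U * (\<Sum>k\<in>UNIV. m $ k $ i * H k F U)) = (\<Sum>k\<in>UNIV. - (Om i j U $ i $ k) * H k F U)" for i
    proof -
      have e: "Om i j U $ k $ i = (\<Sum>m\<in>B. om m i j U * m $ k $ i)" for k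
      proof -
        have "Om i j U $ k $ i = (\<Sum>m\<in>B. om m i j U *\<^sub>R m) $ k $ i"
          unfolding om_def by (rule arg_cong[where f="\<lambda>M. M $ k $ i"]) (rule basis_expansion[OF Om_skew(1)[OF assms(2)]])
        then show ?thesis by simp
      qed
      have "(\<Sum>m\<in>B. om m i j U * (\<Sum>k\<in>UNIV. m $ k $ i * H k F U)) = (\<Sum>k\<in>UNIV. Om i j U $ k $ i * H k F U)"
        unfolding e sum_distrib_left sum_distrib_right by (subst sum.swap) (simp add: mult.assoc)
      also have "\<dots> = (\<Sum>k\<in>UNIV. - (Om i j U $ i $ k) * H k F U)"
        by (intro sum.cong refl arg_cong2[where f="(*)"] Om_skew(2)[OF assms(2)])
      finally show ?thesis .
    qed
    then have "(\<Sum>i\<in>UNIV. \<Sum>m\<in>B. om m i j U * (\<Sum>k\<in>UNIV. m $ k $ i * H k F U)) =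
       (\<Sum>k\<in>UNIV. \<Sum>i\<in>UNIV. - (Om i j U $ i $ k) * H k F U)"
      by (subst sum.swap) simp
    then show ?thesis by (simp add: sum_negf sum_distrib_right[symmetric] Om_ricci[OF assms(2)])
  qed
  have d: "(\<Sum>i\<in>UNIV. \<Sum>m\<in>B. H i (om m i j) U * Vder m F U) = 0"
    by (subst sum.swap) (simp add: sum_distrib_right[symmetric] divergence_om assms(2))
  have "H j (L F) U = (\<Sum>i\<in>UNIV. H j (H i (H i F)) U)"
    unfolding L_eq by (intro derivation_sum[OF D assms(2)] smooth_H assms)
  then have "L (H j F) U - H j (L F) U = - (\<Sum>i\<in>UNIV. \<Sum>m\<in>B. 2 * (om m i j U * H i (Vder m F) U)
      + om m i j U * (\<Sum>k\<in>UNIV. m $ k $ i * H k F U) + H i (om m i j) U * Vder m F U)"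
    unfolding L_eq * by (simp add: sum_subtractf)
  also have "\<dots> = - (2 * (\<Sum>i\<in>UNIV. \<Sum>m\<in>B. om m i j U * H i (Vder m F) U)
     + (\<Sum>i\<in>UNIV. \<Sum>m\<in>B. om m i j U * (\<Sum>k\<in>UNIV. m $ k $ i * H k F U))
     + (\<Sum>i\<in>UNIV. \<Sum>m\<in>B. H i (om m i j) U * Vder m F U))"
    by (simp only: sum.distrib sum_distrib_left)
  finally show ?thesis unfolding r d by simp
qed

end

section \<open>The curvature-dimension inequality\<close>

text \<open>The square sum is that of the symmetric plus that of the antisymmetric part, each with
  weight 1/4 in terms of \<open>x i j + x j i\<close> and \<open>x i j - x j i\<close>. Of the
  symmetric part only the diagonal is kept, and Cauchy-Schwarz bounds the trace.\<close>

lemma sum_squares_symmetric_split: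
  fixes x :: "'n::finite \<Rightarrow> 'n \<Rightarrow> real"
  shows "1 / real CARD('n) * (\<Sum>i\<in>UNIV. x i i)\<^sup>2 + 1/4 * (\<Sum>i\<in>UNIV. \<Sum>j\<in>UNIV. (x i j - x j i)\<^sup>2)
    \<le> (\<Sum>i\<in>UNIV. \<Sum>j\<in>UNIV. (x i j)\<^sup>2)"
proof -
  let ?s = "\<Sum>i\<in>UNIV. \<Sum>j\<in>UNIV. (1/4) * (x i j + x j i)\<^sup>2"
  have "(\<Sum>i\<in>UNIV. \<Sum>j\<in>UNIV. (x j i)\<^sup>2) = (\<Sum>i\<in>UNIV. \<Sum>j\<in>UNIV. (x i j)\<^sup>2)" by (rule sum.swap)
  moreover have "?s + (\<Sum>i\<in>UNIV. \<Sum>j\<in>UNIV. (1/4) * (x i j - x j i)\<^sup>2)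
      = (\<Sum>i\<in>UNIV. \<Sum>j\<in>UNIV. (1/2) * (x i j)\<^sup>2 + (1/2) * (x j i)\<^sup>2)"
    unfolding sum.distrib[symmetric] by (intro sum.cong refl) (simp add: power2_eq_square algebra_simps)
  ultimately have split: "?s + 1/4 * (\<Sum>i\<in>UNIV. \<Sum>j\<in>UNIV. (x i j - x j i)\<^sup>2) = (\<Sum>i\<in>UNIV. \<Sum>j\<in>UNIV. (x i j)\<^sup>2)"
    by (simp only: sum.distrib sum_distrib_left[symmetric])
  have "(\<Sum>i\<in>UNIV. (x i i)\<^sup>2) \<le> ?s"
  proof (rule sum_mono)
    fix i
    have "(1/4) * (x i i + x i i)\<^sup>2 \<le> (\<Sum>j\<in>UNIV. (1/4) * (x i j + x j i)\<^sup>2)"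
      by (rule member_le_sum[of i UNIV "\<lambda>j. (1/4) * (x i j + x j i)\<^sup>2"]) auto
    moreover have "(1/4) * (x i i + x i i)\<^sup>2 = (x i i)\<^sup>2" by (simp add: power2_eq_square)
    ultimately show "(x i i)\<^sup>2 \<le> (\<Sum>j\<in>UNIV. (1/4) * (x i j + x j i)\<^sup>2)" by (simp only:)
  qed
  moreover have "1 / real CARD('n) * (\<Sum>i\<in>UNIV. x i i)\<^sup>2 \<le> (\<Sum>i\<in>UNIV. (x i i)\<^sup>2)"
    using sum_squared_le_sum_of_squares[of "\<lambda>i. x i i" UNIV] by (simp add: field_simps)
  ultimately show ?thesis using split by linarith
qed

context bochner
begin

lemma Gamma2_eq:
  assumes "smooth F" "U \<in> FB"
  shows "Gamma2 A g F U = (\<Sum>i\<in>UNIV. \<Sum>j\<in>UNIV. (H i (H j F) U)\<^sup>2)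
     + (\<Sum>j\<in>UNIV. H j F U * (L (H j F) U - H j (L F) U))"
proof -
  have "Gamma2 A g F U = (\<Sum>j\<in>UNIV. \<Sum>i\<in>UNIV. (H i (H j F) U)\<^sup>2)
     + (\<Sum>j\<in>UNIV. H j F U * (L (H j F) U - H j (L F) U))"
    unfolding Gamma2_def by (rule iterated_form_eq[where D=H, OF Gamma_eq derivation_Hder assms])
  then show ?thesis by (subst sum.swap)
qed

lemma GammaZ2_eq:
  assumes "smooth F" "U \<in> FB"
  shows "GammaZ2 A g B F U = (\<Sum>i\<in>UNIV. \<Sum>m\<in>B. (H i (Vder m F) U)\<^sup>2)"
proof -
  have "GammaZ2 A g B F U = (\<Sum>m\<in>B. \<Sum>i\<in>UNIV. (H i (Vder m F) U)\<^sup>2)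
     + (\<Sum>m\<in>B. Vder m F U * (L (Vder m F) U - Vder m (L F) U))"
    unfolding GammaZ2_def
    by (rule iterated_form_eq[where D=Vder, OF _ derivation_Vder[OF B_facts(2)] assms]) (simp add: GammaZ_def)
  also have "(\<Sum>m\<in>B. Vder m F U * (L (Vder m F) U - Vder m (L F) U)) = 0"
    by (intro sum.neutral ballI) (simp add: L_Vder[OF B_facts(2) assms])
  finally show ?thesis by (subst sum.swap) simp
qed

text \<open>The frame is an isometry, so the Ricci bound is applied to the image of the vector with
  components \<open>a j\<close> and expanded by bilinearity.\<close>

lemma ricci_quadratic:
  assumes "U \<in> FB" "\<forall>v\<in>TM A (fst U). ricci A g (fst U) v v \<ge> \<rho> * g (fst U) v v"
  shows "\<rho> * (\<Sum>j\<in>UNIV. (a j)\<^sup>2) \<le>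
    (\<Sum>j\<in>UNIV. a j * (\<Sum>k\<in>UNIV. ricci A g (fst U) (snd U (axis j 1)) (snd U (axis k 1)) * a k))"
proof -
  obtain c where c: "c \<in> A" "fst U \<in> fst c" using frame_in_chart assms(1) by blast
  interpret L: local_metric "img c" "G c" by (rule local_metric_chart[OF c(1)])
  have x: "snd c (fst U) \<in> img c" using c by auto
  let ?a = "(\<chi> j. a j) :: real^'n"
  define b where "b v w = ricci A g (fst U) (snd U v) (snd U w)" for v w
  have b_eq: "b v w = loc_ric (G c) (snd c (fst U)) (snd (fcoord c U) *v v) (snd (fcoord c U) *v w)" for v w
    unfolding b_def frame_vec(2)[OF c(1) assms(1) c(2)] ricci_push[OF c] ..
  have l1: "linear (b v)" and l2: "linear (\<lambda>v. b v w)" for v w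
    unfolding b_eq[abs_def]
    using linear_compose[OF matrix_vector_mul_linear L.linear_loc_ric_right[OF x]]
      linear_compose[OF matrix_vector_mul_linear L.linear_loc_ric_left[OF x]] by (simp_all add: o_def)
  have "b ?a ?a = (\<Sum>j\<in>UNIV. ?a $ j *\<^sub>R b (axis j 1) ?a)" by (rule linear_axis_sum[OF l2])
  also have "\<dots> = (\<Sum>j\<in>UNIV. a j * (\<Sum>k\<in>UNIV. a k * b (axis j 1) (axis k 1)))"
    using linear_axis_sum[OF l1, of _ ?a] by simp
  finally have "b ?a ?a = (\<Sum>j\<in>UNIV. a j * (\<Sum>k\<in>UNIV. ricci A g (fst U) (snd U (axis j 1)) (snd U (axis k 1)) * a k))"
    by (simp add: b_def mult.commute)
  moreover have "\<rho> * (?a \<bullet> ?a) \<le> b ?a ?a"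
    using assms(2) frame_facts(3,4)[OF assms(1)] unfolding b_def by metis
  ultimately show ?thesis by (simp add: inner_vec_def power2_eq_square)
qed

text \<open>The upper curvature bound is assumed for global horizontal fields. Constant coefficients
  \<open>a\<close> give such a field, with components prescribed at any given frame.\<close>

lemma horizontal_field_hvec: "horizontal_vector_field A g (\<lambda>U. hvec U a)"
  unfolding horizontal_vector_field_def vector_field_def
proof (intro conjI ballI)
  fix U assume "U \<in> (\<Union>c\<in>A. fst (K c))"
  then show "hvec U a \<in> TO A g U" using hvec_velocity by (auto simp: tangent_space_def)
next
  fix c assume c: "c \<in> A"
  interpret L: local_metric "img c" "G c" by (rule local_metric_chart[OF c])
  show "smooth_in_chart (K c) (\<lambda>U. hvec U a c)"
    unfolding smooth_in_chart_def
  proof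
    fix U assume "U \<in> fst (K c)"
    then show "\<exists>W h. open W \<and> snd (K c) U \<in> W \<and> smooth_on W h \<and>
        (\<forall>q\<in>fst (K c). snd (K c) q \<in> W \<longrightarrow> hvec q a c = h (snd (K c) q))"
      using L.open_W L.smooth_hor_field c fcoord_in[OF c]
      by (intro exI[of _ L.W] exI[of _ "hor_field (G c) a"]) (auto simp: hvec_def)
  qed
qed (rule hvec_horizontal)

lemma curvature_form_hvec:
  assumes "U \<in> FB"
  shows "curvature_form A g U (fundamental_field A g i U) (hvec U a) = (\<Sum>j\<in>UNIV. a $ j *\<^sub>R Om i j U)"
proof -
  obtain c where c: "c \<in> A" "fst U \<in> fst c" using frame_in_chart assms by blast
  interpret L: local_metric "img c" "G c" by (rule local_metric_chart[OF c(1)])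
  have x: "snd c (fst U) \<in> img c" using c by auto
  have l: "linear (\<lambda>a. curv_frame (G c) (axis i 1) a (fcoord c U))"
    by (rule linearI) (simp_all add: curv_frame_def matvec_simps matmul_simps
        linear_add[OF L.linear_curv_right[OF x]] linear_scale[OF L.linear_curv_right[OF x]])
  have "curvature_form A g U (fundamental_field A g i U) (hvec U a) = curv_frame (G c) (axis i 1) a (fcoord c U)"
    unfolding fundamental_field_eq[OF assms]
    by (rule curvature_form_eq[OF c(1) assms c(2)]) (rule dproj_hvec[OF assms])+
  then show ?thesis using linear_axis_sum[OF l, of a] by (simp add: Om_eq[OF c(1) assms c(2)])
qed

lemma curvature_dimension:
  assumes ric: "\<forall>p\<in>topspace X. \<forall>v\<in>TM A p. ricci A g p v v \<ge> \<rho>\<^sub>1 * g p v v"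
    and lower: "\<forall>M\<in>skew_matrices. \<forall>U\<in>FB. (\<Sum>j\<in>UNIV. \<Sum>k\<in>UNIV.
       (ip (curvature_form A g U (fundamental_field A g j U) (fundamental_field A g k U)) M)\<^sup>2) \<ge> 4 * \<rho>\<^sub>2 * ip M M"
    and upper: "\<forall>Y. horizontal_vector_field A g Y \<longrightarrow>
       (\<forall>U\<in>FB. (\<Sum>i\<in>UNIV. ip (curvature_form A g U (fundamental_field A g i U) (Y U))
                                (curvature_form A g U (fundamental_field A g i U) (Y U)))
              \<le> \<kappa> * horizontal_inner A g U (Y U) (Y U))"
    and f: "smooth f" and U: "U \<in> FB" and \<nu>: "\<nu> > 0"
  shows "Gamma2 A g f U + \<nu> * GammaZ2 A g B f U
    \<ge> 1 / real CARD('n) * (L f U)\<^sup>2 + (\<rho>\<^sub>1 - \<kappa> / \<nu>) * Gamma A g f f U + \<rho>\<^sub>2 * GammaZ B f f U"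
proof -
  define a where "a j = H j f U" for j
  define v where "v m = Vder m f U" for m
  define p where "p i m = H i (Vder m f) U" for i m
  define t where "t i m = (\<Sum>j\<in>UNIV. a j * om m i j U)" for i m
  define x where "x i j = H i (H j f) U" for i j
  have Gam: "Gamma A g f f U = (\<Sum>j\<in>UNIV. (a j)\<^sup>2)" by (simp add: Gamma_eq f U a_def power2_eq_square)
  have GamZ: "GammaZ B f f U = (\<Sum>m\<in>B. (v m)\<^sup>2)" by (simp add: GammaZ_def v_def power2_eq_square)

  have "\<rho>\<^sub>2 * (\<Sum>m\<in>B. (v m)\<^sup>2) \<le> 1/4 * (\<Sum>i\<in>UNIV. \<Sum>j\<in>UNIV. (x i j - x j i)\<^sup>2)"
  proof -
    \<comment> \<open>The vertical gradient of \<open>f\<close> as a skew matrix: its product with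
      \<open>Om i j U\<close> is the vertical derivative of \<open>f\<close> along the curvature,
      which is \<open>x j i - x i j\<close>. The 4 in the lower curvature bound cancels the
      1/4.\<close>
    let ?M = "\<Sum>m\<in>B. v m *\<^sub>R m"
    have M: "?M \<in> skew_matrices" using B_facts(2) by (rule skew_combination)
    have "ip ?M ?M = (\<Sum>m\<in>B. ip ?M m * ip ?M m)" by (rule ip_parseval[OF M M])
    also have "\<dots> = (\<Sum>m\<in>B. (v m)\<^sup>2)" by (intro sum.cong refl) (simp add: ip_combination power2_eq_square)
    finally have MM: "ip ?M ?M = (\<Sum>m\<in>B. (v m)\<^sup>2)" .
    have "(ip (Om i j U) ?M)\<^sup>2 = (x i j - x j i)\<^sup>2" for i j
    proof -
      have "ip (Om i j U) ?M = (\<Sum>m\<in>B. ip (Om i j U) m * ip ?M m)"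
        by (rule ip_parseval[OF Om_skew(1)[OF U] M])
      also have "\<dots> = (\<Sum>m\<in>B. om m i j U * v m)" by (intro sum.cong refl) (simp add: ip_combination om_def)
      finally have "ip (Om i j U) ?M = - (x i j - x j i)"
        using comm_H_H_basis[OF f U, of i j] unfolding x_def v_def by linarith
      then show ?thesis by (simp only: power2_minus)
    qed
    then show ?thesis using bspec[OF bspec[OF lower M] U] unfolding MM Om_def[symmetric] by simp
  qed
  moreover have "1 / real CARD('n) * (L f U)\<^sup>2 + 1/4 * (\<Sum>i\<in>UNIV. \<Sum>j\<in>UNIV. (x i j - x j i)\<^sup>2)
      \<le> (\<Sum>i\<in>UNIV. \<Sum>j\<in>UNIV. (x i j)\<^sup>2)"
    using sum_squares_symmetric_split[of x] unfolding x_def L_eq .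
  ultimately have hess: "1 / real CARD('n) * (L f U)\<^sup>2 + \<rho>\<^sub>2 * (\<Sum>m\<in>B. (v m)\<^sup>2) \<le> (\<Sum>i\<in>UNIV. \<Sum>j\<in>UNIV. (x i j)\<^sup>2)"
    by linarith

  have "(\<Sum>i\<in>UNIV. \<Sum>m\<in>B. (t i m)\<^sup>2) \<le> \<kappa> * (\<Sum>j\<in>UNIV. (a j)\<^sup>2)"
  proof -
    let ?a = "(\<chi> j. a j) :: real^'n"
    \<comment> \<open>The curvature form of the i-th fundamental field with the horizontal gradient
      of \<open>f\<close>; its components in \<open>B\<close> are the \<open>t i m\<close>.\<close>
    let ?N = "\<lambda>i. \<Sum>j\<in>UNIV. ?a $ j *\<^sub>R Om i j U"
    have N: "?N i \<in> skew_matrices" for i using Om_skew(1)[OF U] by (rule skew_combination)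
    have "ip (?N i) m = t i m" if "m \<in> B" for i m
      using ip_sum[of UNIV "\<lambda>j. Om i j U" m "\<lambda>j. ?a $ j"] Om_skew(1)[OF U] B_facts(2)[OF that]
      by (simp add: t_def om_def)
    then have "ip (?N i) (?N i) = (\<Sum>m\<in>B. (t i m)\<^sup>2)" for i
      unfolding ip_parseval[OF N N] by (intro sum.cong refl) (simp add: power2_eq_square)
    moreover have "(\<Sum>i\<in>UNIV. ip (?N i) (?N i)) \<le> \<kappa> * (?a \<bullet> ?a)"
      using upper[rule_format, OF horizontal_field_hvec U, of ?a]
      unfolding curvature_form_hvec[OF U] horizontal_inner_def horizontal_coeffs_hvec[OF U] .
    ultimately show ?thesis by (simp add: inner_vec_def power2_eq_square)
  qed
  then have kap: "(\<Sum>i\<in>UNIV. \<Sum>m\<in>B. (t i m)\<^sup>2) / \<nu> \<le> \<kappa> / \<nu> * (\<Sum>j\<in>UNIV. (a j)\<^sup>2)"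
    using \<nu> by (simp add: field_simps)

  \<comment> \<open>Young's inequality: the weight is chosen so that the squares of \<open>p\<close>
    add up to \<open>\<nu>\<close> times \<open>GammaZ2\<close>; the squares of \<open>t\<close>
    divided by \<open>\<nu>\<close> then become the term with
    \<open>\<kappa> / \<nu>\<close>.\<close>
  have "- (t i m)\<^sup>2 / \<nu> \<le> \<nu> * (p i m)\<^sup>2 - 2 * (t i m * p i m)" for i m
  proof -
    have "0 \<le> (\<nu> * p i m - t i m)\<^sup>2 / \<nu>" using \<nu> by simp
    also have "\<dots> = \<nu> * (p i m)\<^sup>2 - 2 * (t i m * p i m) + (t i m)\<^sup>2 / \<nu>"
      using \<nu> by (simp add: power2_eq_square field_simps)
    finally show ?thesis by simp
  qed
  then have "(\<Sum>i\<in>UNIV. \<Sum>m\<in>B. - (t i m)\<^sup>2 / \<nu>) \<le> (\<Sum>i\<in>UNIV. \<Sum>m\<in>B. \<nu> * (p i m)\<^sup>2 - 2 * (t i m * p i m))"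
    by (intro sum_mono)
  then have young: "- (\<Sum>i\<in>UNIV. \<Sum>m\<in>B. (t i m)\<^sup>2) / \<nu>
      \<le> \<nu> * (\<Sum>i\<in>UNIV. \<Sum>m\<in>B. (p i m)\<^sup>2) - 2 * (\<Sum>i\<in>UNIV. \<Sum>m\<in>B. t i m * p i m)"
    by (simp add: sum_subtractf sum_distrib_left sum_negf sum_divide_distrib)

  have "(\<Sum>j\<in>UNIV. a j * (\<Sum>i\<in>UNIV. \<Sum>m\<in>B. om m i j U * p i m)) = (\<Sum>i\<in>UNIV. \<Sum>m\<in>B. t i m * p i m)"
  proof -
    have "(\<Sum>j\<in>UNIV. a j * (\<Sum>i\<in>UNIV. \<Sum>m\<in>B. om m i j U * p i m)) =
        (\<Sum>j\<in>UNIV. \<Sum>i\<in>UNIV. \<Sum>m\<in>B. a j * om m i j U * p i m)"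
      by (simp add: sum_distrib_left mult.assoc)
    also have "\<dots> = (\<Sum>i\<in>UNIV. \<Sum>j\<in>UNIV. \<Sum>m\<in>B. a j * om m i j U * p i m)" by (rule sum.swap)
    also have "\<dots> = (\<Sum>i\<in>UNIV. \<Sum>m\<in>B. \<Sum>j\<in>UNIV. a j * om m i j U * p i m)"
      by (intro sum.cong refl) (rule sum.swap)
    finally show ?thesis by (simp add: t_def sum_distrib_right)
  qed
  moreover have "(\<Sum>j\<in>UNIV. a j * (- 2 * S j + R j)) = - 2 * (\<Sum>j\<in>UNIV. a j * S j) + (\<Sum>j\<in>UNIV. a j * R j)"
    for S R :: "'n \<Rightarrow> real"
    by (simp only: distrib_left sum.distrib sum_distrib_left mult.left_commute[of _ "- 2"])
  ultimately have "Gamma2 A g f U = (\<Sum>i\<in>UNIV. \<Sum>j\<in>UNIV. (x i j)\<^sup>2) - 2 * (\<Sum>i\<in>UNIV. \<Sum>m\<in>B. t i m * p i m)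
     + (\<Sum>j\<in>UNIV. a j * (\<Sum>k\<in>UNIV. ricci A g (fst U) (snd U (axis j 1)) (snd U (axis k 1)) * a k))"
    unfolding Gamma2_eq[OF f U] L_Hder[OF f U] a_def[symmetric] p_def[symmetric] x_def[symmetric]
    by simp
  moreover have "\<rho>\<^sub>1 * (\<Sum>j\<in>UNIV. (a j)\<^sup>2) \<le>
      (\<Sum>j\<in>UNIV. a j * (\<Sum>k\<in>UNIV. ricci A g (fst U) (snd U (axis j 1)) (snd U (axis k 1)) * a k))"
    by (rule ricci_quadratic[OF U]) (use ric frame_facts(1)[OF U] in blast)
  moreover have "GammaZ2 A g B f U = (\<Sum>i\<in>UNIV. \<Sum>m\<in>B. (p i m)\<^sup>2)"
    by (simp add: GammaZ2_eq f U p_def)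
  ultimately show ?thesis
    unfolding Gam GamZ using hess kap young by (simp add: left_diff_distrib)
qed

end

theorem proposition2p26:
  fixes X :: "'a topology"
    and A :: "('a, 'n::finite) mchart set"
    and g :: "('a, 'n) metric"
    and ip :: "real^'n^'n \<Rightarrow> real^'n^'n \<Rightarrow> real"
    and B :: "(real^'n^'n) set"
    and \<rho>\<^sub>1 \<rho>\<^sub>2 \<kappa> :: real
  assumes "riemannian_manifold X A g" and "connected_space X"
    and "inner_product_on skew_matrices ip"
    and "orthonormal_basis_of skew_matrices ip B"
    and "codazzi_tensor A g (ricci A g)"
    and "\<rho>\<^sub>1 \<ge> 0"
    and "\<forall>p\<in>topspace X. \<forall>v\<in>TM A p. ricci A g p v v \<ge> \<rho>\<^sub>1 * g p v v"
    and "\<rho>\<^sub>2 > 0"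
    and "\<forall>M\<in>skew_matrices. \<forall>U\<in>frame_bundle A g.
           (\<Sum>j\<in>UNIV. \<Sum>k\<in>UNIV.
              (ip (curvature_form A g U (fundamental_field A g j U) (fundamental_field A g k U)) M)\<^sup>2)
           \<ge> 4 * \<rho>\<^sub>2 * ip M M"
    and "\<kappa> \<ge> 0"
    and "\<forall>Y. horizontal_vector_field A g Y \<longrightarrow>
           (\<forall>U\<in>frame_bundle A g.
              (\<Sum>i\<in>UNIV. ip (curvature_form A g U (fundamental_field A g i U) (Y U))
                             (curvature_form A g U (fundamental_field A g i U) (Y U)))
              \<le> \<kappa> * horizontal_inner A g U (Y U) (Y U))"
  shows "\<forall>f. smooth_fun A (frame_chart A g) f \<longrightarrow>
           (\<forall>\<nu>>0. \<forall>U\<in>frame_bundle A g.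
              Gamma2 A g f U + \<nu> * GammaZ2 A g B f U
              \<ge> 1 / real CARD('n) * (horizontal_bochner A g f U)\<^sup>2
                 + (\<rho>\<^sub>1 - \<kappa> / \<nu>) * Gamma A g f f U + \<rho>\<^sub>2 * GammaZ B f f U)"
proof -
  interpret bochner X A g ip B
    by unfold_locales (fact assms(1,3,4,5))+
  show ?thesis using curvature_dimension[OF assms(7,9,11)] by blast
qed

end
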